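(* Let $M$ and $N$ be smooth Banach manifolds modeled on the Banach spaces $\mathbb{E}$ and $\mathbb{E}'$, let $\nabla_M$ and $\nabla_N$ be linear connections on $M$ and $N$, let $g:M\to N$ be a smooth map, and let $k\in\mathbb{N}$. Equip $\pi^k_M:T^kM\to M$ and $\pi^k_N:T^kN\to N$ with the vector bundle structures induced by $\nabla_M$ and $\nabla_N$ respectively. If $\nabla_M$ and $\nabla_N$ are $g$-related, then $T^kg:T^kM\to T^kN$ is a vector bundle morphism (over $g$).
   Context: All manifolds and maps are smooth ($C^\infty$ in the Fréchet sense), modeled on real Banach spaces. **Higher order tangent bundle.** For $x\in M$, two smooth curves $\gamma_1,\gamma_2:(-\epsilon,\epsilon)\to M$ with $\gamma_1(0)=\gamma_2(0)=x$ are $k$-equivalent if (in a chart) their derivatives at $0$ of orders $1,\dots,k$ agree; $[\gamma,x]_k$ is the class of $\gamma$, $T^k_xM$ the set of classes, $T^kM=\bigcup_{x}T^k_xM$, and $\pi^k_M([\gamma,x]_k)=x$. For a chart $(U_\alpha,\phi_\alpha)$ of $M$ put $\phi_\alpha^k([\gamma,x]_k)=\big(\gamma_\alpha(0),\gamma_\alpha'(0),\dots,\tfrac1{k!}\gamma_\alpha^{(k)}(0)\big)\in\phi_\alpha(U_\alpha)\times\mathbb{E}^k$, $\gamma_\alpha=\phi_\alpha\circ\gamma$; these charts make $T^kM$ a smooth fibre bundle over $M$. The $k$'th order differential of $g$ is $T^kg:T^kM\to T^kN$, $T^kg([\gamma,x]_k)=[g\circ\gamma,g(x)]_k$. **Linear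 connections and $g$-relatedness.** A linear connection $\nabla$ on $M$ is given in charts by smooth Christoffel symbols: $\Gamma_\alpha(x,\xi)y$, $x\in\phi_\alpha(U_\alpha)$, bilinear in $(\xi,y)\in\mathbb{E}^2$; its connection map $TTM\to TM$ is locally $(x,\xi;y,\eta)\mapsto(x,\eta+\Gamma_\alpha(x,\xi)y)$. $\nabla_M$ and $\nabla_N$ are $g$-related if their connection maps $K_M,K_N$ satisfy $K_N\circ TTg=Tg\circ K_M$; locally, with $g_{\beta\alpha}=\psi_\beta\circ g\circ\phi_\alpha^{-1}$ for charts $(U_\alpha,\phi_\alpha)$ of $M$ and $(V_\beta,\psi_\beta)$ of $N$ with $g(U_\alpha)\subseteq V_\beta$, $$dg_{\beta\alpha}(x)[\Gamma^M_\alpha(x,\xi)y]=d^2g_{\beta\alpha}(x)(\xi,y)+\Gamma^N_\beta\big(g_{\beta\alpha}(x),dg_{\beta\alpha}(x)\xi\big)dg_{\beta\alpha}(x)y .$$ **Local components induced by a linear connection.** Given $\nabla$ on $M$, define $M^{1}_\alpha(x,\xi_1)y=\Gamma_\alpha(x,\xi_1)y$ and, for $j\ge2$, $$M^{j}_\alpha(x,\xi_1,\dots,\xi_j)y=\frac1j\Big(\sum_{i=1}^{j}\partial_iM^{j-1}_\alpha(x,\xi_1,\dots,\xi_{j-1})(y,i\xi_i)+M^{1}_\alpha(x,\xi_1)\big[M^{j-1}_\alpha(x,\xi_1,\dots,\xi_{j-1})y\big]\Big),$$ where $\partial_iM^{j-1}_\alpha(\cdot)(y,w)$ is the partial derivative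 of $M^{j-1}_\alpha(\cdot)y$ with respect to its $i$-th variable ($x$ being the first, $\xi_{i-1}$ the $i$-th) in the direction $w$. **Induced vector bundle structure on $T^kM$.** It is known that the following maps are trivializations of a smooth vector bundle structure on $\pi^k_M:T^kM\to M$ with fibre $\mathbb{E}^k$, with transition maps $(\xi_1,\dots,\xi_k)\mapsto(d\phi_{\beta\alpha}(x)\xi_1,\dots,d\phi_{\beta\alpha}(x)\xi_k)$, $\phi_{\beta\alpha}=\phi_\beta\circ\phi_\alpha^{-1}$; this is the structure induced by $\nabla$: $$\Phi^k_\alpha:(\pi^k_M)^{-1}(U_\alpha)\to\phi_\alpha(U_\alpha)\times\mathbb{E}^k,\quad [\gamma,x]_k\mapsto(\gamma_\alpha(0),\gamma_\alpha^{(1)}(0),z^2_\alpha,\dots,z^k_\alpha),$$ where for $2\le i\le k$ $$z^i_\alpha=\frac1i\Big\{\frac{\gamma_\alpha^{(i)}(0)}{(i-1)!}+\sum_{j=1}^{i-1}M^{j}_\alpha\Big[\gamma_\alpha(0),\gamma_\alpha^{(1)}(0),\dots,\frac{\gamma_\alpha^{(j)}(0)}{j!}\Big]\frac{\gamma_\alpha^{(i-j)}(0)}{(i-j-1)!}\Big\}.$$ The same construction on $N$ gives trivializations $\Psi^k_\beta$. **Vector bundle morphism.** A fibre preserving map over $g$ that is continuous linear on fibres and such that, in trivializations, $x\mapsto\Psi^k_{\beta,g(x)}\circ T^k_xg\circ(\Phi^k_{\alpha,x})^{-1}$ is a smooth map from $U_\alpha$ (for $g(U_\alpha)\subseteq V_\beta$)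 into the Banach space $\mathcal{L}(\mathbb{E}^k,\mathbb{E}'^k)$ of continuous linear maps. *)

theory Defs
  imports "HOL-Analysis.Analysis"
begin

section \<open>Smooth maps between open subsets of normed spaces\<close>

text \<open>Elements of \<open>L\<^sup>n(E; F)\<close>, the continuous \<open>n\<close>-multilinear maps, are represented as functions on
  lists, of which only the values on lists of length \<open>n\<close> matter.\<close>

definition bounded_multilinear ::
    "nat \<Rightarrow> ('a::real_normed_vector list \<Rightarrow> 'b::real_normed_vector) \<Rightarrow> bool" where
  "bounded_multilinear n m \<longleftrightarrow>
     (\<forall>vs. length vs = n \<longrightarrow> (\<forall>i<n. linear (\<lambda>v. m (vs[i := v])))) \<and>
     (\<exists>C. \<forall>vs. length vs = n \<longrightarrow> norm (m vs) \<le> C * prod_list (map norm vs))"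

text \<open>\<open>C\<^sup>\<infinity>\<close> in the Frechet sense: \<open>D n x\<close> is the \<open>n\<close>-th derivative at \<open>x\<close>. The last clause says that
  \<open>D n\<close> is Frechet differentiable at \<open>x\<close> with respect to the operator norm of \<open>L\<^sup>n(E; F)\<close>, with
  derivative \<open>D (Suc n) x\<close> under the identification \<open>L(E, L\<^sup>n(E; F)) = L\<^sup>n\<^sup>+\<^sup>1(E; F)\<close>. Nested types
  \<open>'a \<Rightarrow>\<^sub>L 'a \<Rightarrow>\<^sub>L \<dots> 'b\<close> cannot be used, as \<open>n\<close> is quantified.\<close>

definition smooth_on ::
    "'a::real_normed_vector set \<Rightarrow> ('a \<Rightarrow> 'b::real_normed_vector) \<Rightarrow> bool" where
  "smooth_on S f \<longleftrightarrow> open S \<and>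
     (\<exists>D :: nat \<Rightarrow> 'a \<Rightarrow> 'a list \<Rightarrow> 'b.
        (\<forall>x\<in>S. D 0 x [] = f x) \<and>
        (\<forall>n. \<forall>x\<in>S. bounded_multilinear n (D n x)) \<and>
        (\<forall>n. \<forall>x\<in>S. \<forall>e>0. \<exists>d>0. \<forall>h. norm h < d \<longrightarrow>
           (\<forall>vs. length vs = n \<longrightarrow>
              norm (D n (x + h) vs - D n x vs - D (Suc n) x (h # vs))
                \<le> e * norm h * prod_list (map norm vs))))"


section \<open>Manifolds\<close>

text \<open>A manifold is given by an atlas on a set of points; its topology is the one determined by the
  atlas. A chart is a pair of a domain and a map, whose values outside the domain are irrelevant.
  No separation or countability axiom is imposed.\<close>

type_synonym ('m, 'e) chart = "'m set \<times> ('m \<Rightarrow> 'e)"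

definition is_chart :: "('m, 'e::banach) chart \<Rightarrow> bool" where
  "is_chart = (\<lambda>(U, \<phi>). inj_on \<phi> U \<and> open (\<phi> ` U))"

definition compatible :: "('m, 'e::banach) chart \<Rightarrow> ('m, 'e) chart \<Rightarrow> bool" where
  "compatible = (\<lambda>(U, \<phi>) (V, \<psi>).
     smooth_on (\<phi> ` (U \<inter> V)) (\<psi> \<circ> inv_into U \<phi>) \<and>
     smooth_on (\<psi> ` (U \<inter> V)) (\<phi> \<circ> inv_into V \<psi>))"

definition points :: "('m, 'e::banach) chart set \<Rightarrow> 'm set" where
  "points A = (\<Union>c\<in>A. fst c)"

definition banach_manifold :: "('m, 'e::banach) chart set \<Rightarrow> bool" where
  "banach_manifold A \<longleftrightarrow> (\<forall>c\<in>A. is_chart c) \<and> (\<forall>c\<in>A. \<forall>d\<in>A. compatible c d)"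

text \<open>The maximal atlas containing \<open>A\<close>.\<close>

definition charts :: "('m, 'e::banach) chart set \<Rightarrow> ('m, 'e) chart set" where
  "charts A = {c. is_chart c \<and> fst c \<subseteq> points A \<and> (\<forall>d\<in>A. compatible c d)}"

definition smooth_map ::
    "('m, 'e::banach) chart set \<Rightarrow> ('n, 'f::banach) chart set \<Rightarrow> ('m \<Rightarrow> 'n) \<Rightarrow> bool" where
  "smooth_map A B g \<longleftrightarrow>
     (\<forall>x\<in>points A. \<exists>(U, \<phi>)\<in>charts A. \<exists>(V, \<psi>)\<in>charts B.
        x \<in> U \<and> g ` U \<subseteq> V \<and> smooth_on (\<phi> ` U) (\<psi> \<circ> g \<circ> inv_into U \<phi>))"


section \<open>Higher order tangent bundles\<close>

text \<open>Curves are total functions, of which only the germ at \<open>0\<close> matters.\<close>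

definition smooth_curve :: "('m, 'e::banach) chart set \<Rightarrow> (real \<Rightarrow> 'm) \<Rightarrow> bool" where
  "smooth_curve A \<gamma> \<longleftrightarrow> (\<exists>\<epsilon>>0. smooth_map {({-\<epsilon><..<\<epsilon>}, id)} A \<gamma>)"

definition curve_deriv :: "nat \<Rightarrow> (real \<Rightarrow> 'e::real_normed_vector) \<Rightarrow> real \<Rightarrow> 'e" where
  "curve_deriv n = ((\<lambda>c t. vector_derivative c (at t)) ^^ n)"

definition jet_equiv ::
    "nat \<Rightarrow> ('m, 'e::banach) chart set \<Rightarrow> (real \<Rightarrow> 'm) \<Rightarrow> (real \<Rightarrow> 'm) \<Rightarrow> bool" where
  "jet_equiv k A \<gamma> \<delta> \<longleftrightarrow> smooth_curve A \<gamma> \<and> smooth_curve A \<delta> \<and> \<gamma> 0 = \<delta> 0 \<and>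
     (\<exists>(U, \<phi>)\<in>charts A. \<gamma> 0 \<in> U \<and>
        (\<forall>i\<in>{1..k}. curve_deriv i (\<phi> \<circ> \<gamma>) 0 = curve_deriv i (\<phi> \<circ> \<delta>) 0))"

type_synonym 'm jet = "(real \<Rightarrow> 'm) set"

definition jet :: "nat \<Rightarrow> ('m, 'e::banach) chart set \<Rightarrow> (real \<Rightarrow> 'm) \<Rightarrow> 'm jet" where
  "jet k A \<gamma> = {\<delta>. jet_equiv k A \<gamma> \<delta>}"

definition tangent_bundle :: "nat \<Rightarrow> ('m, 'e::banach) chart set \<Rightarrow> 'm jet set" where
  "tangent_bundle k A = {jet k A \<gamma> |\<gamma>. smooth_curve A \<gamma>}"

definition jet_rep :: "'m jet \<Rightarrow> (real \<Rightarrow> 'm)" where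
  "jet_rep w = (SOME \<gamma>. \<gamma> \<in> w)"

definition jet_proj :: "'m jet \<Rightarrow> 'm" where
  "jet_proj w = jet_rep w 0"

definition tangent_map ::
    "nat \<Rightarrow> ('n, 'f::banach) chart set \<Rightarrow> ('m \<Rightarrow> 'n) \<Rightarrow> 'm jet \<Rightarrow> 'n jet" where
  "tangent_map k B g w = jet k B (g \<circ> jet_rep w)"

text \<open>The manifold structure of \<open>TM = T\<^sup>1M\<close>; applied twice it gives the one of \<open>TTM\<close>.\<close>

definition tangent_chart :: "('m \<Rightarrow> 'e::banach) \<Rightarrow> 'm jet \<Rightarrow> 'e \<times> 'e" where
  "tangent_chart \<phi> w = (\<phi> (jet_proj w), curve_deriv 1 (\<phi> \<circ> jet_rep w) 0)"

definition tangent_atlas :: "('m, 'e::banach) chart set \<Rightarrow> ('m jet, 'e \<times> 'e) chart set" where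
  "tangent_atlas A =
     {({w \<in> tangent_bundle 1 A. jet_proj w \<in> U}, tangent_chart \<phi>) |U \<phi>. (U, \<phi>) \<in> charts A}"


section \<open>Linear connections\<close>

text \<open>A linear connection consists of its Christoffel symbols \<open>\<Gamma> c :: E \<rightarrow> L(E, L(E, E))\<close>, one for
  each chart \<open>c\<close>, and its connection map \<open>K : TTM \<rightarrow> TM\<close>. That the local formulas define one global
  map \<open>K\<close> is the compatibility condition on the Christoffel symbols of different charts.\<close>

type_synonym ('m, 'e) christoffel = "('m, 'e) chart \<Rightarrow> 'e \<Rightarrow> 'e \<Rightarrow>\<^sub>L 'e \<Rightarrow>\<^sub>L 'e"

definition linear_connection ::
    "('m, 'e::banach) chart set \<Rightarrow> ('m, 'e) christoffel \<Rightarrow> ('m jet jet \<Rightarrow> 'm jet) \<Rightarrow> bool" where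
  "linear_connection A \<Gamma> K \<longleftrightarrow>
     (\<forall>(U, \<phi>)\<in>charts A. smooth_on (\<phi> ` U) (\<Gamma> (U, \<phi>))) \<and>
     (\<forall>w\<in>tangent_bundle 1 (tangent_atlas A). K w \<in> tangent_bundle 1 A \<and>
        (\<forall>(U, \<phi>)\<in>charts A. jet_proj (jet_proj w) \<in> U \<longrightarrow>
           jet_proj (K w) \<in> U \<and>
           (let ((x, \<xi>), (y, \<eta>)) = tangent_chart (tangent_chart \<phi>) w
            in tangent_chart \<phi> (K w) = (x, \<eta> + \<Gamma> (U, \<phi>) x \<xi> y))))"

definition connections_related ::
    "('m, 'e::banach) chart set \<Rightarrow> ('n, 'f::banach) chart set \<Rightarrow> ('m \<Rightarrow> 'n) \<Rightarrow>
     ('m jet jet \<Rightarrow> 'm jet) \<Rightarrow> ('n jet jet \<Rightarrow> 'n jet) \<Rightarrow> bool" where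
  "connections_related A B g K\<^sub>M K\<^sub>N \<longleftrightarrow>
     (\<forall>w\<in>tangent_bundle 1 (tangent_atlas A).
        K\<^sub>N (tangent_map 1 (tangent_atlas B) (tangent_map 1 B g) w) = tangent_map 1 B g (K\<^sub>M w))"


section \<open>The induced trivializations\<close>

text \<open>The arguments \<open>(x, \<xi>\<^sub>1, \<dots>, \<xi>\<^sub>j)\<close> are encoded as a sequence \<open>\<zeta>\<close> with \<open>\<zeta> 0 = x\<close> and \<open>\<zeta> i = \<xi>\<^sub>i\<close>, so
  that the \<open>i\<close>-th variable (counted from \<open>1\<close>) is \<open>\<zeta> (i - 1)\<close>.\<close>

definition partial_deriv ::
    "nat \<Rightarrow> ((nat \<Rightarrow> 'e::real_normed_vector) \<Rightarrow> 'e) \<Rightarrow> (nat \<Rightarrow> 'e) \<Rightarrow> 'e \<Rightarrow> 'e" where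
  "partial_deriv i F \<zeta> w = frechet_derivative (\<lambda>u. F (\<zeta>(i - 1 := u))) (at (\<zeta> (i - 1))) w"

text \<open>\<open>local_component G j \<zeta> y\<close> is \<open>M\<^sup>j(x, \<xi>\<^sub>1, \<dots>, \<xi>\<^sub>j) y\<close> for Christoffel symbols \<open>G\<close>. The value for
  \<open>j = 0\<close> is not used.\<close>

fun local_component ::
    "('e::banach \<Rightarrow> 'e \<Rightarrow>\<^sub>L 'e \<Rightarrow>\<^sub>L 'e) \<Rightarrow> nat \<Rightarrow> (nat \<Rightarrow> 'e) \<Rightarrow> 'e \<Rightarrow> 'e" where
  "local_component G 0 \<zeta> y = 0"
| "local_component G (Suc 0) \<zeta> y = G (\<zeta> 0) (\<zeta> 1) y"
| "local_component G (Suc (Suc n)) \<zeta> y =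
     (1 / real (Suc (Suc n))) *\<^sub>R
       ((\<Sum>i=1..Suc (Suc n).
           partial_deriv i (\<lambda>\<zeta>'. local_component G (Suc n) \<zeta>' y) \<zeta> (real i *\<^sub>R \<zeta> i)) +
        G (\<zeta> 0) (\<zeta> 1) (local_component G (Suc n) \<zeta> y))"

text \<open>\<open>z\<^sup>i\<close> of a curve \<open>c\<close> in the model space; for \<open>i = 1\<close> the formula reduces to \<open>c'(0)\<close>.\<close>

definition z_coord ::
    "('e::banach \<Rightarrow> 'e \<Rightarrow>\<^sub>L 'e \<Rightarrow>\<^sub>L 'e) \<Rightarrow> (real \<Rightarrow> 'e) \<Rightarrow> nat \<Rightarrow> 'e" where
  "z_coord G c i =
     (1 / real i) *\<^sub>R
       ((1 / fact (i - 1)) *\<^sub>R curve_deriv i c 0 +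
        (\<Sum>j=1..i-1.
           local_component G j (\<lambda>l. (1 / fact l) *\<^sub>R curve_deriv l c 0)
             ((1 / fact (i - j - 1)) *\<^sub>R curve_deriv (i - j) c 0)))"

text \<open>\<open>E\<^sup>k\<close> is the Banach space \<open>'e ^ 'k\<close> with \<open>k = CARD('k)\<close>; the order on \<open>'k\<close> identifies it with
  \<open>{1..k}\<close>.\<close>

definition index :: "'k::{finite,linorder} \<Rightarrow> nat" where
  "index i = card {..i}"

definition induced_triv ::
    "('m, 'e::banach) christoffel \<Rightarrow> ('m, 'e) chart \<Rightarrow> 'm jet \<Rightarrow> 'e \<times> ('e ^ 'k::{finite,linorder})"
  where
  "induced_triv \<Gamma> c w =
     (snd c (jet_proj w), \<chi> i. z_coord (\<Gamma> c) (snd c \<circ> jet_rep w) (index i))"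


section \<open>Vector bundles and their morphisms\<close>

text \<open>The structure of a vector bundle is given by a trivialization over each chart domain of the
  base; the vector space structure and topology of a fibre are transported from the typical fibre
  \<open>'v\<close>.\<close>

record ('p, 'm, 'e, 'v) vbundle =
  base_atlas :: "('m, 'e) chart set"
  total_space :: "'p set"
  bundle_proj :: "'p \<Rightarrow> 'm"
  triv :: "('m, 'e) chart \<Rightarrow> 'p \<Rightarrow> 'e \<times> 'v"

definition fibre :: "('p, 'm, 'e, 'v) vbundle \<Rightarrow> 'm \<Rightarrow> 'p set" where
  "fibre X x = {p \<in> total_space X. bundle_proj X p = x}"

definition triv_at :: "('p, 'm, 'e, 'v) vbundle \<Rightarrow> ('m, 'e) chart \<Rightarrow> 'm \<Rightarrow> 'p \<Rightarrow> 'v" where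
  "triv_at X c x p = snd (triv X c p)"

definition fibre_map ::
    "('p, 'm, 'e, 'v) vbundle \<Rightarrow> ('q, 'n, 'f, 'w) vbundle \<Rightarrow> ('m \<Rightarrow> 'n) \<Rightarrow> ('p \<Rightarrow> 'q) \<Rightarrow>
     ('m, 'e) chart \<Rightarrow> ('n, 'f) chart \<Rightarrow> 'm \<Rightarrow> 'v \<Rightarrow> 'w" where
  "fibre_map X Y g F c d x = triv_at Y d (g x) \<circ> F \<circ> inv_into (fibre X x) (triv_at X c x)"

definition vbundle_morphism ::
    "('p, 'm, 'e::banach, 'v::banach) vbundle \<Rightarrow> ('q, 'n, 'f::banach, 'w::banach) vbundle \<Rightarrow>
     ('m \<Rightarrow> 'n) \<Rightarrow> ('p \<Rightarrow> 'q) \<Rightarrow> bool" where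
  "vbundle_morphism X Y g F \<longleftrightarrow>
     (\<forall>p\<in>total_space X. F p \<in> total_space Y \<and> bundle_proj Y (F p) = g (bundle_proj X p)) \<and>
     (\<forall>(U, \<phi>)\<in>charts (base_atlas X). \<forall>(V, \<psi>)\<in>charts (base_atlas Y).
        (\<forall>x\<in>U. g x \<in> V \<longrightarrow> bounded_linear (fibre_map X Y g F (U, \<phi>) (V, \<psi>) x)) \<and>
        (g ` U \<subseteq> V \<longrightarrow>
           smooth_on (\<phi> ` U)
             (\<lambda>u. Blinfun (fibre_map X Y g F (U, \<phi>) (V, \<psi>) (inv_into U \<phi> u)))))"

definition induced_bundle ::
    "nat \<Rightarrow> ('m, 'e::banach) chart set \<Rightarrow> ('m, 'e) christoffel \<Rightarrow>
     ('m jet, 'm, 'e, 'e ^ 'k::{finite,linorder}) vbundle" where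
  "induced_bundle k A \<Gamma> =
     \<lparr>base_atlas = A, total_space = tangent_bundle k A, bundle_proj = jet_proj,
       triv = induced_triv \<Gamma>\<rparr>"

end

theory Submission
  imports Defs
begin

text \<open>Along a curve \<open>c\<close> in a chart, \<open>j! M\<^sup>j\<close> is the \<open>j\<close>-th iterate of \<open>\<nabla> = d/dt + \<Gamma>(c, c')\<close>
  applied to constant fields, because the sum over the partial derivatives in the recursion for
  \<open>M\<^sup>j\<close> is the time derivative of \<open>M\<^sup>j\<^sup>-\<^sup>1\<close> along the Taylor coefficients of \<open>c\<close>. By the Leibniz
  rule, \<open>z\<^sup>i = \<nabla>\<^sup>i\<^sup>-\<^sup>1 c' / i!\<close>. If the connections are \<open>g\<close>-related, then \<open>dg(c)\<close> intertwines the
  operators \<open>\<nabla>\<close> along \<open>c\<close> and along \<open>g \<circ> c\<close>, and hence \<open>z\<^sup>i(g \<circ> c) = dg(c(0)) z\<^sup>i(c)\<close>: in the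
  trivializations \<open>T\<^sup>kg\<close> is \<open>dg(x)\<close> in each component, which is linear and smooth in \<open>x\<close>. Since
  \<open>fibre_map\<close> inverts a trivialization by a choice of preimages, only its surjectivity on fibres
  is needed.\<close>

section \<open>Calculus of smooth maps\<close>

subsection \<open>Multilinear maps on lists\<close>

text \<open>Three obstacles shape the proof. (1) Smoothness is given by an unspecified family of
  multilinear maps. Once the family is made canonical, composites are handled by Faa di Bruno's sum
  over set partitions; the same sum shows that \<open>k\<close>-jets do not depend on the chart. (2)
  The number of variables of \<open>M^j\<close> grows with \<open>j\<close>. As an operator-valued
  function of one bounded sequence, \<open>M^j\<close> has a single derivative, and the factor
  \<open>i\<close> in the direction \<open>i xi_i\<close> of the recursion is the one in d/dt
  (c^(i-1)/(i-1)!) = i (c^(i)/i!). (3) In the original charts of \<open>T^kM\<close> the map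
  \<open>T^kg\<close> is polynomial in the fibre and contains all derivatives of \<open>g\<close> up
  to order \<open>k\<close>. Only the first survives in the induced trivializations: each covariant
  differentiation produces one second derivative of \<open>g\<close>, and relatedness says that it
  is exactly the defect between the two Christoffel terms. As every induction step differentiates
  the identity of the preceding one, that identity is needed on an interval around 0, although
  \<open>z^i\<close> is evaluated at 0 only.\<close>

abbreviation prod_norm :: "'a::real_normed_vector list \<Rightarrow> real" where
  "prod_norm vs \<equiv> prod_list (map norm vs)"

lemma prod_norm_nonneg [simp]: "0 \<le> prod_norm vs"
  by (induction vs) auto

lemma bounded_multilinearI:
  assumes "\<And>vs i. length vs = n \<Longrightarrow> i < n \<Longrightarrow> linear (\<lambda>v. m (vs[i := v]))"
    and "\<And>vs. length vs = n \<Longrightarrow> norm (m vs) \<le> C * prod_norm vs"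
  shows "bounded_multilinear n m"
  using assms unfolding bounded_multilinear_def by blast

lemma bounded_multilinear_linear:
  "bounded_multilinear n m \<Longrightarrow> length vs = n \<Longrightarrow> i < n \<Longrightarrow> linear (\<lambda>v. m (vs[i := v]))"
  unfolding bounded_multilinear_def by blast

text \<open>The constant is made strictly positive because the estimates below divide by it.\<close>

lemma bounded_multilinear_pos_bound:
  assumes "bounded_multilinear n m"
  obtains C where "C > 0" "\<And>vs. length vs = n \<Longrightarrow> norm (m vs) \<le> C * prod_norm vs"
proof -
  obtain C where C: "\<And>vs. length vs = n \<Longrightarrow> norm (m vs) \<le> C * prod_norm vs"
    using assms unfolding bounded_multilinear_def by blast
  have "norm (m vs) \<le> (\<bar>C\<bar> + 1) * prod_norm vs" if "length vs = n" for vs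
    by (rule order_trans[OF C[OF that]]) (intro mult_right_mono, auto)
  then show thesis using that[of "\<bar>C\<bar> + 1"] by auto
qed

lemma bounded_multilinear_cong:
  assumes "\<And>vs. length vs = n \<Longrightarrow> m vs = m' vs"
  shows "bounded_multilinear n m \<longleftrightarrow> bounded_multilinear n m'"
  using assms unfolding bounded_multilinear_def by (auto simp: cong: conj_cong)

lemma bounded_multilinear_bounded_linear_hd:
  assumes m: "bounded_multilinear (Suc n) m" and "length vs = n"
  shows "bounded_linear (\<lambda>v. m (v # vs))"
proof -
  obtain C where "C > 0" and C: "\<And>vs. length vs = Suc n \<Longrightarrow> norm (m vs) \<le> C * prod_norm vs"
    using bounded_multilinear_pos_bound[OF m] by blast
  have "linear (\<lambda>v. m ((0 # vs)[0 := v]))"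
    using m assms(2) by (intro bounded_multilinear_linear) auto
  then have "linear (\<lambda>v. m (v # vs))" by simp
  moreover have "norm (m (v # vs)) \<le> norm v * (C * prod_norm vs)" for v
    using C[of "v # vs"] assms(2) by (simp add: algebra_simps)
  ultimately show ?thesis
    by (intro bounded_linear.intro bounded_linear_axioms.intro) blast+
qed

lemma bounded_multilinear_Cons:
  assumes m: "bounded_multilinear (Suc n) m"
  shows "bounded_multilinear n (\<lambda>vs. m (v # vs))"
proof -
  obtain C where "C > 0" and C: "\<And>vs. length vs = Suc n \<Longrightarrow> norm (m vs) \<le> C * prod_norm vs"
    using bounded_multilinear_pos_bound[OF m] by blast
  show ?thesis
  proof (rule bounded_multilinearI)
    fix vs :: "'a list" and i assume "length vs = n" "i < n"
    then show "linear (\<lambda>w. m (v # vs[i := w]))"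
      using bounded_multilinear_linear[OF m, of "v # vs" "Suc i"] by simp
  next
    fix vs :: "'a list" assume "length vs = n"
    then show "norm (m (v # vs)) \<le> (C * norm v) * prod_norm vs"
      using C[of "v # vs"] by (simp add: algebra_simps)
  qed
qed

lemma bounded_multilinear_add:
  assumes "bounded_multilinear n m" "bounded_multilinear n m'"
  shows "bounded_multilinear n (\<lambda>vs. m vs + m' vs)"
proof -
  obtain C where C: "\<And>vs. length vs = n \<Longrightarrow> norm (m vs) \<le> C * prod_norm vs"
    using bounded_multilinear_pos_bound[OF assms(1)] by blast
  obtain C' where C': "\<And>vs. length vs = n \<Longrightarrow> norm (m' vs) \<le> C' * prod_norm vs"
    using bounded_multilinear_pos_bound[OF assms(2)] by blast
  show ?thesis
  proof (rule bounded_multilinearI)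
    fix vs :: "'a list" and i assume "length vs = n" "i < n"
    then show "linear (\<lambda>w. m (vs[i := w]) + m' (vs[i := w]))"
      by (intro linear_compose_add bounded_multilinear_linear[OF assms(1)]
          bounded_multilinear_linear[OF assms(2)])
  next
    fix vs :: "'a list" assume "length vs = n"
    then show "norm (m vs + m' vs) \<le> (C + C') * prod_norm vs"
      using norm_triangle_le[OF add_mono[OF C C'], of vs vs] by (simp add: algebra_simps)
  qed
qed


subsection \<open>Differentiating multilinear maps along a curve\<close>

text \<open>\<open>M'\<close> is the derivative at 0 of a curve in the space of
  \<open>n\<close>-linear maps with its operator norm, spelled out because these maps do not form a
  type. Uniformity in \<open>vs\<close> is what later allows arguments that move with
  \<open>t\<close>.\<close>

definition multilinear_deriv ::
    "nat \<Rightarrow> (real \<Rightarrow> 'a::real_normed_vector list \<Rightarrow> 'b::real_normed_vector) \<Rightarrow> ('a list \<Rightarrow> 'b) \<Rightarrow> bool"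
  where
  "multilinear_deriv n M M' \<longleftrightarrow>
     (\<forall>e>0. \<forall>\<^sub>F t in nhds 0. \<forall>vs. length vs = n \<longrightarrow>
        norm (M t vs - M 0 vs - t *\<^sub>R M' vs) \<le> e * \<bar>t\<bar> * prod_norm vs)"

lemma has_vector_derivative_at_0_iff:
  "(w has_vector_derivative w') (at 0) \<longleftrightarrow>
     (\<forall>e>0. \<forall>\<^sub>F t in nhds 0. norm (w t - w 0 - t *\<^sub>R w') \<le> e * \<bar>t\<bar>)"
  unfolding has_vector_derivative_def has_derivative_at_alt eventually_nhds_metric
  by (auto simp: bounded_linear_scaleR_left dist_norm)

lemma multilinear_deriv_0:
  assumes "multilinear_deriv 0 M M'"
  shows "((\<lambda>t. M t []) has_vector_derivative M' []) (at 0)"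
  unfolding has_vector_derivative_at_0_iff using assms by (simp add: multilinear_deriv_def)

text \<open>Product rule for filling the first slot with a curve. The estimate stays uniform in the
  other slots, so that they can be filled one after the other.\<close>

lemma multilinear_deriv_Cons:
  assumes M: "multilinear_deriv (Suc n) M M'"
    and bM: "bounded_multilinear (Suc n) (M 0)" and bM': "bounded_multilinear (Suc n) M'"
    and w: "(w has_vector_derivative w') (at 0)"
  shows "multilinear_deriv n (\<lambda>t vs. M t (w t # vs)) (\<lambda>vs. M' (w 0 # vs) + M 0 (w' # vs))"
  unfolding multilinear_deriv_def
proof (intro allI impI)
  fix e :: real assume "e > 0"
  obtain C where "C > 0" and C: "\<And>vs. length vs = Suc n \<Longrightarrow> norm (M 0 vs) \<le> C * prod_norm vs"
    using bounded_multilinear_pos_bound[OF bM] by blast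
  obtain C' where "C' > 0" and C': "\<And>vs. length vs = Suc n \<Longrightarrow> norm (M' vs) \<le> C' * prod_norm vs"
    using bounded_multilinear_pos_bound[OF bM'] by blast
  define B where "B = norm (w 0) + 1"
  have "B > 0" by (auto simp: B_def add_nonneg_pos)
  have cont: "(w \<longlongrightarrow> w 0) (nhds 0)"
    using has_vector_derivative_continuous[OF w] by (simp add: continuous_at tendsto_nhds_iff)
  \<comment> \<open>The bound 1 keeps \<open>w t\<close> in the ball of radius \<open>B\<close>; the
    other bound makes the error from replacing \<open>w t\<close> by \<open>w 0\<close> inside
    \<open>M'\<close> small.\<close>
  have 1: "\<forall>\<^sub>F t in nhds 0. norm (w t - w 0) < min 1 (e / (3 * C'))"
    using tendstoD[OF cont, of "min 1 (e / (3 * C'))"] \<open>e > 0\<close> \<open>C' > 0\<close> by (simp add: dist_norm)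
  have 2: "\<forall>\<^sub>F t in nhds 0. norm (w t - w 0 - t *\<^sub>R w') \<le> (e / (3 * C)) * \<bar>t\<bar>"
    using w[unfolded has_vector_derivative_at_0_iff, rule_format, of "e / (3 * C)"] \<open>e > 0\<close> \<open>C > 0\<close>
      by simp
  have 3: "\<forall>\<^sub>F t in nhds 0. \<forall>vs. length vs = Suc n \<longrightarrow>
        norm (M t vs - M 0 vs - t *\<^sub>R M' vs) \<le> (e / (3 * B)) * \<bar>t\<bar> * prod_norm vs"
    using M[unfolded multilinear_deriv_def, rule_format, of "e / (3 * B)"] \<open>e > 0\<close> \<open>B > 0\<close> by simp
  show "\<forall>\<^sub>F t in nhds 0. \<forall>vs. length vs = n \<longrightarrow>
        norm (M t (w t # vs) - M 0 (w 0 # vs) - t *\<^sub>R (M' (w 0 # vs) + M 0 (w' # vs)))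
          \<le> e * \<bar>t\<bar> * prod_norm vs"
    using 1 2 3
  proof eventually_elim
    case (elim t)
    show ?case
    proof (intro allI impI)
      fix vs :: "'a list" assume vs: "length vs = n"
      let ?P = "prod_norm vs"
      interpret M0: bounded_linear "\<lambda>v. M 0 (v # vs)"
        by (rule bounded_multilinear_bounded_linear_hd[OF bM vs])
      interpret M': bounded_linear "\<lambda>v. M' (v # vs)"
        by (rule bounded_multilinear_bounded_linear_hd[OF bM' vs])
      have wB: "norm (w t) \<le> B"
        using elim(1) norm_triangle_sub[of "w t" "w 0"] by (auto simp: B_def)
      have "norm (M t (w t # vs) - M 0 (w t # vs) - t *\<^sub>R M' (w t # vs))
              \<le> (e / (3 * B)) * \<bar>t\<bar> * (norm (w t) * ?P)"
        using elim(3) vs by (metis length_Cons list.simps(9) prod_list.Cons)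
      also have "\<dots> \<le> (e / (3 * B)) * \<bar>t\<bar> * (B * ?P)"
        using wB \<open>e > 0\<close> \<open>B > 0\<close> by (intro mult_left_mono mult_right_mono) auto
      finally have a: "norm (M t (w t # vs) - M 0 (w t # vs) - t *\<^sub>R M' (w t # vs))
              \<le> e / 3 * \<bar>t\<bar> * ?P" using \<open>B > 0\<close> by simp
      have "norm (M' ((w t - w 0) # vs)) \<le> C' * (norm (w t - w 0) * ?P)"
        using C'[of "(w t - w 0) # vs"] vs by simp
      also have "\<dots> \<le> C' * (e / (3 * C') * ?P)"
        using elim(1) \<open>C' > 0\<close> by (intro mult_left_mono mult_right_mono) auto
      finally have "norm (M' ((w t - w 0) # vs)) \<le> e / 3 * ?P" using \<open>C' > 0\<close> by simp
      from mult_left_mono[OF this, of "\<bar>t\<bar>"]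
      have b: "norm (t *\<^sub>R M' ((w t - w 0) # vs)) \<le> e / 3 * \<bar>t\<bar> * ?P" by (simp add: algebra_simps)
      have "norm (M 0 ((w t - w 0 - t *\<^sub>R w') # vs)) \<le> C * (norm (w t - w 0 - t *\<^sub>R w') * ?P)"
        using C[of "(w t - w 0 - t *\<^sub>R w') # vs"] vs by simp
      also have "\<dots> \<le> C * ((e / (3 * C)) * \<bar>t\<bar> * ?P)"
        using elim(2) \<open>C > 0\<close> by (intro mult_left_mono mult_right_mono) auto
      finally have c: "norm (M 0 ((w t - w 0 - t *\<^sub>R w') # vs)) \<le> e / 3 * \<bar>t\<bar> * ?P" 
        using \<open>C > 0\<close> by simp
      \<comment> \<open>Three errors, each worth \<open>e / 3\<close>: the increment of the map at
        the moved argument, the moved argument inside \<open>M'\<close>, and the linearization of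
        \<open>w\<close> inside \<open>M 0\<close>.\<close>
      have "M t (w t # vs) - M 0 (w 0 # vs) - t *\<^sub>R (M' (w 0 # vs) + M 0 (w' # vs)) =
          (M t (w t # vs) - M 0 (w t # vs) - t *\<^sub>R M' (w t # vs)) + t *\<^sub>R M' ((w t - w 0) # vs)
          + M 0 ((w t - w 0 - t *\<^sub>R w') # vs)"
        by (simp add: M0.diff M0.add M0.scaleR M'.diff algebra_simps)
      also have "norm \<dots> \<le> e / 3 * \<bar>t\<bar> * ?P + e / 3 * \<bar>t\<bar> * ?P + e / 3 * \<bar>t\<bar> * ?P"
        by (intro norm_triangle_le add_mono a b c)
      finally show "norm (M t (w t # vs) - M 0 (w 0 # vs) - t *\<^sub>R (M' (w 0 # vs) + M 0 (w' # vs)))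
          \<le> e * \<bar>t\<bar> * ?P" by (simp add: algebra_simps)
    qed
  qed
qed

text \<open>Leibniz rule: either the map or one of its arguments is differentiated. The arguments
  are images of a list of labels because in the chain rule the labels are the blocks of a
  partition.\<close>

lemma multilinear_deriv_map:
  assumes "multilinear_deriv (length Ps) M M'"
    and "bounded_multilinear (length Ps) (M 0)" and "bounded_multilinear (length Ps) M'"
    and "\<And>p. p \<in> set Ps \<Longrightarrow> ((\<lambda>t. w t p) has_vector_derivative w' p) (at 0)"
  shows "((\<lambda>t. M t (map (w t) Ps)) has_vector_derivative
      M' (map (w 0) Ps) + (\<Sum>j\<leftarrow>[0..<length Ps]. M 0 ((map (w 0) Ps)[j := w' (Ps ! j)]))) (at 0)"
  using assms
proof (induction Ps arbitrary: M M')
  case Nil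
  then show ?case using multilinear_deriv_0[of M M'] by simp
next
  case (Cons p Ps)
  let ?M = "\<lambda>t vs. M t (w t p # vs)" and ?M' = "\<lambda>vs. M' (w 0 p # vs) + M 0 (w' p # vs)"
  have "multilinear_deriv (length Ps) ?M ?M'"
    using Cons.prems by (intro multilinear_deriv_Cons) auto
  moreover have "bounded_multilinear (length Ps) (?M 0)"
    using Cons.prems by (auto intro: bounded_multilinear_Cons)
  moreover have "bounded_multilinear (length Ps) ?M'"
    using Cons.prems by (auto intro!: bounded_multilinear_add bounded_multilinear_Cons)
  ultimately have "((\<lambda>t. ?M t (map (w t) Ps)) has_vector_derivative
      ?M' (map (w 0) Ps) + (\<Sum>j\<leftarrow>[0..<length Ps]. ?M 0 ((map (w 0) Ps)[j := w' (Ps ! j)]))) (at 0)"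
    using Cons.prems(4) by (intro Cons.IH) auto
  moreover have "[0..<length (p # Ps)] = 0 # map Suc [0..<length Ps]"
    by (simp add: upt_conv_Cons map_Suc_upt del: upt_Suc)
  ultimately show ?case by (simp add: o_def add.assoc del: upt_Suc)
qed


subsection \<open>Iterated directional derivatives\<close>

text \<open>A canonical choice of the family \<open>D\<close> in \<open>smooth_on\<close>, which makes smoothness a local property.\<close>

primrec iter_deriv ::
    "('a::real_normed_vector \<Rightarrow> 'b::real_normed_vector) \<Rightarrow> 'a list \<Rightarrow> 'a \<Rightarrow> 'b" where
  "iter_deriv f [] x = f x"
| "iter_deriv f (v # vs) x = vector_derivative (\<lambda>t. iter_deriv f vs (x + t *\<^sub>R v)) (at 0)"

lemma iter_deriv_cong:
  assumes "open S" "\<And>y. y \<in> S \<Longrightarrow> f y = g y" "x \<in> S"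
  shows "iter_deriv f vs x = iter_deriv g vs x"
  using assms(3)
proof (induction vs arbitrary: x)
  case (Cons v vs)
  have "continuous (at 0) (\<lambda>t. x + t *\<^sub>R v)" by (intro continuous_intros)
  then have "\<forall>\<^sub>F t in nhds 0. x + t *\<^sub>R v \<in> S"
    using \<open>open S\<close> Cons.prems topological_tendstoD[of "\<lambda>t. x + t *\<^sub>R v" "x + 0 *\<^sub>R v" "nhds 0" S]
    by (simp add: continuous_at tendsto_nhds_iff)
  then have "\<forall>\<^sub>F t in nhds 0. t \<in> UNIV \<longrightarrow> iter_deriv f vs (x + t *\<^sub>R v) = iter_deriv g vs (x
    + t *\<^sub>R v)"
    by eventually_elim (use Cons.IH in auto)
  then show ?case by (auto intro!: vector_derivative_cong_eq)
qed (use assms in auto)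

text \<open>The differentiability clause of \<open>smooth_on\<close> at a single point, with the
  next derivative \<open>D'\<close> as a separate argument.\<close>

definition multi_diff ::
    "nat \<Rightarrow> ('a::real_normed_vector \<Rightarrow> 'a list \<Rightarrow> 'b::real_normed_vector) \<Rightarrow> ('a list \<Rightarrow> 'b) \<Rightarrow> 'a \<Rightarrow> bool"
  where
  "multi_diff n D D' x \<longleftrightarrow> (\<forall>e>0. \<exists>d>0. \<forall>h. norm h < d \<longrightarrow>
           (\<forall>vs. length vs = n \<longrightarrow>
              norm (D (x + h) vs - D x vs - D' (h # vs)) \<le> e * norm h * prod_norm vs))"

lemma multi_diff_has_derivative:
  assumes "multi_diff n D D' x" and bD': "bounded_multilinear (Suc n) D'" and vs: "length vs = n"
  shows "((\<lambda>y. D y vs) has_derivative (\<lambda>h. D' (h # vs))) (at x)"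
  unfolding has_derivative_at_alt
proof (intro conjI allI impI bounded_multilinear_bounded_linear_hd[OF bD' vs])
  fix e :: real assume "e > 0"
  let ?P = "prod_norm vs"
  \<comment> \<open>Adding 1 avoids a division by zero when some entry of \<open>vs\<close>
    vanishes.\<close>
  have "e / (?P + 1) > 0" using \<open>e > 0\<close> by (simp add: add_nonneg_pos)
  then obtain d where "d > 0" and d: "\<And>h. norm h < d \<Longrightarrow> 
      norm (D (x + h) vs - D x vs - D' (h # vs)) \<le> e / (?P + 1) * norm h * ?P"
    using assms unfolding multi_diff_def by blast
  have "norm (D y vs - D x vs - D' ((y - x) # vs)) \<le> e * norm (y - x)" if "norm (y - x) < d" for y
  proof -
    have "norm (D y vs - D x vs - D' ((y - x) # vs)) \<le> e / (?P + 1) * norm (y - x) * ?P"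
      using d[OF that] by simp
    also have "\<dots> \<le> e / (?P + 1) * norm (y - x) * (?P + 1)"
      using \<open>e / (?P + 1) > 0\<close> by (intro mult_left_mono mult_nonneg_nonneg) auto
    also have "\<dots> = e * norm (y - x)" using prod_norm_nonneg[of vs]
      by (simp add: add_nonneg_eq_0_iff)
    finally show ?thesis .
  qed
  then show "\<exists>d>0. \<forall>y. norm (y - x) < d \<longrightarrow> norm (D y vs - D x vs - D' ((y - x) # vs))
    \<le> e * norm (y - x)"
    using \<open>d > 0\<close> by blast
qed

lemma has_derivative_line:
  assumes "(f has_derivative f') (at x)"
  shows "((\<lambda>t. f (x + t *\<^sub>R v)) has_vector_derivative f' v) (at 0)"
proof -
  interpret f': bounded_linear f' by (rule has_derivative_bounded_linear[OF assms])
  have "((\<lambda>t. x + t *\<^sub>R v) has_derivative (\<lambda>t. t *\<^sub>R v)) (at 0)"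
    by (auto intro!: derivative_eq_intros)
  then have "((\<lambda>t. f (x + t *\<^sub>R v)) has_derivative (\<lambda>t. f' (t *\<^sub>R v))) (at 0)"
    using has_derivative_compose[of "\<lambda>t. x + t *\<^sub>R v" "\<lambda>t. t *\<^sub>R v" 0 UNIV f f'] assms by simp
  then show ?thesis by (simp add: has_vector_derivative_def f'.scaleR)
qed

text \<open>Directional derivatives alone determine the whole family, by induction on the list of
  directions. This is used both to make the family in \<open>smooth_on\<close> canonical and to
  identify the derivatives of a composite.\<close>

lemma iter_deriv_unique:
  assumes "open S" and "\<And>x. x \<in> S \<Longrightarrow> D 0 x [] = f x"
    and "\<And>n x v vs. x \<in> S \<Longrightarrow> length vs = n \<Longrightarrow>
           ((\<lambda>t. D n (x + t *\<^sub>R v) vs) has_vector_derivative D (Suc n) x (v # vs)) (at 0)"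
    and "x \<in> S"
  shows "iter_deriv f vs x = D (length vs) x vs"
  using \<open>x \<in> S\<close>
proof (induction vs arbitrary: x)
  case (Cons v vs)
  have "continuous (at 0) (\<lambda>t. x + t *\<^sub>R v)" by (intro continuous_intros)
  then have "\<forall>\<^sub>F t in nhds 0. x + t *\<^sub>R v \<in> S"
    using \<open>open S\<close> Cons.prems topological_tendstoD[of "\<lambda>t. x + t *\<^sub>R v" "x + 0 *\<^sub>R v" "nhds 0" S]
    by (simp add: continuous_at tendsto_nhds_iff)
  then have "\<forall>\<^sub>F t in nhds 0. t \<in> UNIV \<longrightarrow> iter_deriv f vs (x + t *\<^sub>R v) = D (length vs) (x
    + t *\<^sub>R v) vs"
    by eventually_elim (use Cons.IH in auto)
  then have "iter_deriv f (v # vs) x = vector_derivative (\<lambda>t. D (length vs) (x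
    + t *\<^sub>R v) vs) (at 0)"
    by (auto intro!: vector_derivative_cong_eq)
  also have "\<dots> = D (Suc (length vs)) x (v # vs)"
    using assms(3)[OF Cons.prems, of vs "length vs" v] by (auto intro: vector_derivative_at)
  finally show ?case by simp
qed (use assms in auto)

text \<open>The existential over families disappears. What remains besides openness is a condition
  at each point that does not mention \<open>S\<close>, so smoothness can be localized without
  gluing anything.\<close>

lemma smooth_on_iff:
  "smooth_on S f \<longleftrightarrow> open S \<and> (\<forall>x\<in>S. \<forall>n. bounded_multilinear n (\<lambda>vs. iter_deriv f vs x) \<and>
      multi_diff n (\<lambda>y vs. iter_deriv f vs y) (\<lambda>vs. iter_deriv f vs x) x)" (is "?L \<longleftrightarrow> ?R")
proof
  assume ?L
  then obtain D where S: "open S" and D0: "\<And>x. x \<in> S \<Longrightarrow> D 0 x [] = f x"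
    and bD: "\<And>n x. x \<in> S \<Longrightarrow> bounded_multilinear n (D n x)"
    and dD: "\<And>n x. x \<in> S \<Longrightarrow> multi_diff n (D n) (D (Suc n) x) x"
    unfolding smooth_on_def multi_diff_def by metis
  have line: "((\<lambda>t. D n (x + t *\<^sub>R v) vs) has_vector_derivative D (Suc n) x (v # vs)) (at 0)"
    if "x \<in> S" "length vs = n" for n x v vs
    using has_derivative_line[OF multi_diff_has_derivative[OF dD bD]] that by blast
  have eq: "iter_deriv f vs x = D (length vs) x vs" if "x \<in> S" for x vs
    using S D0 line that by (rule iter_deriv_unique)
  show ?R
  proof (intro conjI ballI allI S)
    fix x n assume x: "x \<in> S"
    show "bounded_multilinear n (\<lambda>vs. iter_deriv f vs x)"
      using bD[OF x, of n] bounded_multilinear_cong[of n "D n x" "\<lambda>vs. iter_deriv f vs x"] eq[OF x]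
        by simp
    show "multi_diff n (\<lambda>y vs. iter_deriv f vs y) (\<lambda>vs. iter_deriv f vs x) x"
      unfolding multi_diff_def
    proof (intro allI impI)
      fix e :: real assume "e > 0"
      then obtain d where "d > 0" and d: "\<And>h vs. norm h < d \<Longrightarrow> length vs = n \<Longrightarrow>
          norm (D n (x + h) vs - D n x vs - D (Suc n) x (h # vs)) \<le> e * norm h * prod_norm vs"
        using dD[OF x, of n] unfolding multi_diff_def by blast
      \<comment> \<open>The family \<open>D\<close> agrees with \<open>iter_deriv\<close> on
        \<open>S\<close> only, so \<open>x + h\<close> has to stay there.\<close>
      obtain r where "r > 0" and r: "ball x r \<subseteq> S" using S x open_contains_ball by blast
      have "x + h \<in> S" if "norm h < r" for h using r that by (auto simp: dist_norm subset_eq)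
      then show "\<exists>d>0. \<forall>h. norm h < d \<longrightarrow> (\<forall>vs. length vs = n \<longrightarrow>
              norm (iter_deriv f vs (x + h) - iter_deriv f vs x - iter_deriv f (h # vs) x)
                \<le> e * norm h * prod_norm vs)"
        using d \<open>d > 0\<close> \<open>r > 0\<close> eq x by (intro exI[of _ "min d r"]) (simp del: iter_deriv.simps)
    qed
  qed
next
  assume ?R
  then show ?L unfolding smooth_on_def multi_diff_def
    by (auto intro!: exI[of _ "\<lambda>n y vs. iter_deriv f vs y"] simp del: iter_deriv.simps(2))
qed

section \<open>Consequences of smoothness on an open set\<close>

lemma smooth_on_open: "smooth_on S f \<Longrightarrow> open S"
  by (simp add: smooth_on_def)

lemma smooth_on_bounded_multilinear:
  "smooth_on S f \<Longrightarrow> x \<in> S \<Longrightarrow> bounded_multilinear n (\<lambda>vs. iter_deriv f vs x)"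
  by (simp add: smooth_on_iff)

lemma smooth_on_multi_diff:
  "smooth_on S f \<Longrightarrow> x \<in> S \<Longrightarrow> multi_diff n (\<lambda>y vs. iter_deriv f vs y) (\<lambda>vs. iter_deriv f vs x) x"
  by (simp add: smooth_on_iff)

lemma smooth_on_iter_deriv:
  assumes "smooth_on S f" "x \<in> S"
  shows "((\<lambda>y. iter_deriv f vs y) has_derivative (\<lambda>h. iter_deriv f (h # vs) x)) (at x)"
  using multi_diff_has_derivative[OF smooth_on_multi_diff[OF assms] smooth_on_bounded_multilinear[OF
    assms] refl] .

text \<open>Only \<open>D 0\<close> refers to the function, so the same family serves for
  both.\<close>

lemma smooth_on_cong:
  assumes "smooth_on S f" and "\<And>x. x \<in> S \<Longrightarrow> f x = g x"
  shows "smooth_on S g"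
proof -
  obtain D where "\<forall>x\<in>S. D 0 x [] = f x" "(\<forall>n. \<forall>x\<in>S. bounded_multilinear n (D n x)) \<and>
        (\<forall>n. \<forall>x\<in>S. \<forall>e>0. \<exists>d>0. \<forall>h. norm h < d \<longrightarrow>
           (\<forall>vs. length vs = n \<longrightarrow>
              norm (D n (x + h) vs - D n x vs - D (Suc n) x (h # vs))
                \<le> e * norm h * prod_list (map norm vs)))" "open S"
    using assms(1) unfolding smooth_on_def by blast
  then show ?thesis using assms(2) unfolding smooth_on_def by (intro conjI exI[of _ D]) auto
qed

lemma smooth_on_subset:
  assumes "smooth_on S f" "T \<subseteq> S" "open T"
  shows "smooth_on T f"
  using assms unfolding smooth_on_iff by blast

text \<open>Near \<open>x\<close> the derivative of order \<open>n\<close> differs from its value at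
  \<open>x\<close> (bound \<open>A\<close>) by a linear term (bound \<open>B\<close> for increments
  of norm at most 1) and an error of at most 1. Such bounds are a hypothesis of
  \<open>smooth_onI\<close>.\<close>

lemma smooth_on_locally_bounded:
  assumes f: "smooth_on S f" and x: "x \<in> S"
  shows "\<exists>C>0. \<forall>\<^sub>F y in nhds x. \<forall>vs. length vs = n \<longrightarrow> norm (iter_deriv f vs y) \<le> C * prod_norm vs"
proof -
  obtain A where "A > 0" and A: "\<And>vs. length vs = n \<Longrightarrow> norm (iter_deriv f vs x) \<le> A * prod_norm vs"
    using bounded_multilinear_pos_bound[OF smooth_on_bounded_multilinear[OF f x]] by blast
  obtain B where "B > 0" and B: "\<And>vs. length vs = Suc n \<Longrightarrow> norm (iter_deriv f vs x)
    \<le> B * prod_norm vs"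
    using bounded_multilinear_pos_bound[OF smooth_on_bounded_multilinear[OF f x]] by blast
  obtain d where "d > 0" and d: "\<And>h vs. norm h < d \<Longrightarrow> length vs = n \<Longrightarrow>
      norm (iter_deriv f vs (x + h) - iter_deriv f vs x - iter_deriv f (h # vs) x)
        \<le> 1 * norm h * prod_norm vs"
    using smooth_on_multi_diff[OF f x, of n] unfolding multi_diff_def by (meson zero_less_one)
  have "norm (iter_deriv f vs y) \<le> (A + (B + 1)) * prod_norm vs"
    if y: "dist y x < min d 1" and vs: "length vs = n" for y vs
  proof -
    let ?h = "y - x" and ?P = "prod_norm vs"
    have h: "norm ?h < d" "norm ?h \<le> 1" using y by (auto simp: dist_norm)
    have 1: "norm (iter_deriv f vs y - iter_deriv f vs x - iter_deriv f (?h # vs) x) \<le> 1 * ?P"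
      using d[OF h(1) vs] mult_right_mono[OF h(2), of ?P] by simp
    have "norm (iter_deriv f (?h # vs) x) \<le> B * (norm ?h * ?P)"
      using B[of "?h # vs"] vs by (simp del: iter_deriv.simps)
    also have "\<dots> \<le> B * (1 * ?P)" using h \<open>B > 0\<close> by (intro mult_left_mono mult_right_mono) auto
    finally have 2: "norm (iter_deriv f (?h # vs) x) \<le> B * ?P" by simp
    have "norm (iter_deriv f vs y) = norm ((iter_deriv f vs y - iter_deriv f vs x - iter_deriv f (?h
      # vs) x)
        + iter_deriv f (?h # vs) x + iter_deriv f vs x)" by (simp del: iter_deriv.simps)
    also have "\<dots> \<le> 1 * ?P + B * ?P + A * ?P"
      by (intro norm_triangle_le add_mono 1 2 A vs)
    finally show ?thesis by (simp add: algebra_simps)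
  qed
  then have "\<forall>\<^sub>F y in nhds x. \<forall>vs. length vs = n \<longrightarrow> norm (iter_deriv f vs y) \<le> (A + (B
    + 1)) * prod_norm vs"
    unfolding eventually_nhds_metric using \<open>d > 0\<close> by (intro exI[of _ "min d 1"]) auto
  then show ?thesis using \<open>A > 0\<close> \<open>B > 0\<close> by (intro exI[of _ "A + (B + 1)"]) auto
qed

text \<open>Local boundedness of the derivative of order \<open>n + 2\<close> makes the one of order \<open>n + 1\<close> locally
  Lipschitz, which upgrades Gateaux to Frechet differentiability of the one of order \<open>n\<close>.\<close>

lemma smooth_onI:
  assumes S: "open S"
    and D0: "\<And>x. x \<in> S \<Longrightarrow> D 0 x [] = f x"
    and lin: "\<And>n x vs i. x \<in> S \<Longrightarrow> length vs = n \<Longrightarrow> i < n \<Longrightarrow> linear (\<lambda>v. D n x (vs[i := v]))"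
    and bd: "\<And>n x. x \<in> S \<Longrightarrow> \<exists>C. \<forall>\<^sub>F y in nhds x. \<forall>vs. length vs = n \<longrightarrow> norm (D n y vs)
      \<le> C * prod_norm vs"
    and der: "\<And>n x v vs. x \<in> S \<Longrightarrow> length vs = n \<Longrightarrow>
           ((\<lambda>t. D n (x + t *\<^sub>R v) vs) has_vector_derivative D (Suc n) x (v # vs)) (at 0)"
  shows "smooth_on S f"
proof -
  have bD: "bounded_multilinear n (D n x)" if x: "x \<in> S" for n x
  proof -
    obtain C where "\<forall>vs. length vs = n \<longrightarrow> norm (D n x vs) \<le> C * prod_norm vs"
      using bd[OF x] eventually_nhds_x_imp_x by blast
    then show ?thesis using lin[OF x] by (intro bounded_multilinearI[where C = C]) auto
  qed
  have "\<exists>d>0. \<forall>h. norm h < d \<longrightarrow> (\<forall>vs. length vs = n \<longrightarrow>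
              norm (D n (x + h) vs - D n x vs - D (Suc n) x (h # vs)) \<le> e * norm h * prod_norm vs)"
    if x: "x \<in> S" and "e > 0" for n x and e :: real
  proof -
    obtain C0 where C0: "\<forall>\<^sub>F y in nhds x. \<forall>vs. length vs = Suc (Suc n) \<longrightarrow> norm (D (Suc (Suc n)) y vs)
      \<le> C0 * prod_norm vs"
      using bd[OF x] by blast
    define C where "C = \<bar>C0\<bar> + 1"
    have "C > 0" by (auto simp: C_def)
    have "\<forall>\<^sub>F y in nhds x. y \<in> S \<and> (\<forall>vs. length vs = Suc (Suc n) \<longrightarrow> norm (D (Suc (Suc n)) y vs)
      \<le> C * prod_norm vs)"
      using C0 eventually_nhds_in_open[OF S x]
    proof eventually_elim
      case (elim y)
      have "C0 * prod_norm vs \<le> C * prod_norm vs" for vs :: "'a list"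
        by (intro mult_right_mono) (auto simp: C_def)
      then show ?case using elim by (meson order_trans)
    qed
    then obtain r where "r > 0" and r: "\<And>y. dist y x < r \<Longrightarrow> y \<in> S"
      "\<And>y vs. dist y x < r \<Longrightarrow> length vs = Suc (Suc n) \<Longrightarrow> norm (D (Suc (Suc n)) y vs)
        \<le> C * prod_norm vs"
      unfolding eventually_nhds_metric by metis
    have "norm (D n (x + h) vs - D n x vs - D (Suc n) x (h # vs)) \<le> e * norm h * prod_norm vs"
      if h: "norm h < min r (e / C)" and vs: "length vs = n" for h vs
    proof -
      \<comment> \<open>The remainder will be at most \<open>C\<close> times the square of
        \<open>norm h\<close>; \<open>norm h < e / C\<close> turns one of these two factors into
        \<open>e\<close>.\<close>
      let ?B = "C * (norm h * (norm h * prod_norm vs))"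
      have near: "dist (x + t *\<^sub>R h) x < r" if "t \<in> {0..1}" for t
      proof -
        have "norm (t *\<^sub>R h) \<le> 1 * norm h" using that unfolding norm_scaleR
          by (intro mult_right_mono) auto
        then show ?thesis using h by (simp add: dist_norm)
      qed
      have line: "((\<lambda>t. D m (x + t *\<^sub>R h) us) has_vector_derivative D (Suc m) (x
        + t *\<^sub>R h) (h # us)) (at t within X)"
        if "t \<in> {0..1}" "length us = m" for m t us X
      proof -
        have "((\<lambda>s. D m (x + t *\<^sub>R h + s *\<^sub>R h) us) has_vector_derivative D (Suc m) (x
          + t *\<^sub>R h) (h # us)) (at 0)"
          using der[OF r(1)[OF near[OF that(1)]] that(2)] .
        then have "(((\<lambda>s. D m (x + t *\<^sub>R h + s *\<^sub>R h) us) \<circ> (\<lambda>s. s - t)) has_vector_derivative 1 *\<^sub>R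
          D (Suc m) (x + t *\<^sub>R h) (h # us)) (at t)"
          by (intro vector_diff_chain_at) (auto intro!: derivative_eq_intros)
        then show ?thesis by (simp add: o_def algebra_simps has_vector_derivative_at_within)
      qed
      have 1: "norm (D (Suc n) (x + t *\<^sub>R h) (h # vs) - D (Suc n) x (h # vs)) \<le> ?B"
        if t: "t \<in> {0..1}" for t
      proof -
        have "norm (D (Suc n) (x + t *\<^sub>R h) (h # vs) - D (Suc n) (x + 0 *\<^sub>R h) (h # vs))
          \<le> ?B * norm (t - 0)"
        proof (rule differentiable_bound[where S = "{0..1::real}" and f'
          = "\<lambda>t s. s *\<^sub>R D (Suc (Suc n)) (x + t *\<^sub>R h) (h # h # vs)"])
          fix s :: real assume s: "s \<in> {0..1}"
          show "((\<lambda>t. D (Suc n) (x + t *\<^sub>R h) (h # vs)) has_derivative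
             (\<lambda>u. u *\<^sub>R D (Suc (Suc n)) (x + s *\<^sub>R h) (h # h # vs))) (at s within {0..1})"
            using line[OF s, of "h # vs" "Suc n"] vs by (simp add: has_vector_derivative_def)
          have "norm (D (Suc (Suc n)) (x + s *\<^sub>R h) (h # h # vs)) \<le> ?B"
            using r(2)[OF near[OF s], of "h # h # vs"] vs by simp
          then show "onorm (\<lambda>u. u *\<^sub>R D (Suc (Suc n)) (x + s *\<^sub>R h) (h # h # vs)) \<le> ?B"
            by (intro onorm_le, unfold norm_scaleR real_norm_def, subst mult.commute)
              (intro mult_right_mono, auto)
        qed (use t in auto)
        also have "\<dots> \<le> ?B * 1"
          using t \<open>C > 0\<close> by (intro mult_left_mono) auto
        finally show ?thesis by simp
      qed
      \<comment> \<open>With the linear part subtracted, the derivative along the segment is the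
        variation of \<open>D (Suc n)\<close>, which the previous step bounds by \<open>?B\<close>;
        the mean value inequality then yields the remainder.\<close>
      let ?\<phi> = "\<lambda>t. D n (x + t *\<^sub>R h) vs - t *\<^sub>R D (Suc n) x (h # vs)"
      have "norm (?\<phi> 1 - ?\<phi> 0) \<le> ?B * norm (1 - 0 :: real)"
      proof (rule differentiable_bound[where S = "{0..1::real}" and f' = "\<lambda>t s. s *\<^sub>R (D (Suc n) (x
        + t *\<^sub>R h) (h # vs) - D (Suc n) x (h # vs))"])
        fix s :: real assume s: "s \<in> {0..1}"
        have "(?\<phi> has_vector_derivative D (Suc n) (x
          + s *\<^sub>R h) (h # vs) - 1 *\<^sub>R D (Suc n) x (h # vs)) (at s within {0..1})"
          by (rule has_vector_derivative_diff[OF line[OF s vs]]) (auto intro!: derivative_eq_intros)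
        then show "(?\<phi> has_derivative
           (\<lambda>u. u *\<^sub>R (D (Suc n) (x + s *\<^sub>R h) (h # vs) - D (Suc n) x (h # vs)))) (at s within
             {0..1})"
          by (simp add: has_vector_derivative_def)
        show "onorm (\<lambda>u. u *\<^sub>R (D (Suc n) (x + s *\<^sub>R h) (h # vs) - D (Suc n) x (h # vs))) \<le> ?B"
          using 1[OF s] by (intro onorm_le, unfold norm_scaleR real_norm_def, subst mult.commute)
              (intro mult_right_mono, auto)
      qed auto
      then have "norm (D n (x + h) vs - D n x vs - D (Suc n) x (h # vs)) \<le> ?B"
        by (simp add: algebra_simps)
      also have "\<dots> \<le> C * (e / C * (norm h * prod_norm vs))"
        using h \<open>C > 0\<close> by (intro mult_left_mono mult_right_mono) auto
      also have "\<dots> = e * norm h * prod_norm vs" using \<open>C > 0\<close> by simp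
      finally show ?thesis .
    qed
    then show ?thesis using \<open>r > 0\<close> \<open>e > 0\<close> \<open>C > 0\<close> by (intro exI[of _ "min r (e / C)"]) auto
  qed
  then show ?thesis
    unfolding smooth_on_def using S D0 bD by (intro conjI exI[of _ D]) auto
qed

subsection \<open>The higher order chain rule\<close>

text \<open>\<open>parts n\<close> lists the partitions of \<open>{0..<n}\<close> into nonempty blocks, each as a list of lists: the
  new element \<open>0\<close> of a partition of \<open>{0..<n+1}\<close> either is a block of its own or joins one of the
  blocks of a partition of \<open>{1..<n+1}\<close>.\<close>

definition next_parts :: "nat list list \<Rightarrow> nat list list list" where
  "next_parts P = ([0] # map (map Suc) P) #
     map (\<lambda>j. (map (map Suc) P)[j := 0 # map Suc (P ! j)]) [0..<length P]"

primrec parts :: "nat \<Rightarrow> nat list list list" where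
  "parts 0 = [[]]"
| "parts (Suc n) = concat (map next_parts (parts n))"

text \<open>Every index occurs exactly once in the blocks. Hence each term of the chain rule is
  linear in each direction and is bounded by the product of all norms. Multisets are used because
  the blocks permute the indices.\<close>

lemma mset_concat_parts: "P \<in> set (parts n) \<Longrightarrow> mset (concat P) = mset [0..<n]"
proof (induction n arbitrary: P)
  case (Suc n)
  then obtain Q where Q: "Q \<in> set (parts n)" and P: "P \<in> set (next_parts Q)" by auto
  have "mset (0 # map Suc (concat Q)) = mset (0 # map Suc [0..<n])"
    using Suc.IH[OF Q] by simp
  also have "0 # map Suc [0..<n] = [0..<Suc n]"
    by (simp add: upt_conv_Cons map_Suc_upt del: upt_Suc)
  finally have *: "mset (0 # map Suc (concat Q)) = mset [0..<Suc n]" .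
  have "mset (concat P) = mset (0 # map Suc (concat Q))"
  proof (cases "P = [0] # map (map Suc) Q")
    case False
    then obtain j where j: "j < length Q" "P = (map (map Suc) Q)[j := 0 # map Suc (Q ! j)]"
      using P by (auto simp: next_parts_def)
    have "P = map (map Suc) (take j Q) @ (0 # map Suc (Q ! j)) # map (map Suc) (drop (Suc j) Q)"
      using j by (simp add: upd_conv_take_nth_drop take_map drop_map)
    moreover have "concat Q = concat (take j Q @ Q ! j # drop (Suc j) Q)"
      using j id_take_nth_drop by metis
    ultimately show ?thesis by (simp add: map_concat)
  qed (simp add: map_concat)
  then show ?case using * by simp
qed simp

text \<open>The chain rule of order \<open>n\<close> involves no inner derivative of higher order;
  this is why \<open>k\<close>-jets can be transported by smooth maps.\<close>

lemma length_block_parts: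
  assumes "P \<in> set (parts n)" "I \<in> set P"
  shows "length I \<le> n"
proof -
  have "length (concat P) = n"
    using mset_concat_parts[OF assms(1)] by (metis size_mset length_upt diff_zero)
  moreover have "length I \<le> length (concat P)"
    using assms(2) by (simp add: length_concat member_le_sum_list)
  ultimately show ?thesis by simp
qed

text \<open>The summand of Faa di Bruno's formula that belongs to the partition \<open>P\<close>; a
  block selects the directions in which the inner map is differentiated.\<close>

definition comp_term ::
    "('a::real_normed_vector \<Rightarrow> 'b::real_normed_vector) \<Rightarrow> ('b \<Rightarrow> 'c::real_normed_vector) \<Rightarrow>
     nat list list \<Rightarrow> 'a \<Rightarrow> 'a list \<Rightarrow> 'c" where
  "comp_term f g P x vs = iter_deriv g (map (\<lambda>I. iter_deriv f (map ((!) vs) I) x) P) (f x)"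

section \<open>Derivatives, linearity and bounds of the terms of the chain rule\<close>

lemma smooth_on_has_derivative_0:
  assumes "smooth_on S f" "x \<in> S"
  shows "(f has_derivative (\<lambda>h. iter_deriv f [h] x)) (at x)"
  using smooth_on_iter_deriv[OF assms, of "[]"] by (simp del: iter_deriv.simps(2))

lemma smooth_on_continuous_on:
  "smooth_on S f \<Longrightarrow> continuous_on S f"
  by (meson continuous_at_imp_continuous_on has_derivative_continuous smooth_on_has_derivative_0)

lemma multilinear_deriv_compose:
  assumes D: "multi_diff n D D' (y 0)" and bD': "bounded_multilinear (Suc n) D'"
    and y: "(y has_vector_derivative y') (at 0)"
  shows "multilinear_deriv n (\<lambda>t. D (y t)) (\<lambda>ws. D' (y' # ws))"
  unfolding multilinear_deriv_def
proof (intro allI impI)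
  fix e :: real assume "e > 0"
  obtain C where "C > 0" and C: "\<And>vs. length vs = Suc n \<Longrightarrow> norm (D' vs) \<le> C * prod_norm vs"
    using bounded_multilinear_pos_bound[OF bD'] by blast
  define B where "B = norm y' + 1"
  have "B > 0" by (auto simp: B_def add_nonneg_pos)
  obtain d where "d > 0" and d: "\<And>h vs. norm h < d \<Longrightarrow> length vs = n \<Longrightarrow>
      norm (D (y 0 + h) vs - D (y 0) vs - D' (h # vs)) \<le> e / (2 * B) * norm h * prod_norm vs"
    using D[unfolded multi_diff_def, rule_format, of "e / (2 * B)"] \<open>e > 0\<close> \<open>B > 0\<close> by auto
  have "(y \<longlongrightarrow> y 0) (nhds 0)"
    using has_vector_derivative_continuous[OF y] by (simp add: continuous_at tendsto_nhds_iff)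
  then have 1: "\<forall>\<^sub>F t in nhds 0. norm (y t - y 0) < d"
    using tendstoD[of y "y 0" "nhds 0" d] \<open>d > 0\<close> by (simp add: dist_norm)
  \<comment> \<open>One estimate for two purposes: the bound 1 gives
    \<open>norm (y t - y 0) \<le> B * \<bar>t\<bar>\<close>, and \<open>e / (2 * C)\<close> controls
    the linearization error inside \<open>D'\<close>.\<close>
  have 2: "\<forall>\<^sub>F t in nhds 0. norm (y t - y 0 - t *\<^sub>R y') \<le> min 1 (e / (2 * C)) * \<bar>t\<bar>"
    using y[unfolded has_vector_derivative_at_0_iff, rule_format, of "min 1 (e / (2 * C))"]
      \<open>e > 0\<close> \<open>C > 0\<close> by simp
  show "\<forall>\<^sub>F t in nhds 0. \<forall>vs. length vs = n \<longrightarrow>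
        norm (D (y t) vs - D (y 0) vs - t *\<^sub>R D' (y' # vs)) \<le> e * \<bar>t\<bar> * prod_norm vs"
    using 1 2
  proof eventually_elim
    case (elim t)
    show ?case
    proof (intro allI impI)
      fix vs :: "'a list" assume vs: "length vs = n"
      let ?P = "prod_norm vs" and ?k = "y t - y 0"
      interpret D': bounded_linear "\<lambda>v. D' (v # vs)"
        by (rule bounded_multilinear_bounded_linear_hd[OF bD' vs])
      have "norm ?k \<le> norm (?k - t *\<^sub>R y') + norm (t *\<^sub>R y')"
        by (metis add.commute norm_triangle_sub)
      also have "\<dots> \<le> 1 * \<bar>t\<bar> + \<bar>t\<bar> * norm y'"
        using elim(2) mult_right_mono[of "min 1 (e / (2 * C))" 1 "\<bar>t\<bar>"] by simp
      finally have k: "norm ?k \<le> B * \<bar>t\<bar>" by (simp add: B_def algebra_simps)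
      have "norm (D (y t) vs - D (y 0) vs - D' (?k # vs)) \<le> e / (2 * B) * norm ?k * ?P"
        using d[OF elim(1) vs] by simp
      also have "\<dots> \<le> e / (2 * B) * (B * \<bar>t\<bar>) * ?P"
        using k \<open>e > 0\<close> \<open>B > 0\<close> by (intro mult_left_mono mult_right_mono) auto
      finally have a: "norm (D (y t) vs - D (y 0) vs - D' (?k # vs)) \<le> e / 2 * \<bar>t\<bar> * ?P"
        using \<open>B > 0\<close> by simp
      have "norm (D' ((?k - t *\<^sub>R y') # vs)) \<le> C * (norm (?k - t *\<^sub>R y') * ?P)"
        using C[of "(?k - t *\<^sub>R y') # vs"] vs by simp
      also have "\<dots> \<le> C * ((e / (2 * C) * \<bar>t\<bar>) * ?P)"
        using elim(2) mult_right_mono[of "min 1 (e / (2 * C))" "e / (2 * C)" "\<bar>t\<bar>"] \<open>C > 0\<close>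
        by (intro mult_left_mono mult_right_mono) auto
      finally have b: "norm (D' ((?k - t *\<^sub>R y') # vs)) \<le> e / 2 * \<bar>t\<bar> * ?P" 
        using \<open>C > 0\<close> by simp
      have "D (y t) vs - D (y 0) vs - t *\<^sub>R D' (y' # vs) =
         (D (y t) vs - D (y 0) vs - D' (?k # vs)) + D' ((?k - t *\<^sub>R y') # vs)"
        by (simp add: D'.diff D'.scaleR)
      also have "norm \<dots> \<le> e / 2 * \<bar>t\<bar> * ?P + e / 2 * \<bar>t\<bar> * ?P"
        by (intro norm_triangle_le add_mono a b)
      finally show "norm (D (y t) vs - D (y 0) vs - t *\<^sub>R D' (y' # vs)) \<le> e * \<bar>t\<bar> * ?P"
        by simp
    qed
  qed
qed

text \<open>Leibniz rule: differentiating the outer factor creates the block \<open>[0]\<close>, and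
  differentiating an inner factor puts 0 into its block. The new direction stands at the head of
  \<open>v # vs\<close>, which shifts the old indices by \<open>Suc\<close>.\<close>

lemma comp_term_deriv:
  assumes f: "smooth_on S f" and g: "smooth_on T g" and x: "x \<in> S" "f x \<in> T"
  shows "((\<lambda>t. comp_term f g P (x + t *\<^sub>R v) vs) has_vector_derivative
           (\<Sum>Q\<leftarrow>next_parts P. comp_term f g Q x (v # vs))) (at 0)"
proof -
  let ?M = "\<lambda>t ws. iter_deriv g ws (f (x + t *\<^sub>R v))"
  let ?M' = "\<lambda>ws. iter_deriv g (iter_deriv f [v] x # ws) (f x)"
  let ?w = "\<lambda>t I. iter_deriv f (map ((!) vs) I) (x + t *\<^sub>R v)"
  let ?w' = "\<lambda>I. iter_deriv f (v # map ((!) vs) I) x"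
  have bg: "bounded_multilinear n (\<lambda>ws. iter_deriv g ws (f x))" for n
    by (rule smooth_on_bounded_multilinear[OF g x(2)])
  have fl: "((\<lambda>t. f (x + t *\<^sub>R v)) has_vector_derivative iter_deriv f [v] x) (at 0)"
    by (rule has_derivative_line[OF smooth_on_has_derivative_0[OF f x(1)]])
  have "((\<lambda>t. ?M t (map (?w t) P)) has_vector_derivative
      ?M' (map (?w 0) P) + (\<Sum>j\<leftarrow>[0..<length P]. ?M 0 ((map (?w 0) P)[j := ?w' (P ! j)]))) (at 0)"
  proof (rule multilinear_deriv_map)
    show "multilinear_deriv (length P) ?M ?M'"
      using smooth_on_multi_diff[OF g x(2)] bg fl
      by (intro multilinear_deriv_compose[where y = "\<lambda>t. f (x + t *\<^sub>R v)" and D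
        = "\<lambda>z ws. iter_deriv g ws z"
          and D' = "\<lambda>ws. iter_deriv g ws (f x)"]) (simp_all del: iter_deriv.simps)
    show "bounded_multilinear (length P) (?M 0)" using bg by simp
    show "bounded_multilinear (length P) ?M'" by (rule bounded_multilinear_Cons[OF bg])
    show "((\<lambda>t. ?w t p) has_vector_derivative ?w' p) (at 0)" for p
      by (rule has_derivative_line[OF smooth_on_iter_deriv[OF f x(1)]])
  qed
  also have "?M' (map (?w 0) P) + (\<Sum>j\<leftarrow>[0..<length P]. ?M 0 ((map (?w 0) P)[j := ?w' (P ! j)]))
      = (\<Sum>Q\<leftarrow>next_parts P. comp_term f g Q x (v # vs))"
    by (auto simp: next_parts_def comp_term_def o_def map_update simp del: iter_deriv.simps
        intro!: arg_cong[where f = sum_list])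
  finally show ?thesis by (simp add: comp_term_def)
qed

text \<open>The index \<open>i\<close> lies in exactly one block and there at one place, so the term
  is an inner derivative, linear in that slot, followed by an outer derivative, linear in the slot
  of the block.\<close>

lemma comp_term_linear:
  assumes f: "smooth_on S f" and g: "smooth_on T g" and x: "x \<in> S" "f x \<in> T"
    and P: "P \<in> set (parts n)" and vs: "length vs = n" "i < n"
  shows "linear (\<lambda>v. comp_term f g P x (vs[i := v]))"
proof -
  have mP: "mset (concat P) = mset [0..<n]" by (rule mset_concat_parts[OF P])
  have dP: "distinct (concat P)" using mset_eq_imp_distinct_iff[OF mP] by simp
  have iP: "i \<in> set (concat P)" using mset_eq_setD[OF mP] vs by auto
  let ?F = "\<lambda>vs I. iter_deriv f (map ((!) vs) I) x"
  have upd: "map ((!) (vs[i := v])) I = map ((!) vs) I" if "i \<notin> set I" for v I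
    using that by (intro map_cong refl) (metis nth_list_update_neq)
  \<comment> \<open>Here \<open>j\<close> is the position of the block that contains
    \<open>i\<close>, \<open>us\<close> are the directions of this block, and \<open>l\<close> is
    the place of \<open>i\<close> in it.\<close>
  have "\<exists>j<length P. \<exists>us l. l < length us \<and>
      (\<forall>v. map (?F (vs[i := v])) P = (map (?F vs) P)[j := iter_deriv f (us[l := v]) x])"
    using dP iP
  proof (induction P)
    case (Cons I P)
    show ?case
    proof (cases "i \<in> set I")
      case True
      then obtain l where l: "l < length I" "I ! l = i" by (auto simp: in_set_conv_nth)
      have "map ((!) (vs[i := v])) I = (map ((!) vs) I)[l := v]" for v
      proof (rule nth_equalityI)
        fix m assume m: "m < length (map ((!) (vs[i := v])) I)"
        have "distinct I" using Cons.prems by simp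
        then have "I ! m = i \<longleftrightarrow> m = l" using l m by (auto simp: nth_eq_iff_index_eq)
        then show "map ((!) (vs[i := v])) I ! m = (map ((!) vs) I)[l := v] ! m"
          using m vs l by (cases "m = l") (auto simp: nth_list_update_neq)
      qed simp
      moreover have "map (?F (vs[i := v])) P = map (?F vs) P" for v
      proof (intro map_cong refl)
        fix J assume "J \<in> set P"
        then have "i \<notin> set J" using True Cons.prems(1) by auto
        then show "?F (vs[i := v]) J = ?F vs J" by (metis upd)
      qed
      ultimately show ?thesis using l
        by (intro exI[of _ 0]) (auto intro!: exI[of _ "map ((!) vs) I"] exI[of _ l])
    next
      case False
      then obtain j us l where "j < length P" "l < length us"
        "\<And>v. map (?F (vs[i := v])) P = (map (?F vs) P)[j := iter_deriv f (us[l := v]) x]"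
        using Cons by auto
      moreover have "?F (vs[i := v]) I = ?F vs I" for v using False by (metis upd)
      ultimately show ?thesis
        by (intro exI[of _ "Suc j"] conjI) (auto intro!: exI[of _ us] exI[of _ l])
    qed
  qed simp
  then obtain j us l where j: "j < length P" "l < length us"
    and *: "\<And>v. map (?F (vs[i := v])) P = (map (?F vs) P)[j := iter_deriv f (us[l := v]) x]"
    by auto
  have "linear (\<lambda>v. iter_deriv f (us[l := v]) x)"
    using bounded_multilinear_linear[OF smooth_on_bounded_multilinear[OF f x(1)] refl j(2)] .
  moreover have "linear (\<lambda>w. iter_deriv g ((map (?F vs) P)[j := w]) (f x))"
    using bounded_multilinear_linear[OF smooth_on_bounded_multilinear[OF g x(2)] refl] j(1) by simp
  ultimately show ?thesis
    using linear_compose[of "\<lambda>v. iter_deriv f (us[l := v]) x"] by (simp add: comp_term_def * o_def)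
qed

lemma comp_term_bounded:
  assumes f: "smooth_on S f" and g: "smooth_on T g" and x: "x \<in> S" "f x \<in> T"
    and P: "P \<in> set (parts n)"
  shows "\<exists>C>0. \<forall>\<^sub>F y in nhds x. \<forall>vs. length vs = n \<longrightarrow> norm (comp_term f g P y vs) \<le> C * prod_norm vs"
proof -
  have mP: "mset (concat P) = mset [0..<n]" by (rule mset_concat_parts[OF P])
  \<comment> \<open>This bound holds for every list of blocks, hence the induction. That the blocks
    partition the indices below \<open>n\<close> enters only at the end, when the product over
    \<open>concat P\<close> is reordered.\<close>
  have "\<exists>C>0. \<forall>\<^sub>F y in nhds x. \<forall>vs. prod_norm (map (\<lambda>I. iter_deriv f (map ((!) vs) I) y) P)
     \<le> C * prod_norm (map ((!) vs) (concat P))" for P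
  proof (induction P)
    case (Cons I P)
    obtain C where "C > 0" and C: "\<forall>\<^sub>F y in nhds x. \<forall>vs. prod_norm (map (\<lambda>I. iter_deriv f (map ((!)
      vs) I) y) P)
     \<le> C * prod_norm (map ((!) vs) (concat P))" using Cons by blast
    obtain B where "B > 0" and B: "\<forall>\<^sub>F y in nhds x. \<forall>us. length us = length I
      \<longrightarrow> norm (iter_deriv f us y) \<le> B * prod_norm us"
      using smooth_on_locally_bounded[OF f x(1)] by blast
    have "\<forall>\<^sub>F y in nhds x. \<forall>vs. prod_norm (map (\<lambda>I. iter_deriv f (map ((!) vs) I) y) (I # P))
     \<le> (B * C) * prod_norm (map ((!) vs) (concat (I # P)))"
      using C B
    proof eventually_elim
      case (elim y)
      have "norm (iter_deriv f (map ((!) vs) I) y) * prod_norm (map (\<lambda>I. iter_deriv f (map ((!) vs)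
        I) y) P)
          \<le> (B * prod_norm (map ((!) vs) I)) * (C * prod_norm (map ((!) vs) (concat P)))" for vs
        using elim(1)[rule_format, of vs] elim(2)[rule_format, of "map ((!) vs) I"] \<open>B > 0\<close>
        by (intro mult_mono mult_nonneg_nonneg prod_norm_nonneg) (simp_all del: map_map)
      then show ?case by (simp add: algebra_simps)
    qed
    then show ?case using \<open>B > 0\<close> \<open>C > 0\<close> by (intro exI[of _ "B * C"]) auto
  qed (auto intro!: exI[of _ 1])
  then obtain C where "C > 0" and C: "\<forall>\<^sub>F y in nhds x. \<forall>vs. prod_norm (map (\<lambda>I. iter_deriv f (map
    ((!) vs) I) y) P)
     \<le> C * prod_norm (map ((!) vs) (concat P))" by blast
  obtain B where "B > 0" and B: "\<forall>\<^sub>F z in nhds (f x). \<forall>ws. length ws = length P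
    \<longrightarrow> norm (iter_deriv g ws z) \<le> B * prod_norm ws"
    using smooth_on_locally_bounded[OF g x(2)] by blast
  have "(f \<longlongrightarrow> f x) (nhds x)"
    using has_derivative_continuous[OF smooth_on_has_derivative_0[OF f x(1)]]
      by (simp add: continuous_at tendsto_nhds_iff)
  then have B': "\<forall>\<^sub>F y in nhds x. \<forall>ws. length ws = length P \<longrightarrow> norm (iter_deriv g ws (f y))
    \<le> B * prod_norm ws"
    using B by (rule eventually_compose_filterlim[rotated])
  have "\<forall>\<^sub>F y in nhds x. \<forall>vs. length vs = n \<longrightarrow> norm (comp_term f g P y vs) \<le> (B * C) * prod_norm vs"
    using C B'
  proof eventually_elim
    case (elim y)
    have "norm (comp_term f g P y vs) \<le> (B * C) * prod_norm vs" if "length vs = n" for vs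
    proof -
      have "norm (comp_term f g P y vs) \<le> B * prod_norm (map (\<lambda>I. iter_deriv f (map ((!) vs) I) y)
        P)"
        using elim(2)[rule_format, of "map (\<lambda>I. iter_deriv f (map ((!) vs) I) y) P"]
        by (simp add: comp_term_def del: map_map)
      also have "\<dots> \<le> B * (C * prod_norm (map ((!) vs) (concat P)))"
        using elim(1)[rule_format, of vs] \<open>B > 0\<close> by (intro mult_left_mono) (simp_all del: map_map)
      also have "prod_norm (map ((!) vs) (concat P))
        = prod_mset (image_mset (\<lambda>i. norm (vs ! i)) (mset (concat P)))"
        by (simp flip: prod_mset_prod_list add: o_def)
      also have "\<dots> = prod_norm (map ((!) vs) [0..<n])"
        unfolding mP by (simp flip: prod_mset_prod_list add: o_def)
      also have "map ((!) vs) [0..<n] = vs" using map_nth that by metis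
      finally show ?thesis by simp
    qed
    then show ?case by blast
  qed
  then show ?thesis using \<open>B > 0\<close> \<open>C > 0\<close> by (intro exI[of _ "B * C"]) auto
qed

lemma linear_sum_list:
  "(\<And>P. P \<in> set Ps \<Longrightarrow> linear (F P)) \<Longrightarrow> linear (\<lambda>v. \<Sum>P\<leftarrow>Ps. F P v)"
  by (induction Ps) (auto intro!: linear_compose_add simp: linear_zero)

lemma has_vector_derivative_sum_list:
  "(\<And>P. P \<in> set Ps \<Longrightarrow> (F P has_vector_derivative F' P) A) \<Longrightarrow>
    ((\<lambda>v. \<Sum>P\<leftarrow>Ps. F P v) has_vector_derivative (\<Sum>P\<leftarrow>Ps. F' P)) A"
  by (induction Ps) (auto intro!: has_vector_derivative_add has_vector_derivative_const)

lemma bounded_sum_list: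
  assumes "\<And>P. P \<in> set Ps \<Longrightarrow> \<exists>C>0. \<forall>\<^sub>F y in A. \<forall>vs. length vs = n \<longrightarrow> norm (F P y vs)
    \<le> C * prod_norm vs"
  shows "\<exists>C>0. \<forall>\<^sub>F y in A. \<forall>vs. length vs = n \<longrightarrow> norm (\<Sum>P\<leftarrow>Ps. F P y vs) \<le> C * prod_norm vs"
  using assms
proof (induction Ps)
  case (Cons P Ps)
  obtain C where "C > 0" and C: "\<forall>\<^sub>F y in A. \<forall>vs. length vs = n \<longrightarrow> norm (\<Sum>P\<leftarrow>Ps. F P y vs)
    \<le> C * prod_norm vs"
    using Cons by auto
  obtain B where "B > 0" and B: "\<forall>\<^sub>F y in A. \<forall>vs. length vs = n \<longrightarrow> norm (F P y vs)
    \<le> B * prod_norm vs"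
    using Cons.prems[of P] by auto
  have "\<forall>\<^sub>F y in A. \<forall>vs. length vs = n \<longrightarrow> norm (\<Sum>P\<leftarrow>P # Ps. F P y vs) \<le> (B + C) * prod_norm vs"
    using C B by eventually_elim (auto simp: algebra_simps intro!: norm_triangle_le add_mono)
  then show ?case using \<open>B > 0\<close> \<open>C > 0\<close> by (intro exI[of _ "B + C"]) auto
qed (auto intro!: exI[of _ 1])

lemma sum_list_concat_map:
  "(\<Sum>Q\<leftarrow>concat (map F Ps). h Q) = (\<Sum>P\<leftarrow>Ps. \<Sum>Q\<leftarrow>F P. h Q)"
  by (induction Ps) auto

text \<open>The sums over partitions satisfy the hypotheses of \<open>smooth_onI\<close>, and by
  \<open>iter_deriv_unique\<close> they are the iterated derivatives; one family yields both
  conclusions.\<close>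

lemma
  assumes f: "smooth_on S f" and g: "smooth_on T g" and ST: "f ` S \<subseteq> T"
  shows smooth_on_compose: "smooth_on S (\<lambda>x. g (f x))"
    and iter_deriv_compose: "x \<in> S \<Longrightarrow>
      iter_deriv (\<lambda>x. g (f x)) vs x = (\<Sum>P\<leftarrow>parts (length vs). comp_term f g P x vs)"
proof -
  let ?D = "\<lambda>n x vs. \<Sum>P\<leftarrow>parts n. comp_term f g P x vs"
  have der: "((\<lambda>t. ?D n (x + t *\<^sub>R v) vs) has_vector_derivative ?D (Suc n) x (v # vs)) (at 0)"
    if "x \<in> S" for n x v vs
    unfolding parts.simps sum_list_concat_map
    using that ST by (intro has_vector_derivative_sum_list comp_term_deriv[OF f g]) auto
  have D0: "?D 0 x [] = g (f x)" for x by (simp add: comp_term_def)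
  show "smooth_on S (\<lambda>x. g (f x))"
  proof (rule smooth_onI[where D = ?D])
    show "open S" by (rule smooth_on_open[OF f])
    show "?D 0 x [] = g (f x)" for x by (rule D0)
    show "linear (\<lambda>v. ?D n x (vs[i := v]))" if "x \<in> S" "length vs = n" "i < n" for n x vs i
      using that ST by (intro linear_sum_list comp_term_linear[OF f g]) auto
    show "\<exists>C. \<forall>\<^sub>F y in nhds x. \<forall>vs. length vs = n \<longrightarrow> norm (?D n y vs) \<le> C * prod_norm vs" if "x \<in> S"
      for n x
    proof -
      have "\<exists>C>0. \<forall>\<^sub>F y in nhds x. \<forall>vs. length vs = n \<longrightarrow> norm (comp_term f g P y vs)
        \<le> C * prod_norm vs"
        if "P \<in> set (parts n)" for P
        using comp_term_bounded[OF f g _ _ that] \<open>x \<in> S\<close> ST by blast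
      from bounded_sum_list[where F = "comp_term f g", OF this] show ?thesis by blast
    qed
  qed (rule der)
  show "iter_deriv (\<lambda>x. g (f x)) vs x = ?D (length vs) x vs" if "x \<in> S"
    using iter_deriv_unique[where D = ?D and f
      = "\<lambda>x. g (f x)", OF smooth_on_open[OF f] D0 der that] .
qed

subsection \<open>Smoothness at a point\<close>

text \<open>Smoothness of a germ: chart domains and their images turn into \<open>eventually\<close>
  statements instead of sets to be tracked through compositions.\<close>

definition smooth_at ::
    "('a::real_normed_vector \<Rightarrow> 'b::real_normed_vector) \<Rightarrow> 'a \<Rightarrow> bool" where
  "smooth_at f x \<longleftrightarrow> (\<exists>S. x \<in> S \<and> smooth_on S f)"

lemma smooth_atI: "smooth_on S f \<Longrightarrow> x \<in> S \<Longrightarrow> smooth_at f x"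
  unfolding smooth_at_def by blast

text \<open>The neighbourhoods of the individual points need no common family of derivatives, as
  \<open>iter_deriv\<close> is the same on all of them.\<close>

lemma smooth_on_iff_smooth_at: "smooth_on S f \<longleftrightarrow> open S \<and> (\<forall>x\<in>S. smooth_at f x)"
proof
  show "smooth_on S f \<Longrightarrow> open S \<and> (\<forall>x\<in>S. smooth_at f x)"
    using smooth_on_open[of S f] smooth_atI[of S f] by simp
next
  assume *: "open S \<and> (\<forall>x\<in>S. smooth_at f x)"
  have "bounded_multilinear n (\<lambda>vs. iter_deriv f vs x) \<and>
      multi_diff n (\<lambda>y vs. iter_deriv f vs y) (\<lambda>vs. iter_deriv f vs x) x" if x: "x \<in> S" for x n
  proof -
    obtain T where T: "smooth_on T f" "x \<in> T" using * x unfolding smooth_at_def by blast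
    show ?thesis
      using smooth_on_bounded_multilinear[OF T] smooth_on_multi_diff[OF T] by simp
  qed
  then show "smooth_on S f" using * by (simp add: smooth_on_iff)
qed

lemma smooth_at_eventually: "smooth_at f x \<Longrightarrow> \<forall>\<^sub>F y in nhds x. smooth_at f y"
  unfolding smooth_at_def eventually_nhds using smooth_on_open by blast

lemma smooth_at_cong:
  assumes "smooth_at f x" "\<forall>\<^sub>F y in nhds x. f y = g y"
  shows "smooth_at g x"
proof -
  obtain S where S: "x \<in> S" "smooth_on S f" using assms(1) unfolding smooth_at_def by blast
  obtain T where T: "open T" "x \<in> T" "\<And>y. y \<in> T \<Longrightarrow> f y = g y"
    using assms(2) unfolding eventually_nhds by blast
  have "smooth_on (S \<inter> T) f"
    using S T by (intro smooth_on_subset[OF S(2)]) (auto intro: smooth_on_open)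
  then have "smooth_on (S \<inter> T) g" by (rule smooth_on_cong) (use T in auto)
  then show ?thesis using S T by (intro smooth_atI[of "S \<inter> T"]) auto
qed

lemma smooth_at_has_derivative_0:
  "smooth_at f x \<Longrightarrow> (f has_derivative (\<lambda>h. iter_deriv f [h] x)) (at x)"
  unfolding smooth_at_def using smooth_on_has_derivative_0 by blast

lemma smooth_at_continuous: "smooth_at f x \<Longrightarrow> (f \<longlongrightarrow> f x) (nhds x)"
  using has_derivative_continuous[OF smooth_at_has_derivative_0]
  by (simp add: continuous_at tendsto_nhds_iff)

lemma smooth_at_compose_eventually:
  "smooth_at f x \<Longrightarrow> \<forall>\<^sub>F z in nhds (f x). P z \<Longrightarrow> \<forall>\<^sub>F y in nhds x. P (f y)"
  using eventually_compose_filterlim smooth_at_continuous by blast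

lemma
  assumes f: "smooth_at f x" and g: "smooth_at g (f x)"
  shows smooth_at_compose: "smooth_at (\<lambda>x. g (f x)) x"
    and iter_deriv_compose_at:
      "iter_deriv (\<lambda>x. g (f x)) vs x = (\<Sum>P\<leftarrow>parts (length vs). comp_term f g P x vs)"
proof -
  obtain S where S: "x \<in> S" "smooth_on S f" using f unfolding smooth_at_def by blast
  obtain T where T: "f x \<in> T" "smooth_on T g" using g unfolding smooth_at_def by blast
  let ?S = "S \<inter> f -` T"
  have "open ?S"
    by (intro continuous_open_preimage smooth_on_continuous_on S smooth_on_open[OF S(2)]
        smooth_on_open[OF T(2)])
  then have f': "smooth_on ?S f" by (intro smooth_on_subset[OF S(2)]) auto
  show "smooth_at (\<lambda>x. g (f x)) x"
    by (rule smooth_atI[OF smooth_on_compose[OF f' T(2)]]) (use S T in auto)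
  show "iter_deriv (\<lambda>x. g (f x)) vs x = (\<Sum>P\<leftarrow>parts (length vs). comp_term f g P x vs)"
    by (rule iter_deriv_compose[OF f' T(2)]) (use S T in auto)
qed


subsection \<open>Closure properties of smooth maps\<close>

lemma has_vector_derivative_line_linear:
  assumes "bounded_linear f"
  shows "((\<lambda>t. f (x + t *\<^sub>R v)) has_vector_derivative f v) (at 0)"
  by (rule has_derivative_line) (rule bounded_linear_imp_has_derivative[OF assms])

lemma smooth_on_bounded_linear:
  assumes f: "bounded_linear f"
  shows "smooth_on UNIV f"
proof -
  interpret f: bounded_linear f by (rule f)
  define D where "D n x vs = (case vs of [] \<Rightarrow> f x | [v] \<Rightarrow> f v | _ \<Rightarrow> 0)" for n :: nat and x vs
  have D: "D n x [] = f x" "D n x [v] = f v" "D n x (u # v # vs) = 0" for n x u v vs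
    by (auto simp: D_def)
  obtain K where K: "K > 0" "\<And>x. norm (f x) \<le> norm x * K" using f.pos_bounded by blast
  show ?thesis
  proof (rule smooth_onI[where D = D])
    show "linear (\<lambda>v. D n x (vs[i := v]))" if "length vs = n" "i < n" for n x i and vs :: "'a list"
    proof -
      consider "vs = []" | u where "vs = [u]" | u w ws where "vs = u # w # ws"
        by (metis list.exhaust)
      then show ?thesis
      proof cases
        case 3
        then show ?thesis using that D by (cases i; cases "i - 1") (auto simp: linear_zero)
      qed (use that D f.linear_axioms in auto)
    qed
    show "\<exists>C. \<forall>\<^sub>F y in nhds x. \<forall>vs. length vs = n \<longrightarrow> norm (D n y vs) \<le> C * prod_norm vs" for n x
    proof -
      have "\<forall>\<^sub>F y in nhds x. norm (y - x) < 1"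
        using eventually_nhds_in_open[of "ball x 1" x] by (simp add: dist_norm norm_minus_commute)
      \<comment> \<open>The number \<open>norm x + 1\<close> bounds \<open>norm y\<close> near
        \<open>x\<close> and is at least 1, so a single constant covers the orders 0 and 1.\<close>
      then have "\<forall>\<^sub>F y in nhds x. \<forall>vs. length vs = n \<longrightarrow> norm (D n y vs) \<le> (K * (norm x
        + 1)) * prod_norm vs"
      proof eventually_elim
        case (elim y)
        have y: "norm y \<le> norm x + 1" using elim norm_triangle_sub[of y x] by auto
        have "norm (D n y vs) \<le> (K * (norm x + 1)) * prod_norm vs" for vs :: "'a list"
        proof -
          consider "vs = []" | u where "vs = [u]" | u w ws where "vs = u # w # ws"
            by (metis list.exhaust)
          then show ?thesis
          proof cases
            case 1
            have "norm (f y) \<le> (norm x + 1) * K"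
              using K y by (meson order_trans mult_right_mono less_imp_le)
            then show ?thesis using 1 D by (simp add: mult.commute)
          next
            case (2 u)
            have "norm (f u) \<le> (norm u * K) * 1" using K by simp
            also have "\<dots> \<le> (norm u * K) * (norm x + 1)" using K(1) by (intro mult_left_mono) auto
            finally show ?thesis using 2 D by (simp add: algebra_simps)
          next
            case 3
            then show ?thesis using D K(1) by simp
          qed
        qed
        then show ?case by blast
      qed
      then show ?thesis by blast
    qed
    show "((\<lambda>t. D n (x + t *\<^sub>R v) vs) has_vector_derivative D (Suc n) x (v # vs)) (at 0)"
      for n x v vs
    proof -
      consider "vs = []" | u where "vs = [u]" | u w ws where "vs = u # w # ws"
        by (metis list.exhaust)
      then show ?thesis
        by cases (use D has_vector_derivative_line_linear[OF f] in auto)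
    qed
  qed (auto simp: D)
qed

lemma smooth_at_bounded_linear: "bounded_linear f \<Longrightarrow> smooth_at f x"
  using smooth_atI[OF smooth_on_bounded_linear] by blast

lemma smooth_at_linear_compose:
  "bounded_linear L \<Longrightarrow> smooth_at f x \<Longrightarrow> smooth_at (\<lambda>x. L (f x)) x"
  by (rule smooth_at_compose[where g = L, OF _ smooth_at_bounded_linear])

lemma smooth_at_ident: "smooth_at (\<lambda>x. x) x"
  by (intro smooth_at_bounded_linear bounded_linear_ident)

lemma smooth_on_Pair:
  assumes f: "smooth_on S f" and g: "smooth_on S g"
  shows "smooth_on S (\<lambda>x. (f x, g x))"
proof (rule smooth_onI[where D = "\<lambda>n x vs. (iter_deriv f vs x, iter_deriv g vs x)"])
  show "open S" by (rule smooth_on_open[OF f])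
  show "linear (\<lambda>v. (iter_deriv f (vs[i := v]) x, iter_deriv g (vs[i := v]) x))"
    if "x \<in> S" "length vs = n" "i < n" for n x vs i
    using bounded_multilinear_linear[OF smooth_on_bounded_multilinear[OF f] that(2,3)]
      bounded_multilinear_linear[OF smooth_on_bounded_multilinear[OF g] that(2,3)] that(1)
    by (auto simp: linear_iff)
  show "\<exists>C. \<forall>\<^sub>F y in nhds x. \<forall>vs. length vs = n \<longrightarrow>
      norm (iter_deriv f vs y, iter_deriv g vs y) \<le> C * prod_norm vs" if "x \<in> S" for n x
  proof -
    obtain A where A: "\<forall>\<^sub>F y in nhds x. \<forall>vs. length vs = n \<longrightarrow> norm (iter_deriv f vs y)
      \<le> A * prod_norm vs"
      using smooth_on_locally_bounded[OF f \<open>x \<in> S\<close>] by blast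
    obtain B where B: "\<forall>\<^sub>F y in nhds x. \<forall>vs. length vs = n \<longrightarrow> norm (iter_deriv g vs y)
      \<le> B * prod_norm vs"
      using smooth_on_locally_bounded[OF g \<open>x \<in> S\<close>] by blast
    have "\<forall>\<^sub>F y in nhds x. \<forall>vs. length vs = n \<longrightarrow>
      norm (iter_deriv f vs y, iter_deriv g vs y) \<le> (A + B) * prod_norm vs"
      using A B
      by eventually_elim (auto simp: algebra_simps intro!: order_trans[OF norm_Pair_le] add_mono)
    then show ?thesis by blast
  qed
  show "((\<lambda>t. (iter_deriv f vs (x + t *\<^sub>R v), iter_deriv g vs (x + t *\<^sub>R v))) has_vector_derivative
      (iter_deriv f (v # vs) x, iter_deriv g (v # vs) x)) (at 0)" if "x \<in> S" for x v vs
    by (intro has_vector_derivative_Pair has_derivative_line[OF smooth_on_iter_deriv[OF f that]]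
        has_derivative_line[OF smooth_on_iter_deriv[OF g that]])
qed simp

lemma smooth_at_Pair:
  assumes "smooth_at f x" "smooth_at g x"
  shows "smooth_at (\<lambda>x. (f x, g x)) x"
proof -
  obtain S where S: "x \<in> S" "smooth_on S f" using assms unfolding smooth_at_def by blast
  obtain T where T: "x \<in> T" "smooth_on T g" using assms unfolding smooth_at_def by blast
  have "open (S \<inter> T)" using smooth_on_open[OF S(2)] smooth_on_open[OF T(2)] by blast
  then have "smooth_on (S \<inter> T) (\<lambda>x. (f x, g x))"
    using S T by (intro smooth_on_Pair smooth_on_subset[OF S(2)] smooth_on_subset[OF T(2)]) auto
  then show ?thesis using S T by (auto intro: smooth_atI)
qed

lemma smooth_on_const: "open S \<Longrightarrow> smooth_on S (\<lambda>x. c)"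
proof (rule smooth_onI[where D = "\<lambda>n x vs. if vs = [] then c else 0"], goal_cases)
  case (3 n x vs i)
  then have "vs[i := v] \<noteq> []" for v by auto
  then show ?case by (simp add: linear_zero)
next
  case (4 n x)
  have "\<forall>\<^sub>F y in nhds x. \<forall>vs. length vs = n \<longrightarrow> norm (if vs = [] then c else 0)
    \<le> norm c * prod_norm vs"
    by auto
  then show ?case by blast
qed auto

lemma smooth_at_const: "smooth_at (\<lambda>x. c) x"
  using smooth_atI[OF smooth_on_const[OF open_UNIV]] by blast

lemma smooth_on_bounded_bilinear:
  fixes b :: "'a::real_normed_vector \<Rightarrow> 'b::real_normed_vector \<Rightarrow> 'c::real_normed_vector"
  assumes b: "bounded_bilinear b"
  shows "smooth_on UNIV (\<lambda>p. b (fst p) (snd p))"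
proof -
  interpret b: bounded_bilinear b by (rule b)
  \<comment> \<open>This is the derivative at \<open>u\<close> in direction \<open>v\<close>. It is
    symmetric and bilinear, so it is also the constant second derivative, and all higher ones
    vanish.\<close>
  let ?s = "\<lambda>u v. b (fst u) (snd v) + b (fst v) (snd u)"
  define D where "D n x vs = (case vs of [] \<Rightarrow> b (fst x) (snd x) | [v] \<Rightarrow> ?s x v | [u, v] \<Rightarrow> ?s u v | _
    \<Rightarrow> 0)"
    for n :: nat and x and vs :: "('a \<times> 'b) list"
  have D: "D n x [] = b (fst x) (snd x)" "D n x [v] = ?s x v" "D n x [u, v] = ?s u v"
    "D n x (u # v # w # vs) = 0" for n x u v w vs
    by (auto simp: D_def)
  have bl: "bounded_linear (?s u)" "bounded_linear (\<lambda>v. ?s v u)" for u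
    by (intro bounded_linear_add bounded_linear_compose[OF b.bounded_linear_right]
        bounded_linear_compose[OF b.bounded_linear_left] bounded_linear_fst bounded_linear_snd)+
  obtain K where K: "K > 0" "\<And>x y. norm (b x y) \<le> norm x * norm y * K" using b.pos_bounded by blast
  have nb: "norm (b (fst u) (snd v)) \<le> norm u * norm v * K" for u v :: "'a \<times> 'b"
    using norm_fst_le[of "fst u" "snd u"] norm_snd_le[of "snd v" "fst v"] K(1)
    by (intro order_trans[OF K(2)] mult_right_mono mult_mono) auto
  have ns: "norm (?s u v) \<le> 2 * K * (norm u * norm v)" for u v
    using nb[of u v] nb[of v u] by (intro order_trans[OF norm_triangle_ineq]) (simp add:
      algebra_simps)
  have cases: "vs = [] \<or> (\<exists>u. vs = [u]) \<or> (\<exists>u v. vs = [u, v]) \<or> (\<exists>u v w ws. vs = u # v # w # ws)"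
    for vs :: "('a \<times> 'b) list"
    by (cases vs; cases "tl vs"; cases "tl (tl vs)") auto
  show ?thesis
  proof (rule smooth_onI[where D = D])
    show "linear (\<lambda>v. D n x (vs[i := v]))" if li: "length vs = n" "i < n" for n x i
      and vs :: "('a \<times> 'b) list"
      using cases[of vs]
    proof (elim disjE exE)
      fix u v w ws assume "vs = u # v # w # ws"
      then have len: "length (vs[i := y]) \<ge> 3" for y by (simp only: length_list_update) simp
      have "D n x (vs[i := y]) = 0" for y
        using cases[of "vs[i := y]"] len[of y]
          by (elim disjE exE) (simp_all add: D del: length_list_update)
      then show ?thesis by (simp add: linear_zero)
    next
      fix u v assume vs: "vs = [u, v]"
      then consider "i = 0" | "i = 1" using li by fastforce
      then show ?thesis using vs bl by cases (auto simp: D bounded_linear.linear)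
    qed (use li bl in \<open>auto simp: D bounded_linear.linear\<close>)
    show "\<exists>C. \<forall>\<^sub>F y in nhds x. \<forall>vs. length vs = n \<longrightarrow> norm (D n y vs) \<le> C * prod_norm vs" for n x
    proof -
      let ?R = "norm x + 1"
      have "\<forall>\<^sub>F y in nhds x. norm (y - x) < 1"
        using eventually_nhds_in_open[of "ball x 1" x] by (simp add: dist_norm norm_minus_commute)
      \<comment> \<open>As \<open>?R\<close> bounds \<open>norm y\<close> and is at least 1, two
        factors \<open>?R\<close> cover the orders 0, 1 and 2 at once.\<close>
      then have "\<forall>\<^sub>F y in nhds x. \<forall>vs. length vs = n \<longrightarrow> norm (D n y vs)
        \<le> (2 * K * ?R * ?R) * prod_norm vs"
      proof eventually_elim
        case (elim y)
        have y: "norm y \<le> ?R" using elim norm_triangle_sub[of y x] by auto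
        have "norm (D n y vs) \<le> (2 * K * ?R * ?R) * prod_norm vs" for vs :: "('a \<times> 'b) list"
          using cases[of vs]
        proof (elim disjE exE)
          assume vs: "vs = []"
          have "norm (b (fst y) (snd y)) \<le> norm y * norm y * K" by (rule nb)
          also have "\<dots> \<le> ?R * ?R * (2 * K)" using y K(1) by (intro mult_mono) auto
          finally show ?thesis by (simp add: D vs algebra_simps)
        next
          fix u assume vs: "vs = [u]"
          have "norm (?s y u) \<le> 2 * K * (norm y * norm u)" by (rule ns)
          also have "\<dots> \<le> 2 * K * ((?R * ?R) * norm u)"
            using y K(1) mult_mono[OF y, of 1 ?R] by (intro mult_left_mono mult_right_mono) auto
          finally show ?thesis by (simp add: D vs algebra_simps)
        next
          fix u v assume vs: "vs = [u, v]"
          have "norm (?s u v) \<le> (2 * K) * 1 * (norm u * norm v)" using ns[of u v] by simp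
          also have "\<dots> \<le> (2 * K) * (?R * ?R) * (norm u * norm v)"
            using K(1) mult_mono[of 1 ?R 1 ?R] by (intro mult_left_mono mult_right_mono) auto
          finally show ?thesis by (simp add: D vs algebra_simps)
        qed (use K(1) in \<open>auto simp: D\<close>)
        then show ?case by blast
      qed
      then show ?thesis by blast
    qed
    show "((\<lambda>t. D n (x + t *\<^sub>R v) vs) has_vector_derivative D (Suc n) x (v # vs)) (at 0)"
      for n x v vs
      using cases[of vs]
    proof (elim disjE exE)
      assume vs: "vs = []"
      have "((\<lambda>p. b (fst p) (snd p)) has_derivative (\<lambda>h. b (fst x) (snd h)
        + b (fst h) (snd x))) (at x)"
        by (intro b.FDERIV has_derivative_fst has_derivative_snd has_derivative_ident)
      from has_derivative_line[OF this] show ?thesis by (simp only: vs D)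
    next
      fix u assume vs: "vs = [u]"
      show ?thesis using has_vector_derivative_line_linear[OF bl(2)[of u], of x v]
        by (simp only: vs D)
    qed (auto simp: D)
  qed (auto simp: D)
qed

lemma smooth_at_bilinear:
  assumes b: "bounded_bilinear b" and "smooth_at f x" "smooth_at g x"
  shows "smooth_at (\<lambda>x. b (f x) (g x)) x"
  using smooth_at_compose[OF smooth_at_Pair[OF assms(2,3)] smooth_atI[OF
    smooth_on_bounded_bilinear[OF b]]]
  by simp

lemma smooth_at_fst: "smooth_at f x \<Longrightarrow> smooth_at (\<lambda>x. fst (f x)) x"
  by (rule smooth_at_linear_compose[OF bounded_linear_fst])

lemma smooth_at_snd: "smooth_at f x \<Longrightarrow> smooth_at (\<lambda>x. snd (f x)) x"
  by (rule smooth_at_linear_compose[OF bounded_linear_snd])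

lemma smooth_at_add:
  assumes "smooth_at f x" "smooth_at g x"
  shows "smooth_at (\<lambda>x. f x + g x) x"
  using smooth_at_linear_compose[OF bounded_linear_add[OF bounded_linear_fst bounded_linear_snd]
    smooth_at_Pair[OF assms]]
  by simp

lemma smooth_at_scaleR:
  "smooth_at f x \<Longrightarrow> smooth_at g x \<Longrightarrow> smooth_at (\<lambda>x. f x *\<^sub>R g x) x"
  by (rule smooth_at_bilinear[OF bounded_bilinear_scaleR])

lemma smooth_at_sum:
  "(\<And>i. i \<in> I \<Longrightarrow> smooth_at (f i) x) \<Longrightarrow> smooth_at (\<lambda>x. \<Sum>i\<in>I. f i x) x"
  by (induction I rule: infinite_finite_induct) (auto intro!: smooth_at_const smooth_at_add)

lemma smooth_at_power:
  "smooth_at f x \<Longrightarrow> smooth_at (\<lambda>x. (f x :: real) ^ n) x"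
  by (induction n) (auto intro!: smooth_at_const smooth_at_bilinear[OF bounded_bilinear_mult])

lemma smooth_at_apply:
  "smooth_at f x \<Longrightarrow> smooth_at g x \<Longrightarrow> smooth_at (\<lambda>x. blinfun_apply (f x) (g x)) x"
  by (rule smooth_at_bilinear[OF bounded_bilinear_blinfun_apply])


subsection \<open>The derivative as a map into a space of operators\<close>

text \<open>The derivative as an element of the Banach space of operators, so that it can be
  differentiated again. \<open>Blinfun\<close> is meaningful for bounded linear arguments only,
  hence the smoothness hypotheses in the facts about it.\<close>

definition fderiv ::
    "('a::real_normed_vector \<Rightarrow> 'b::real_normed_vector) \<Rightarrow> 'a \<Rightarrow> 'a \<Rightarrow>\<^sub>L 'b" where
  "fderiv f x = Blinfun (\<lambda>h. iter_deriv f [h] x)"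

lemma fderiv_apply:
  "smooth_at f x \<Longrightarrow> blinfun_apply (fderiv f x) h = iter_deriv f [h] x"
  by (simp add: fderiv_def  bounded_linear_Blinfun_apply[OF has_derivative_bounded_linear[OF
    smooth_at_has_derivative_0]]
      del: iter_deriv.simps)

lemma smooth_at_has_derivative:
  assumes "smooth_at f x"
  shows "(f has_derivative blinfun_apply (fderiv f x)) (at x)"
proof -
  have "blinfun_apply (fderiv f x) = (\<lambda>h. iter_deriv f [h] x)"
    using fderiv_apply[OF assms] by (rule ext)
  then show ?thesis using smooth_at_has_derivative_0[OF assms] by simp
qed

lemma fderiv_unique:
  assumes "smooth_at f x" "(f has_derivative f') (at x)"
  shows "blinfun_apply (fderiv f x) = f'"
  using has_derivative_unique[OF smooth_at_has_derivative[OF assms(1)] assms(2)] .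

lemma bounded_multilinear_bounded_linear_last:
  assumes m: "bounded_multilinear (Suc n) m" and vs: "length vs = n"
  shows "bounded_linear (\<lambda>v. m (vs @ [v]))"
proof -
  obtain C where "C > 0" and C: "\<And>vs. length vs = Suc n \<Longrightarrow> norm (m vs) \<le> C * prod_norm vs"
    using bounded_multilinear_pos_bound[OF m] by blast
  have "linear (\<lambda>v. m ((vs @ [0])[n := v]))"
    using m vs by (intro bounded_multilinear_linear) auto
  then have "linear (\<lambda>v. m (vs @ [v]))" using vs by (simp add: list_update_append)
  moreover have "norm (m (vs @ [v])) \<le> norm v * (C * prod_norm vs)" for v
    using C[of "vs @ [v]"] vs by (simp add: algebra_simps)
  ultimately show ?thesis
    by (intro bounded_linear.intro bounded_linear_axioms.intro) blast+
qed

lemma bounded_multilinear_Blinfun: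
  assumes m: "bounded_multilinear (Suc n) m"
  shows "bounded_multilinear n (\<lambda>vs. Blinfun (\<lambda>v. m (vs @ [v])))"
proof -
  obtain C where "C > 0" and C: "\<And>vs. length vs = Suc n \<Longrightarrow> norm (m vs) \<le> C * prod_norm vs"
    using bounded_multilinear_pos_bound[OF m] by blast
  have app: "blinfun_apply (Blinfun (\<lambda>v. m (vs @ [v]))) w = m (vs @ [w])" if "length vs = n"
    for vs w
    using bounded_linear_Blinfun_apply[OF bounded_multilinear_bounded_linear_last[OF m that]]
      by simp
  show ?thesis
  proof (rule bounded_multilinearI)
    fix vs :: "'a list" and i assume vs: "length vs = n" "i < n"
    have "linear (\<lambda>v. m ((vs @ [w])[i := v]))" for w
      using bounded_multilinear_linear[OF m] vs by simp
    then have lin: "linear (\<lambda>v. m (vs[i := v] @ [w]))" for w using vs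
      by (simp add: list_update_append)
    show "linear (\<lambda>v. Blinfun (\<lambda>w. m (vs[i := v] @ [w])))"
    proof (rule linearI; rule blinfun_eqI)
      fix u v w
      show "blinfun_apply (Blinfun (\<lambda>w. m (vs[i := u + v] @ [w]))) w =
          blinfun_apply (Blinfun (\<lambda>w. m (vs[i := u] @ [w])) + Blinfun (\<lambda>w. m (vs[i := v] @ [w]))) w"
        unfolding blinfun.add_left using vs(1) linear_add[OF lin[of w]]
          by (simp only: app length_list_update)
    next
      fix u w and c :: real
      show "blinfun_apply (Blinfun (\<lambda>w. m (vs[i := c *\<^sub>R u] @ [w]))) w =
          blinfun_apply (c *\<^sub>R Blinfun (\<lambda>w. m (vs[i := u] @ [w]))) w"
        unfolding blinfun.scaleR_left using vs(1) linear_scale[OF lin[of w]]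
          by (simp only: app length_list_update)
    qed
  next
    fix vs :: "'a list" assume vs: "length vs = n"
    show "norm (Blinfun (\<lambda>v. m (vs @ [v]))) \<le> C * prod_norm vs"
    proof (rule norm_blinfun_bound)
      show "norm (blinfun_apply (Blinfun (\<lambda>v. m (vs @ [v]))) w) \<le> C * prod_norm vs * norm w" for w
        using C[of "vs @ [w]"] vs by (simp add: app algebra_simps)
    qed (use \<open>C > 0\<close> in simp)
  qed
qed

text \<open>The last entry of the list is the innermost direction, the one differentiated first. So
  the derivatives of \<open>fderiv f\<close> are those of \<open>f\<close> of one order higher with
  the last slot left open.\<close>

lemma smooth_on_fderiv:
  assumes f: "smooth_on S f"
  shows "smooth_on S (fderiv f)"
  unfolding smooth_on_def
proof (intro conjI exI[of _ "\<lambda>n x vs. Blinfun (\<lambda>v. iter_deriv f (vs @ [v]) x)"] ballI allI impI)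
  have bm: "bounded_multilinear n (\<lambda>vs. iter_deriv f vs x)" if "x \<in> S" for n x
    by (rule smooth_on_bounded_multilinear[OF f that])
  have app: "blinfun_apply (Blinfun (\<lambda>v. iter_deriv f (vs @ [v]) x)) w = iter_deriv f (vs @ [w]) x"
    if "x \<in> S" for vs x w
    using bounded_linear_Blinfun_apply[OF bounded_multilinear_bounded_linear_last[OF bm[OF that]
      refl]] by metis
  show S: "open S" by (rule smooth_on_open[OF f])
  show "Blinfun (\<lambda>v. iter_deriv f ([] @ [v]) x) = fderiv f x" for x by (simp add: fderiv_def)
  show "bounded_multilinear n (\<lambda>vs. Blinfun (\<lambda>v. iter_deriv f (vs @ [v]) x))" if "x \<in> S" for n x
    by (rule bounded_multilinear_Blinfun[OF bm[OF that]])
  fix n x and e :: real assume x: "x \<in> S" and "e > 0"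
  obtain d where "d > 0" and d: "\<And>h vs. norm h < d \<Longrightarrow> length vs = Suc n \<Longrightarrow>
      norm (iter_deriv f vs (x + h) - iter_deriv f vs x - iter_deriv f (h # vs) x)
        \<le> e * norm h * prod_norm vs"
    using smooth_on_multi_diff[OF f x] \<open>e > 0\<close> unfolding multi_diff_def by metis
  obtain r where "r > 0" and r: "ball x r \<subseteq> S" using S x open_contains_ball by blast
  have xh: "x + h \<in> S" if "norm h < r" for h using r that by (auto simp: dist_norm subset_eq)
  have "norm (Blinfun (\<lambda>v. iter_deriv f (vs @ [v]) (x
    + h)) - Blinfun (\<lambda>v. iter_deriv f (vs @ [v]) x)
      - Blinfun (\<lambda>v. iter_deriv f ((h # vs) @ [v]) x)) \<le> e * norm h * prod_norm vs"
    if "norm h < min d r" "length vs = n" for h vs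
  proof (rule norm_blinfun_bound)
    show "0 \<le> e * norm h * prod_norm vs" using \<open>e > 0\<close> by simp
    fix w
    have "blinfun_apply (Blinfun (\<lambda>v. iter_deriv f (vs @ [v]) (x
      + h)) - Blinfun (\<lambda>v. iter_deriv f (vs @ [v]) x)
        - Blinfun (\<lambda>v. iter_deriv f ((h # vs) @ [v]) x)) w =
        iter_deriv f (vs @ [w]) (x + h) - iter_deriv f (vs @ [w]) x - iter_deriv f (h # vs @ [w]) x"
      using that app[OF x, of vs w] app[OF x, of "h # vs" w] app[OF xh, of h vs w]
      by (simp add: blinfun.diff_left del: iter_deriv.simps)
    then show "norm (blinfun_apply (Blinfun (\<lambda>v. iter_deriv f (vs @ [v]) (x
      + h)) - Blinfun (\<lambda>v. iter_deriv f (vs @ [v]) x)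
      - Blinfun (\<lambda>v. iter_deriv f ((h # vs) @ [v]) x)) w) \<le> e * norm h * prod_norm vs * norm w"
      using d[of h "vs @ [w]"] that by (simp add: mult.assoc del: iter_deriv.simps)
  qed
  then show "\<exists>d>0. \<forall>h. norm h < d \<longrightarrow> (\<forall>vs. length vs = n \<longrightarrow>
      norm (Blinfun (\<lambda>v. iter_deriv f (vs @ [v]) (x + h)) - Blinfun (\<lambda>v. iter_deriv f (vs @ [v]) x)
      - Blinfun (\<lambda>v. iter_deriv f ((h # vs) @ [v]) x)) \<le> e * norm h * prod_norm vs)"
    using \<open>d > 0\<close> \<open>r > 0\<close> by (intro exI[of _ "min d r"]) auto
qed

lemma smooth_at_fderiv: "smooth_at f x \<Longrightarrow> smooth_at (fderiv f) x"
  unfolding smooth_at_def using smooth_on_fderiv by blast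

lemma smooth_at_fderiv_apply:
  "smooth_at f (p x) \<Longrightarrow> smooth_at p x \<Longrightarrow> smooth_at v x \<Longrightarrow>
    smooth_at (\<lambda>x. blinfun_apply (fderiv f (p x)) (v x)) x"
  by (rule smooth_at_apply[OF smooth_at_compose[where f = p and g
    = "fderiv f", OF _ smooth_at_fderiv]])

subsection \<open>Symmetry of the second derivative\<close>

text \<open>Mean value inequality in the direction of \<open>u\<close> for a difference in the
  direction of \<open>v\<close>. The second derivative is only needed at \<open>x\<close> itself:
  differentiability of \<open>fderiv f\<close> there controls both difference points.\<close>

lemma second_difference_bound:
  fixes f :: "'a::real_normed_vector \<Rightarrow> 'b::real_normed_vector"
  assumes f: "smooth_at f x" and "e > 0"
  shows "\<forall>\<^sub>F s in at_right 0. norm (f (x + s *\<^sub>R u + s *\<^sub>R v) - f (x + s *\<^sub>R u) - f (x + s *\<^sub>R v)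
    + f x
     - (s * s) *\<^sub>R fderiv (fderiv f) x v u) \<le> e * (s * s)"
proof -
  define B where "B = norm u + norm v + 1"
  have B: "B > 0" "norm u \<le> B" "norm v \<le> B" by (auto simp: B_def add_nonneg_pos)
  \<comment> \<open>Two points at distance at most \<open>2 * B * s\<close> from \<open>x\<close>
    contribute \<open>e' * (2 * B * s)\<close> each, and evaluation at \<open>u\<close> costs
    another factor \<open>B\<close>: altogether \<open>e * s\<close>.\<close>
  define e' where "e' = e / (4 * B * B)"
  have "e' > 0" using \<open>e > 0\<close> B by (simp add: e'_def)
  let ?D2 = "fderiv (fderiv f) x"
  have "(fderiv f has_derivative blinfun_apply ?D2) (at x)"
    by (rule smooth_at_has_derivative[OF smooth_at_fderiv[OF f]])
  then obtain d where "d > 0" and d: "\<And>y. norm (y - x) < d \<Longrightarrow>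
      norm (fderiv f y - fderiv f x - ?D2 (y - x)) \<le> e' * norm (y - x)"
    using \<open>e' > 0\<close> unfolding has_derivative_at_alt by blast
  obtain r where "r > 0" and r: "\<And>y. dist y x < r \<Longrightarrow> smooth_at f y"
    using smooth_at_eventually[OF f] unfolding eventually_nhds_metric by blast
  have "norm (f (x + s *\<^sub>R u + s *\<^sub>R v) - f (x + s *\<^sub>R u) - f (x + s *\<^sub>R v)
    + f x - (s * s) *\<^sub>R ?D2 v u) \<le> e * (s * s)"
    if s: "0 < s" "s < min r d / (2 * B)" for s :: real
  proof -
    have small: "norm (t *\<^sub>R u + s' *\<^sub>R v) \<le> 2 * B * s" if "t \<in> {0..s}" "s' \<in> {0..s}" for t s'
    proof -
      have "norm (t *\<^sub>R u + s' *\<^sub>R v) \<le> t * norm u + s' * norm v"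
        using norm_triangle_ineq[of "t *\<^sub>R u" "s' *\<^sub>R v"] that by simp
      also have "\<dots> \<le> s * B + s * B" using that B by (intro add_mono mult_mono) auto
      finally show ?thesis by simp
    qed
    have sB: "2 * B * s < min r d" using s B by (simp add: field_simps)
    \<comment> \<open>Its increment from 0 to \<open>s\<close> is the second difference minus the
      claimed main term.\<close>
    let ?\<phi> = "\<lambda>t. f (x + t *\<^sub>R u + s *\<^sub>R v) - f (x + t *\<^sub>R u) - (t * s) *\<^sub>R ?D2 v u"
    let ?\<phi>' = "\<lambda>t. fderiv f (x + t *\<^sub>R u + s *\<^sub>R v) u - fderiv f (x + t *\<^sub>R u) u - s *\<^sub>R ?D2 v u"
    have "norm (?\<phi> s - ?\<phi> 0) \<le> (e * s) * norm (s - 0)"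
    proof (rule differentiable_bound[where S = "{0..s}" and f' = "\<lambda>t h. h *\<^sub>R ?\<phi>' t"])
      fix t :: real assume t: "t \<in> {0..s}"
      let ?y = "x + t *\<^sub>R u + s *\<^sub>R v" and ?z = "x + t *\<^sub>R u"
      have ny: "norm (?y - x) \<le> 2 * B * s" using small[OF t, of s] s by (simp add: algebra_simps)
      have nz: "norm (?z - x) \<le> 2 * B * s" using small[OF t, of 0] s by (simp add: algebra_simps)
      have sm: "smooth_at f ?y" "smooth_at f ?z"
        using ny nz sB by (auto intro!: r simp: dist_norm)
      have "((\<lambda>t. x + t *\<^sub>R u + s *\<^sub>R v) has_derivative (\<lambda>h. h *\<^sub>R u)) (at t within {0..s})"
        by (auto intro!: derivative_eq_intros)
      from has_derivative_compose[OF this smooth_at_has_derivative[OF sm(1)]]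
      have 1: "((\<lambda>t. f (x + t *\<^sub>R u + s *\<^sub>R v)) has_derivative (\<lambda>h. h *\<^sub>R fderiv f ?y u)) (at t
        within {0..s})"
        by (simp add: blinfun.scaleR_right)
      have "((\<lambda>t. x + t *\<^sub>R u) has_derivative (\<lambda>h. h *\<^sub>R u)) (at t within {0..s})"
        by (auto intro!: derivative_eq_intros)
      from has_derivative_compose[OF this smooth_at_has_derivative[OF sm(2)]]
      have 2: "((\<lambda>t. f (x + t *\<^sub>R u)) has_derivative (\<lambda>h. h *\<^sub>R fderiv f ?z u)) (at t within
        {0..s})"
        by (simp add: blinfun.scaleR_right)
      have 3: "((\<lambda>t. (t * s) *\<^sub>R ?D2 v u) has_derivative (\<lambda>h. (h * s) *\<^sub>R ?D2 v u)) (at t within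
        {0..s})"
        by (auto intro!: derivative_eq_intros)
      show "(?\<phi> has_derivative (\<lambda>h. h *\<^sub>R ?\<phi>' t)) (at t within {0..s})"
        using has_derivative_diff[OF has_derivative_diff[OF 1 2] 3] by (simp add: algebra_simps)
      have "fderiv f ?y - fderiv f ?z - s *\<^sub>R ?D2 v =
          (fderiv f ?y - fderiv f x - ?D2 (?y - x)) - (fderiv f ?z - fderiv f x - ?D2 (?z - x))"
        by (simp add: blinfun.add_right blinfun.scaleR_right blinfun.diff_right)
      also have "norm \<dots> \<le> e' * norm (?y - x) + e' * norm (?z - x)"
        using ny nz sB by (intro order_trans[OF norm_triangle_ineq4] add_mono d) auto
      also have "\<dots> \<le> e' * (2 * B * s) + e' * (2 * B * s)"
        using \<open>e' > 0\<close> ny nz by (intro add_mono mult_left_mono) auto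
      finally have n: "norm (fderiv f ?y - fderiv f ?z - s *\<^sub>R ?D2 v) \<le> 4 * e' * B * s"
        by (simp add: algebra_simps)
      have "norm (?\<phi>' t) = norm ((fderiv f ?y - fderiv f ?z - s *\<^sub>R ?D2 v) u)"
        by (simp add: blinfun.diff_left blinfun.scaleR_left)
      also have "\<dots> \<le> (4 * e' * B * s) * B"
        using n B s \<open>e' > 0\<close> by (intro order_trans[OF norm_blinfun] mult_mono) auto
      also have "\<dots> = e * s" using B by (simp add: e'_def)
      finally have "norm (?\<phi>' t) \<le> e * s" .
      then show "onorm (\<lambda>h. h *\<^sub>R ?\<phi>' t) \<le> e * s"
        by (intro onorm_le, unfold norm_scaleR real_norm_def, subst mult.commute) (intro
          mult_right_mono, auto)
    qed (use s in auto)
    then show ?thesis using s by (simp add: algebra_simps)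
  qed
  then show ?thesis unfolding eventually_at_right_field
    using \<open>r > 0\<close> \<open>d > 0\<close> B by (intro exI[of _ "min r d / (2 * B)"]) auto
qed

text \<open>The second difference is symmetric in \<open>u\<close> and \<open>v\<close>, whereas its
  main term is the second derivative in one order of the arguments or the other, according to the
  direction in which the estimate is run.\<close>

lemma fderiv_fderiv_commute:
  assumes f: "smooth_at f x"
  shows "fderiv (fderiv f) x u v = fderiv (fderiv f) x v u"
proof -
  let ?D2 = "fderiv (fderiv f) x"
  have "norm (?D2 u v - ?D2 v u) \<le> e" if "e > 0" for e :: real
  proof -
    let ?\<Delta> = "\<lambda>s. f (x + s *\<^sub>R u + s *\<^sub>R v) - f (x + s *\<^sub>R u) - f (x + s *\<^sub>R v) + f x"
    have "\<forall>\<^sub>F s in at_right (0::real). s > 0 \<and> norm (?\<Delta> s - (s * s) *\<^sub>R ?D2 v u) \<le> e / 2 * (s * s)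
        \<and> norm (?\<Delta> s - (s * s) *\<^sub>R ?D2 u v) \<le> e / 2 * (s * s)"
      using second_difference_bound[OF f, of "e / 2" u v] second_difference_bound[OF f, of "e / 2" v
        u]
        eventually_at_right_less[of 0] \<open>e > 0\<close>
      by (intro eventually_conj) (simp_all add: algebra_simps)
    then obtain s :: real where s: "s > 0" "norm (?\<Delta> s - (s * s) *\<^sub>R ?D2 v u) \<le> e / 2 * (s * s)"
        "norm (?\<Delta> s - (s * s) *\<^sub>R ?D2 u v) \<le> e / 2 * (s * s)"
      using eventually_happens'[OF trivial_limit_at_right_real] by blast
    have "(s * s) *\<^sub>R (?D2 u v - ?D2 v u) = (?\<Delta> s - (s * s) *\<^sub>R ?D2 v u) - (?\<Delta> s - (s * s) *\<^sub>R ?D2 u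
      v)"
      by (simp add: algebra_simps)
    also have "norm \<dots> \<le> e / 2 * (s * s) + e / 2 * (s * s)"
      by (intro order_trans[OF norm_triangle_ineq4] add_mono s)
    finally have "norm ((s * s) *\<^sub>R (?D2 u v - ?D2 v u)) \<le> (s * s) * e" by (simp add: mult.commute)
    then have "(s * s) * norm (?D2 u v - ?D2 v u) \<le> (s * s) * e" using s(1) by simp
    then show ?thesis using s(1) by simp
  qed
  then have "norm (?D2 u v - ?D2 v u) \<le> 0" by (rule field_le_epsilon[of _ 0, simplified])
  then show ?thesis by simp
qed

section \<open>Charts\<close>

abbreviation chart_inv :: "('m, 'e) chart \<Rightarrow> 'e \<Rightarrow> 'm" where
  "chart_inv c \<equiv> inv_into (fst c) (snd c)"

lemma open_iff_eventually: "open S \<longleftrightarrow> (\<forall>x\<in>S. \<forall>\<^sub>F y in nhds x. y \<in> S)"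
proof (intro iffI ballI)
  fix x assume "open S" "x \<in> S"
  then show "\<forall>\<^sub>F y in nhds x. y \<in> S" by (rule eventually_nhds_in_open)
next
  assume *: "\<forall>x\<in>S. \<forall>\<^sub>F y in nhds x. y \<in> S"
  show "open S"
  proof (subst open_subopen, intro ballI)
    fix x assume "x \<in> S"
    then have "\<forall>\<^sub>F y in nhds x. y \<in> S" using * by simp
    then show "\<exists>T. open T \<and> x \<in> T \<and> T \<subseteq> S" by (auto simp: eventually_nhds)
  qed
qed

section \<open>Charts of the maximal atlas and smooth maps in charts\<close>

lemma chart_inv_left: "is_chart c \<Longrightarrow> x \<in> fst c \<Longrightarrow> chart_inv c (snd c x) = x"
  by (cases c) (simp add: is_chart_def)

lemma chart_open: "is_chart c \<Longrightarrow> open (snd c ` fst c)"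
  by (cases c) (simp add: is_chart_def)

lemma chart_inj: "is_chart c \<Longrightarrow> x \<in> fst c \<Longrightarrow> y \<in> fst c \<Longrightarrow> snd c x = snd c y \<Longrightarrow> x = y"
  by (metis chart_inv_left)

lemma compatible_iff: "compatible c d \<longleftrightarrow>
    smooth_on (snd c ` (fst c \<inter> fst d)) (\<lambda>u. snd d (chart_inv c u)) \<and>
    smooth_on (snd d ` (fst c \<inter> fst d)) (\<lambda>u. snd c (chart_inv d u))"
  by (cases c; cases d) (simp add: compatible_def o_def)

lemma chart_is_chart: "c \<in> charts A \<Longrightarrow> is_chart c"
  by (simp add: charts_def)

lemma atlas_subset_charts: "banach_manifold A \<Longrightarrow> A \<subseteq> charts A"
  by (auto simp: banach_manifold_def charts_def points_def)

lemma charts_points: "c \<in> charts A \<Longrightarrow> x \<in> fst c \<Longrightarrow> x \<in> points A"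
  by (auto simp: charts_def)

lemma points_chart:
  assumes "banach_manifold A" "x \<in> points A"
  obtains c where "c \<in> charts A" "x \<in> fst c"
  using assms atlas_subset_charts[OF assms(1)] by (auto simp: points_def)

text \<open>Charts of the maximal atlas are compatible by definition only with members of
  \<open>A\<close>. Around each point the transition passes through some \<open>a\<close> in
  \<open>A\<close>; injectivity of \<open>a\<close> shows that the image of the overlap is
  open.\<close>

lemma smooth_on_transition:
  assumes A: "banach_manifold A" and c: "c \<in> charts A" and d: "d \<in> charts A"
  shows "smooth_on (snd c ` (fst c \<inter> fst d)) (\<lambda>u. snd d (chart_inv c u))"
proof -
  have C: "is_chart c" "is_chart d" using c d by (auto intro: chart_is_chart)
  have *: "smooth_at (\<lambda>u. snd d (chart_inv c u)) (snd c x) \<and>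
      (\<forall>\<^sub>F u in nhds (snd c x). u \<in> snd c ` (fst c \<inter> fst d))" if x: "x \<in> fst c" "x \<in> fst d" for x
  proof -
    obtain a where a: "a \<in> A" "x \<in> fst a"
      using charts_points[OF c x(1)] by (auto simp: points_def)
    have Ca: "is_chart a" using A a by (auto simp: banach_manifold_def)
    have ca: "smooth_on (snd c ` (fst c \<inter> fst a)) (\<lambda>u. snd a (chart_inv c u))"
      using c a by (auto simp: charts_def compatible_iff)
    have ad: "smooth_on (snd a ` (fst a \<inter> fst d)) (\<lambda>u. snd d (chart_inv a u))"
      using d a by (auto simp: charts_def compatible_iff Int_commute)
    have x': "snd c x \<in> snd c ` (fst c \<inter> fst a)" "snd a x \<in> snd a ` (fst a \<inter> fst d)"
      using x a by auto
    have s: "smooth_at (\<lambda>u. snd a (chart_inv c u)) (snd c x)" by (rule smooth_atI[OF ca x'(1)])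
    have t: "smooth_at (\<lambda>u. snd d (chart_inv a u)) (snd a (chart_inv c (snd c x)))"
      using smooth_atI[OF ad x'(2)] x C by (simp add: chart_inv_left)
    have e1: "\<forall>\<^sub>F u in nhds (snd c x). u \<in> snd c ` (fst c \<inter> fst a)"
      by (rule eventually_nhds_in_open[OF smooth_on_open[OF ca] x'(1)])
    have "\<forall>\<^sub>F v in nhds (snd a (chart_inv c (snd c x))). v \<in> snd a ` (fst a \<inter> fst d)"
      using eventually_nhds_in_open[OF smooth_on_open[OF ad] x'(2)] x C
        by (simp add: chart_inv_left)
    then have e2: "\<forall>\<^sub>F u in nhds (snd c x). snd a (chart_inv c u) \<in> snd a ` (fst a \<inter> fst d)"
      by (rule smooth_at_compose_eventually[OF s])
    have e: "\<forall>\<^sub>F u in nhds (snd c x). u \<in> snd c ` (fst c \<inter> fst d \<inter> fst a)"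
      using e1 e2
    proof eventually_elim
      case (elim u)
      then obtain y where y: "y \<in> fst c" "y \<in> fst a" "u = snd c y" by auto
      then have "snd a y \<in> snd a ` (fst a \<inter> fst d)" using elim(2) C by (simp add: chart_inv_left)
      then have "y \<in> fst d" using chart_inj[OF Ca] y by auto
      then show ?case using y by auto
    qed
    have "smooth_at (\<lambda>u. snd d (chart_inv c u)) (snd c x)"
    proof (rule smooth_at_cong[OF smooth_at_compose[OF s t]])
      show "\<forall>\<^sub>F u in nhds (snd c x). snd d (chart_inv a (snd a (chart_inv c u)))
        = snd d (chart_inv c u)"
        using e by eventually_elim (use C Ca in \<open>auto simp: chart_inv_left\<close>)
    qed
    moreover have "\<forall>\<^sub>F u in nhds (snd c x). u \<in> snd c ` (fst c \<inter> fst d)"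
      using e by eventually_elim auto
    ultimately show ?thesis by blast
  qed
  then show ?thesis
    unfolding smooth_on_iff_smooth_at open_iff_eventually by auto
qed

lemma transition:
  assumes "banach_manifold A" "c \<in> charts A" "d \<in> charts A" "x \<in> fst c" "x \<in> fst d"
  shows "smooth_at (\<lambda>u. snd d (chart_inv c u)) (snd c x)"
    and "\<forall>\<^sub>F u in nhds (snd c x). u \<in> snd c ` (fst c \<inter> fst d)"
proof -
  have x: "snd c x \<in> snd c ` (fst c \<inter> fst d)" using assms by auto
  note s = smooth_on_transition[OF assms(1-3)]
  show "smooth_at (\<lambda>u. snd d (chart_inv c u)) (snd c x)" by (rule smooth_atI[OF s x])
  show "\<forall>\<^sub>F u in nhds (snd c x). u \<in> snd c ` (fst c \<inter> fst d)"
    by (rule eventually_nhds_in_open[OF smooth_on_open[OF s] x])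
qed

lemma eventually_chart_inv:
  assumes c: "is_chart c" and x: "x \<in> fst c"
  shows "\<forall>\<^sub>F u in nhds (snd c x). chart_inv c u \<in> fst c \<and> snd c (chart_inv c u) = u"
proof -
  have "\<forall>\<^sub>F u in nhds (snd c x). u \<in> snd c ` fst c"
    using x by (intro eventually_nhds_in_open chart_open[OF c]) auto
  then show ?thesis by eventually_elim (use c in \<open>auto simp: chart_inv_left\<close>)
qed

text \<open>\<open>smooth_map\<close> supplies one pair of charts around each point; transition maps
  on both sides lead to an arbitrary pair. The second conclusion is the continuity of
  \<open>g\<close>, which is contained in the condition on the domains.\<close>

lemma smooth_map_at:
  assumes A: "banach_manifold A" and B: "banach_manifold B" and g: "smooth_map A B g"
    and c: "c \<in> charts A" "x \<in> fst c" and d: "d \<in> charts B" "g x \<in> fst d"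
  shows "smooth_at (\<lambda>u. snd d (g (chart_inv c u))) (snd c x)"
    and "\<forall>\<^sub>F u in nhds (snd c x). g (chart_inv c u) \<in> fst d"
proof -
  have C: "is_chart c" "is_chart d" using c d by (auto intro: chart_is_chart)
  obtain c' d' where c': "c' \<in> charts A" "x \<in> fst c'" and d': "d' \<in> charts B"
    and sub: "g ` fst c' \<subseteq> fst d'"
    and sm: "smooth_on (snd c' ` fst c') (\<lambda>u. snd d' (g (chart_inv c' u)))"
    using g charts_points[OF c] unfolding smooth_map_def o_def by fastforce
  have C': "is_chart c'" "is_chart d'" using c' d' by (auto intro: chart_is_chart)
  have gx: "g x \<in> fst d'" using sub c' by auto
  let ?\<tau> = "\<lambda>u. snd c' (chart_inv c u)" and ?\<sigma> = "\<lambda>u. snd d (chart_inv d' u)"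
  let ?g = "\<lambda>u. snd d' (g (chart_inv c' u))"
  have s1: "smooth_at ?\<tau> (snd c x)" by (rule transition[OF A c(1) c'(1) c(2) c'(2)])
  have s2: "smooth_at ?g (?\<tau> (snd c x))"
    using smooth_atI[OF sm, of "snd c' x"] c c' C by (simp add: chart_inv_left)
  have gx': "?g (?\<tau> (snd c x)) = snd d' (g x)" using c c' C C' by (simp add: chart_inv_left)
  have s3: "smooth_at ?\<sigma> (?g (?\<tau> (snd c x)))"
    unfolding gx' by (rule transition[OF B d'(1) d(1) gx d(2)])
  have s12: "smooth_at (\<lambda>u. ?g (?\<tau> u)) (snd c x)" by (rule smooth_at_compose[OF s1 s2])
  have e1: "\<forall>\<^sub>F u in nhds (snd c x). u \<in> snd c ` (fst c \<inter> fst c')"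
    by (rule transition[OF A c(1) c'(1) c(2) c'(2)])
  have "\<forall>\<^sub>F v in nhds (?g (?\<tau> (snd c x))). v \<in> snd d' ` (fst d' \<inter> fst d)"
    unfolding gx' by (rule transition[OF B d'(1) d(1) gx d(2)])
  then have e2: "\<forall>\<^sub>F u in nhds (snd c x). ?g (?\<tau> u) \<in> snd d' ` (fst d' \<inter> fst d)"
    by (rule smooth_at_compose_eventually[OF s12])
  have e: "\<forall>\<^sub>F u in nhds (snd c x). g (chart_inv c u) \<in> fst d \<and> ?\<sigma> (?g (?\<tau> u))
    = snd d (g (chart_inv c u))"
    using e1 e2
  proof eventually_elim
    case (elim u)
    then obtain y where y: "y \<in> fst c" "y \<in> fst c'" "u = snd c y" by auto
    then have 1: "chart_inv c u = y" "chart_inv c' (?\<tau> u) = y" using C C'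
      by (simp_all add: chart_inv_left)
    then have "snd d' (g y) \<in> snd d' ` (fst d' \<inter> fst d)" using elim(2) by simp
    moreover have gy: "g y \<in> fst d'" using y sub by auto
    ultimately have "g y \<in> fst d" using chart_inj[OF C'(2)] by auto
    then show ?case using 1 gy C' by (simp add: chart_inv_left)
  qed
  show "smooth_at (\<lambda>u. snd d (g (chart_inv c u))) (snd c x)"
    by (rule smooth_at_cong[OF smooth_at_compose[OF s12 s3]]) (use e in \<open>auto elim:
      eventually_mono\<close>)
  show "\<forall>\<^sub>F u in nhds (snd c x). g (chart_inv c u) \<in> fst d"
    using e by eventually_elim auto
qed


section \<open>Curves and jets\<close>

text \<open>The form of \<open>smooth_curve\<close> in a fixed chart (see
  \<open>smooth_curve_iff\<close>), a condition on the germ at 0.\<close>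

definition curve_in :: "('m, 'e::banach) chart \<Rightarrow> (real \<Rightarrow> 'm) \<Rightarrow> bool" where
  "curve_in c \<gamma> \<longleftrightarrow> smooth_at (\<lambda>t. snd c (\<gamma> t)) 0 \<and> (\<forall>\<^sub>F t in nhds 0. \<gamma> t \<in> fst c)"

lemma curve_in_0: "curve_in c \<gamma> \<Longrightarrow> \<gamma> 0 \<in> fst c"
  unfolding curve_in_def using eventually_nhds_x_imp_x by blast

lemma curve_in_smooth_map:
  assumes A: "banach_manifold A" and B: "banach_manifold B" and g: "smooth_map A B g"
    and c: "c \<in> charts A" "curve_in c \<gamma>" and d: "d \<in> charts B" "g (\<gamma> 0) \<in> fst d"
  shows "curve_in d (g \<circ> \<gamma>)"
proof -
  have C: "is_chart c" using c by (auto intro: chart_is_chart)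
  have s: "smooth_at (\<lambda>t. snd c (\<gamma> t)) 0" and e: "\<forall>\<^sub>F t in nhds 0. \<gamma> t \<in> fst c"
    using c(2) by (auto simp: curve_in_def)
  note g = smooth_map_at[OF A B g c(1) curve_in_0[OF c(2)] d]
  have "\<forall>\<^sub>F t in nhds 0. g (chart_inv c (snd c (\<gamma> t))) \<in> fst d"
    by (rule smooth_at_compose_eventually[OF s g(2)])
  then have "\<forall>\<^sub>F t in nhds 0. g (\<gamma> t) \<in> fst d"
    using e by eventually_elim (use C in \<open>simp add: chart_inv_left\<close>)
  moreover have "smooth_at (\<lambda>t. snd d (g (\<gamma> t))) 0"
  proof (rule smooth_at_cong[OF smooth_at_compose[OF s g(1)]])
    show "\<forall>\<^sub>F t in nhds 0. snd d (g (chart_inv c (snd c (\<gamma> t)))) = snd d (g (\<gamma> t))"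
      using e by eventually_elim (use C in \<open>simp add: chart_inv_left\<close>)
  qed
  ultimately show ?thesis by (simp add: curve_in_def)
qed

lemma curve_in_transition:
  assumes A: "banach_manifold A" and c: "c \<in> charts A" "curve_in c \<gamma>"
    and d: "d \<in> charts A" "\<gamma> 0 \<in> fst d"
  shows "curve_in d \<gamma>"
proof -
  have C: "is_chart c" using c by (auto intro: chart_is_chart)
  have s: "smooth_at (\<lambda>t. snd c (\<gamma> t)) 0" and e: "\<forall>\<^sub>F t in nhds 0. \<gamma> t \<in> fst c"
    using c(2) by (auto simp: curve_in_def)
  note \<tau> = transition[OF A c(1) d(1) curve_in_0[OF c(2)] d(2)]
  have "\<forall>\<^sub>F t in nhds 0. snd c (\<gamma> t) \<in> snd c ` (fst c \<inter> fst d)"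
    by (rule smooth_at_compose_eventually[OF s \<tau>(2)])
  then have "\<forall>\<^sub>F t in nhds 0. \<gamma> t \<in> fst d"
    using e by eventually_elim (use chart_inj[OF C] in auto)
  moreover have "smooth_at (\<lambda>t. snd d (\<gamma> t)) 0"
  proof (rule smooth_at_cong[OF smooth_at_compose[OF s \<tau>(1)]])
    show "\<forall>\<^sub>F t in nhds 0. snd d (chart_inv c (snd c (\<gamma> t))) = snd d (\<gamma> t)"
      using e by eventually_elim (use C in \<open>simp add: chart_inv_left\<close>)
  qed
  ultimately show ?thesis by (simp add: curve_in_def)
qed

lemma smooth_curveI:
  assumes c: "c \<in> charts A" "curve_in c \<gamma>"
  shows "smooth_curve A \<gamma>"
proof -
  have "\<forall>\<^sub>F t in nhds 0. smooth_at (\<lambda>t. snd c (\<gamma> t)) t \<and> \<gamma> t \<in> fst c"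
    using eventually_conj[OF smooth_at_eventually] c(2) unfolding curve_in_def by blast
  then obtain \<epsilon> where "\<epsilon> > 0" and \<epsilon>: "\<And>t. dist t 0 < \<epsilon> \<Longrightarrow> smooth_at (\<lambda>t. snd c (\<gamma> t)) t
    \<and> \<gamma> t \<in> fst c"
    unfolding eventually_nhds_metric by blast
  let ?I = "{-\<epsilon><..<\<epsilon>}"
  have I: "smooth_at (\<lambda>t. snd c (\<gamma> t)) t" "\<gamma> t \<in> fst c" if "t \<in> ?I" for t using \<epsilon>[of t] that
    by (auto simp: dist_real_def)
  have inv: "inv_into ?I id t = t" if "t \<in> ?I" for t using that
    by (metis id_apply inj_on_id inv_into_f_f)
  have sub: "smooth_on ?I (\<lambda>t::real. t)"
    by (rule smooth_on_subset[OF smooth_on_bounded_linear[OF bounded_linear_ident]]) auto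
  have "smooth_on ?I (inv_into ?I id)" by (rule smooth_on_cong[OF sub]) (simp add: inv)
  then have "(?I, id) \<in> charts {(?I, id)}"
    by (simp add: charts_def is_chart_def points_def compatible_def)
  moreover have "smooth_on (id ` ?I) (snd c \<circ> \<gamma> \<circ> inv_into ?I id)"
  proof -
    have "smooth_on ?I (\<lambda>t. snd c (\<gamma> t))" unfolding smooth_on_iff_smooth_at using I(1) by simp
    then have "smooth_on ?I (snd c \<circ> \<gamma> \<circ> inv_into ?I id)" by (rule smooth_on_cong) (simp add: inv)
    then show ?thesis by simp
  qed
  moreover have "\<gamma> ` ?I \<subseteq> fst c" using I(2) by blast
  moreover obtain V \<psi> where "c = (V, \<psi>)" by (cases c)
  ultimately have "smooth_map {(?I, id)} A \<gamma>"
    using c(1) unfolding smooth_map_def points_def by (intro ballI bexI[of _ "(?I, id)"]) auto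
  then show ?thesis unfolding smooth_curve_def using \<open>\<epsilon> > 0\<close> by blast
qed

text \<open>The chart of the interval obtained from \<open>smooth_map\<close> is an arbitrary member
  of the maximal atlas. Its compatibility with \<open>id\<close> makes it a smooth function of the
  parameter, so it can be composed away.\<close>

lemma smooth_curve_chart:
  assumes A: "banach_manifold A" and \<gamma>: "smooth_curve A \<gamma>"
  obtains c where "c \<in> charts A" "curve_in c \<gamma>"
proof -
  obtain \<epsilon> where "\<epsilon> > 0" and g: "smooth_map {({-\<epsilon><..<\<epsilon>}, id)} A \<gamma>" using \<gamma>
    by (auto simp: smooth_curve_def)
  let ?I = "{-\<epsilon><..<\<epsilon>}"
  have "0 \<in> points {(?I, id)}" using \<open>\<epsilon> > 0\<close> by (simp add: points_def)
  then obtain c d where c: "c \<in> charts {(?I, id)}" "0 \<in> fst c" and d: "d \<in> charts A"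
    and sub: "\<gamma> ` fst c \<subseteq> fst d"
    and sm: "smooth_on (snd c ` fst c) (\<lambda>u. snd d (\<gamma> (chart_inv c u)))"
    using g unfolding smooth_map_def o_def by fastforce
  have C: "is_chart c" using c by (auto intro: chart_is_chart)
  have "fst c \<subseteq> ?I" using c by (auto simp: charts_def points_def)
  moreover have "smooth_on (id ` (fst c \<inter> ?I)) (\<lambda>u. snd c (inv_into ?I id u))"
    using c by (auto simp: charts_def compatible_iff)
  ultimately have *: "smooth_on (fst c) (\<lambda>u. snd c (inv_into ?I id u))" by (simp add: Int_absorb2)
  have inv: "inv_into ?I id t = t" if "t \<in> ?I" for t using that
    by (metis id_apply inj_on_id inv_into_f_f)
  have s: "smooth_on (fst c) (snd c)"
    by (rule smooth_on_cong[OF *]) (use \<open>fst c \<subseteq> ?I\<close> inv in auto)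
  have e: "\<forall>\<^sub>F t in nhds 0. t \<in> fst c" using smooth_on_open[OF s] c
    by (auto intro: eventually_nhds_in_open)
  have "smooth_at (\<lambda>t. snd d (\<gamma> (chart_inv c (snd c t)))) 0"
    using smooth_at_compose[OF smooth_atI[OF s c(2)] smooth_atI[OF sm]] c by blast
  then have "smooth_at (\<lambda>t. snd d (\<gamma> t)) 0"
    by (rule smooth_at_cong) (use e C in \<open>auto elim!: eventually_mono simp: chart_inv_left\<close>)
  moreover have "\<forall>\<^sub>F t in nhds 0. \<gamma> t \<in> fst d" using e by eventually_elim (use sub in auto)
  ultimately show thesis using that d by (auto simp: curve_in_def)
qed

lemma smooth_curve_iff:
  assumes "banach_manifold A" "c \<in> charts A" "\<gamma> 0 \<in> fst c"
  shows "smooth_curve A \<gamma> \<longleftrightarrow> curve_in c \<gamma>"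
  using assms smooth_curveI smooth_curve_chart curve_in_transition by metis

lemma smooth_curve_smooth_map:
  assumes A: "banach_manifold A" and B: "banach_manifold B" and g: "smooth_map A B g"
    and \<gamma>: "smooth_curve A \<gamma>"
  shows "smooth_curve B (g \<circ> \<gamma>)"
proof -
  obtain c where c: "c \<in> charts A" "curve_in c \<gamma>" using smooth_curve_chart[OF A \<gamma>] by blast
  have "\<gamma> 0 \<in> points A" by (rule charts_points[OF c(1) curve_in_0[OF c(2)]])
  then have "g (\<gamma> 0) \<in> points B" using g charts_points unfolding smooth_map_def by fastforce
  then obtain d where d: "d \<in> charts B" "g (\<gamma> 0) \<in> fst d" using points_chart[OF B] by blast
  show ?thesis by (rule smooth_curveI[OF d(1) curve_in_smooth_map[OF A B g c d]])
qed

section \<open>Higher derivatives of curves and their behaviour under smooth maps\<close>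

lemma curve_deriv_eq_iter_deriv: "curve_deriv n c t = iter_deriv c (replicate n 1) t"
proof (induction n arbitrary: t)
  case (Suc n)
  \<comment> \<open>Translation invariance holds for arbitrary \<open>f\<close>: both sides choose
    from equivalent predicates. Hence no smoothness is assumed here.\<close>
  have "vector_derivative f (at t) = vector_derivative (\<lambda>s. f (t + s)) (at 0)" for f :: "real \<Rightarrow> 'a"
  proof -
    have "(f has_vector_derivative f') (at t) \<longleftrightarrow> ((\<lambda>s. f (t + s)) has_vector_derivative f') (at 0)"
      for f'
    proof
      assume "(f has_vector_derivative f') (at t)"
      then have "(f \<circ> (\<lambda>s. t + s) has_vector_derivative 1 *\<^sub>R f') (at 0)"
        by (intro vector_diff_chain_at) (auto intro!: derivative_eq_intros)
      then show "((\<lambda>s. f (t + s)) has_vector_derivative f') (at 0)" by (simp add: o_def)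
    next
      assume "((\<lambda>s. f (t + s)) has_vector_derivative f') (at 0)"
      then have "((\<lambda>s. f (t + s)) \<circ> (\<lambda>s. s - t) has_vector_derivative 1 *\<^sub>R f') (at t)"
        by (intro vector_diff_chain_at) (auto intro!: derivative_eq_intros)
      then show "(f has_vector_derivative f') (at t)" by (simp add: o_def)
    qed
    then show ?thesis by (simp add: vector_derivative_def)
  qed
  then show ?case using Suc by (simp add: curve_deriv_def)
qed (simp add: curve_deriv_def)

text \<open>All directions are 1, so only the length of a block matters.\<close>

lemma curve_deriv_compose:
  fixes c :: "real \<Rightarrow> 'e::real_normed_vector" and \<tau> :: "'e \<Rightarrow> 'f::real_normed_vector"
  assumes "smooth_at c t" "smooth_at \<tau> (c t)"
  shows "curve_deriv n (\<lambda>t. \<tau> (c t)) t =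
    (\<Sum>P\<leftarrow>parts n. iter_deriv \<tau> (map (\<lambda>I. curve_deriv (length I) c t) P) (c t))"
proof -
  have "map ((!) (replicate n (1::real))) I = replicate (length I) 1"
    if "P \<in> set (parts n)" "I \<in> set P" for P I
  proof -
    have "i < n" if "i \<in> set I" for i
      using mset_eq_setD[OF mset_concat_parts[OF \<open>P \<in> set (parts n)\<close>]] that \<open>I \<in> set P\<close> by auto
    then have "map ((!) (replicate n (1::real))) I = map (\<lambda>_. 1) I" by (intro map_cong) auto
    then show ?thesis by (simp add: map_replicate_const)
  qed
  then show ?thesis
    using iter_deriv_compose_at[OF assms, of "replicate n 1"]
    by (auto simp: curve_deriv_eq_iter_deriv comp_term_def cong: map_cong intro!: arg_cong[where f
      = sum_list]
        map_cong arg_cong[where f = "\<lambda>vs. iter_deriv \<tau> vs _"])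
qed

lemma curve_deriv_compose_cong:
  assumes "smooth_at c 0" "smooth_at d 0" "smooth_at \<tau> (c 0)"
    and "\<And>i. i \<le> k \<Longrightarrow> curve_deriv i c 0 = curve_deriv i d 0" and "n \<le> k"
  shows "curve_deriv n (\<lambda>t. \<tau> (c t)) 0 = curve_deriv n (\<lambda>t. \<tau> (d t)) 0"
proof -
  have 0: "c 0 = d 0" using assms(4)[of 0] by (simp add: curve_deriv_def)
  have "curve_deriv (length I) c 0 = curve_deriv (length I) d 0" if "P \<in> set (parts n)" "I \<in> set P"
    for P I
    using length_block_parts[OF that] assms(4,5) by simp
  then show ?thesis
    using curve_deriv_compose[OF assms(1,3)] curve_deriv_compose[of d 0 \<tau>] assms(2,3) 0
    by (auto intro!: arg_cong[where f = sum_list] map_cong arg_cong[where f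
      = "\<lambda>vs. iter_deriv \<tau> vs _"])
qed

lemma curve_deriv_cong:
  assumes "\<forall>\<^sub>F t in nhds t0. c t = d t"
  shows "curve_deriv n c t0 = curve_deriv n d t0"
proof -
  obtain S where "open S" "t0 \<in> S" "\<And>t. t \<in> S \<Longrightarrow> c t = d t" using assms unfolding eventually_nhds
    by blast
  then show ?thesis unfolding curve_deriv_eq_iter_deriv by (intro iter_deriv_cong[of S]) auto
qed

lemma curve_deriv_transition:
  assumes A: "banach_manifold A" and c: "c \<in> charts A" "curve_in c \<gamma>" "curve_in c \<delta>" 
    and d: "d \<in> charts A" "\<gamma> 0 \<in> fst d"
    and eq: "\<And>i. i \<le> k \<Longrightarrow> curve_deriv i (snd c \<circ> \<gamma>) 0 = curve_deriv i (snd c \<circ> \<delta>) 0" and "n \<le> k"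
  shows "curve_deriv n (snd d \<circ> \<gamma>) 0 = curve_deriv n (snd d \<circ> \<delta>) 0"
proof -
  have C: "is_chart c" using c by (auto intro: chart_is_chart)
  let ?\<tau> = "\<lambda>u. snd d (chart_inv c u)"
  have *: "curve_deriv n (\<lambda>t. ?\<tau> (snd c (\<gamma> t))) 0 = curve_deriv n (snd d \<circ> \<gamma>) 0" if "curve_in c \<gamma>"
    for \<gamma>
    using that by (intro curve_deriv_cong) (auto simp: curve_in_def chart_inv_left[OF C] elim!:
      eventually_mono)
  have "curve_deriv n (\<lambda>t. ?\<tau> (snd c (\<gamma> t))) 0 = curve_deriv n (\<lambda>t. ?\<tau> (snd c (\<delta> t))) 0"
    by (rule curve_deriv_compose_cong[where k = k])
      (use c eq \<open>n \<le> k\<close> transition[OF A c(1) d(1) curve_in_0[OF c(2)] d(2)] in \<open>auto simp: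
        curve_in_def o_def\<close>)
  then show ?thesis using * c by simp
qed

text \<open>Frees the equivalence from its existential chart. Order 0 is included because equality
  of the base points becomes, by injectivity of the chart, just one more condition.\<close>

lemma jet_equiv_iff:
  assumes A: "banach_manifold A" and d: "d \<in> charts A" "\<gamma> 0 \<in> fst d"
  shows "jet_equiv k A \<gamma> \<delta> \<longleftrightarrow> curve_in d \<gamma> \<and> curve_in d \<delta> \<and>
    (\<forall>i\<le>k. curve_deriv i (snd d \<circ> \<gamma>) 0 = curve_deriv i (snd d \<circ> \<delta>) 0)" (is "?L \<longleftrightarrow> ?R")
proof
  assume L: ?L
  then obtain c where c: "c \<in> charts A" "\<gamma> 0 \<in> fst c"
      "\<And>i. i \<in> {1..k} \<Longrightarrow> curve_deriv i (snd c \<circ> \<gamma>) 0 = curve_deriv i (snd c \<circ> \<delta>) 0"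
    and \<gamma>: "smooth_curve A \<gamma>" "smooth_curve A \<delta>" "\<gamma> 0 = \<delta> 0"
    unfolding jet_equiv_def by fastforce
  have eq: "curve_deriv i (snd c \<circ> \<gamma>) 0 = curve_deriv i (snd c \<circ> \<delta>) 0" if "i \<le> k" for i
    using c(3)[of i] that \<gamma>(3) by (cases "i = 0") (auto simp: curve_deriv_def)
  have "curve_in c \<gamma>" "curve_in c \<delta>" "curve_in d \<gamma>" "curve_in d \<delta>"
    using \<gamma> c(1,2) d smooth_curve_iff[where \<gamma> = \<gamma>, OF A] smooth_curve_iff[where \<gamma> = \<delta>, OF A]
      by simp_all
  then show ?R
    using curve_deriv_transition[where \<gamma> = \<gamma> and \<delta> = \<delta> and k = k, OF A c(1) _ _ d eq] by blast
next
  assume R: ?R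
  then have "snd d (\<gamma> 0) = snd d (\<delta> 0)" by (auto simp: curve_deriv_def dest: spec[of _ 0])
  then have "\<gamma> 0 = \<delta> 0" using R chart_inj[OF chart_is_chart[OF d(1)]] curve_in_0 by blast
  then show ?L using R d smooth_curveI[OF d(1)] unfolding jet_equiv_def
    by (auto intro!: bexI[of _ d] split: prod.splits)
qed

lemma jet_equiv_0: "jet_equiv k A \<gamma> \<delta> \<Longrightarrow> \<gamma> 0 = \<delta> 0"
  by (simp add: jet_equiv_def)

lemma jet_equiv_refl:
  assumes A: "banach_manifold A" and \<gamma>: "smooth_curve A \<gamma>"
  shows "jet_equiv k A \<gamma> \<gamma>"
proof -
  obtain c where c: "c \<in> charts A" "curve_in c \<gamma>" using smooth_curve_chart[OF A \<gamma>] by blast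
  then show ?thesis using jet_equiv_iff[where \<gamma> = \<gamma>, OF A c(1) curve_in_0[OF c(2)]] by simp
qed

lemma jet_eq:
  assumes A: "banach_manifold A" and eq: "jet_equiv k A \<gamma> \<delta>"
  shows "jet k A \<gamma> = jet k A \<delta>"
proof -
  obtain c where c: "c \<in> charts A" "\<gamma> 0 \<in> fst c" "\<delta> 0 \<in> fst c"
    using eq unfolding jet_equiv_def by fastforce
  show ?thesis
    using eq unfolding jet_def jet_equiv_iff[where \<gamma> = \<gamma>, OF A c(1,2)] jet_equiv_iff[where \<gamma>
      = \<delta>, OF A c(1,3)] by auto
qed

lemma jet_rep_equiv:
  assumes A: "banach_manifold A" and \<gamma>: "smooth_curve A \<gamma>"
  shows "jet_equiv k A \<gamma> (jet_rep (jet k A \<gamma>))"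
  using someI[of "\<lambda>\<delta>. \<delta> \<in> jet k A \<gamma>" \<gamma>] jet_equiv_refl[OF assms] by (simp add: jet_rep_def jet_def)

lemma jet_proj_jet:
  assumes A: "banach_manifold A" and \<gamma>: "smooth_curve A \<gamma>"
  shows "jet_proj (jet k A \<gamma>) = \<gamma> 0"
  using jet_equiv_0[OF jet_rep_equiv[OF assms]] by (simp add: jet_proj_def)

text \<open>Makes the choice in \<open>jet_rep\<close> harmless: up to order \<open>k\<close>, the
  representative has the chart derivatives of the original curve.\<close>

lemma curve_in_jet_rep:
  assumes A: "banach_manifold A" and c: "c \<in> charts A" "curve_in c \<gamma>"
  shows "curve_in c (jet_rep (jet k A \<gamma>))"
    and "i \<le> k \<Longrightarrow> curve_deriv i (snd c \<circ> jet_rep (jet k A \<gamma>)) 0 = curve_deriv i (snd c \<circ> \<gamma>) 0"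
  using jet_rep_equiv[OF A smooth_curveI[OF c], of k] jet_equiv_iff[where \<gamma>
    = \<gamma>, OF A c(1) curve_in_0[OF c(2)]] by auto

lemma tangent_bundle_jet: "smooth_curve A \<gamma> \<Longrightarrow> jet k A \<gamma> \<in> tangent_bundle k A"
  by (auto simp: tangent_bundle_def)

lemma tangent_bundle_rep:
  assumes A: "banach_manifold A" and w: "w \<in> tangent_bundle k A"
  shows "smooth_curve A (jet_rep w)" and "jet k A (jet_rep w) = w"
proof -
  obtain \<gamma> where \<gamma>: "smooth_curve A \<gamma>" "w = jet k A \<gamma>" using w by (auto simp: tangent_bundle_def)
  note * = jet_rep_equiv[OF A \<gamma>(1), of k]
  show "smooth_curve A (jet_rep w)" using * \<gamma>(2) by (simp add: jet_equiv_def)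
  show "jet k A (jet_rep w) = w" using jet_eq[OF A *] \<gamma>(2) by simp
qed

section \<open>The tangent bundle as a manifold\<close>

lemma curve_deriv_1: "curve_deriv 1 c t = vector_derivative c (at t)"
  by (simp add: curve_deriv_def)

lemma curve_deriv_1I: "(c has_vector_derivative v) (at t) \<Longrightarrow> curve_deriv 1 c t = v"
  unfolding curve_deriv_1 by (rule vector_derivative_at)

lemma smooth_at_vector_derivative:
  assumes "smooth_at c t"
  shows "(c has_vector_derivative curve_deriv 1 c t) (at t)"
  unfolding curve_deriv_1 using smooth_at_has_derivative[OF assms]
  by (intro vector_derivative_works[THEN iffD1] differentiableI)

lemma smooth_at_compose_vector_derivative:
  assumes f: "smooth_at f (c t)" and c: "(c has_vector_derivative v) (at t)"
  shows "((\<lambda>t. f (c t)) has_vector_derivative fderiv f (c t) v) (at t)"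
proof -
  have "((\<lambda>t. f (c t)) has_derivative (\<lambda>h. fderiv f (c t) (h *\<^sub>R v))) (at t)"
    using has_derivative_compose[where f = c and g
      = f, OF c[unfolded has_vector_derivative_def] smooth_at_has_derivative[OF f]] .
  then show ?thesis by (simp add: has_vector_derivative_def blinfun.scaleR_right)
qed

lemma curve_in_chart_inv:
  assumes c: "is_chart c" and q: "smooth_at q 0" "q 0 \<in> snd c ` fst c"
  shows "curve_in c (\<lambda>t. chart_inv c (q t))"
    and "\<forall>\<^sub>F t in nhds 0. snd c (chart_inv c (q t)) = q t"
proof -
  obtain x where x: "x \<in> fst c" "q 0 = snd c x" using q by blast
  have "\<forall>\<^sub>F u in nhds (q 0). chart_inv c u \<in> fst c \<and> snd c (chart_inv c u) = u"
    unfolding x(2) by (rule eventually_chart_inv[OF c x(1)])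
  then have e: "\<forall>\<^sub>F t in nhds 0. chart_inv c (q t) \<in> fst c \<and> snd c (chart_inv c (q t)) = q t"
    by (rule smooth_at_compose_eventually[OF q(1)])
  then show "\<forall>\<^sub>F t in nhds 0. snd c (chart_inv c (q t)) = q t" by eventually_elim simp
  have "smooth_at (\<lambda>t. snd c (chart_inv c (q t))) 0"
    by (rule smooth_at_cong[OF q(1)]) (use e in eventually_elim, simp)
  then show "curve_in c (\<lambda>t. chart_inv c (q t))" using e
    by (auto simp: curve_in_def elim: eventually_mono)
qed

lemma tangent_chart_jet:
  assumes A: "banach_manifold A" and c: "c \<in> charts A" "curve_in c \<gamma>"
  shows "tangent_chart (snd c) (jet 1 A \<gamma>) = (snd c (\<gamma> 0), curve_deriv 1 (snd c \<circ> \<gamma>) 0)"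
  using jet_proj_jet[OF A smooth_curveI[OF c]] curve_in_jet_rep(2)[OF A c, of 1 1]
  by (simp add: tangent_chart_def)

definition tangent_bundle_chart ::
    "('m, 'e::banach) chart set \<Rightarrow> ('m, 'e) chart \<Rightarrow> ('m jet, 'e \<times> 'e) chart" where
  "tangent_bundle_chart A c = ({w \<in> tangent_bundle 1 A. jet_proj w \<in> fst c}, tangent_chart (snd c))"

lemma tangent_atlas_eq: "tangent_atlas A = tangent_bundle_chart A ` charts A"
  unfolding tangent_atlas_def tangent_bundle_chart_def by force

text \<open>The inverse of the tangent chart induced by \<open>c\<close>: the class of a straight
  line in the chart (see \<open>tangent_bundle_chart_inv\<close>).\<close>

definition tangent_vector ::
    "('m, 'e::banach) chart set \<Rightarrow> ('m, 'e) chart \<Rightarrow> 'e \<times> 'e \<Rightarrow> 'm jet" where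
  "tangent_vector A c p = jet 1 A (\<lambda>t. chart_inv c (fst p + t *\<^sub>R snd p))"

lemma smooth_at_line: "smooth_at (\<lambda>t. u + t *\<^sub>R v) t"
  by (intro smooth_at_add smooth_at_const smooth_at_scaleR smooth_at_ident)

lemma
  assumes A: "banach_manifold A" and c: "c \<in> charts A" "u \<in> snd c ` fst c"
  shows tangent_vector_in: "tangent_vector A c (u, \<xi>) \<in> tangent_bundle 1 A"
    and tangent_vector_proj: "jet_proj (tangent_vector A c (u, \<xi>)) = chart_inv c u"
    and tangent_chart_tangent_vector: "d \<in> charts A \<Longrightarrow> chart_inv c u \<in> fst d \<Longrightarrow>
      tangent_chart (snd d) (tangent_vector A c (u, \<xi>)) =
        (snd d (chart_inv c u), fderiv (\<lambda>u. snd d (chart_inv c u)) u \<xi>)"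
proof -
  have C: "is_chart c" by (rule chart_is_chart[OF c(1)])
  let ?q = "\<lambda>t. u + t *\<^sub>R \<xi>"
  have q: "smooth_at ?q 0" "?q 0 \<in> snd c ` fst c" using c smooth_at_line by auto
  note in_c = curve_in_chart_inv[OF C q]
  note sc = smooth_curveI[OF c(1) in_c(1)]
  show "tangent_vector A c (u, \<xi>) \<in> tangent_bundle 1 A"
    using tangent_bundle_jet[OF sc] by (simp add: tangent_vector_def)
  show "jet_proj (tangent_vector A c (u, \<xi>)) = chart_inv c u"
    using jet_proj_jet[OF A sc, of 1] by (simp add: tangent_vector_def)
  assume d: "d \<in> charts A" "chart_inv c u \<in> fst d"
  have in_d: "curve_in d (\<lambda>t. chart_inv c (?q t))"
    by (rule curve_in_transition[OF A c(1) in_c(1) d(1)]) (use d in simp)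
  obtain x where x: "x \<in> fst c" "u = snd c x" using c by blast
  have \<tau>: "smooth_at (\<lambda>u. snd d (chart_inv c u)) u"
    using transition(1)[OF A c(1) d(1) x(1)] d x C by (simp add: chart_inv_left)
  have "(?q has_vector_derivative \<xi>) (at 0)"
    using has_vector_derivative_line_linear[OF bounded_linear_ident] .
  then have "((\<lambda>t. snd d (chart_inv c (?q t))) has_vector_derivative fderiv (\<lambda>u. snd d (chart_inv c
    u)) u \<xi>) (at 0)"
    using smooth_at_compose_vector_derivative[of "\<lambda>u. snd d (chart_inv c u)" ?q 0 \<xi>] \<tau> by simp
  then show "tangent_chart (snd d) (tangent_vector A c (u, \<xi>)) =
      (snd d (chart_inv c u), fderiv (\<lambda>u. snd d (chart_inv c u)) u \<xi>)"
    using tangent_chart_jet[OF A d(1) in_d] curve_deriv_1I by (simp add: tangent_vector_def o_def)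
qed

lemma fderiv_cong:
  assumes "\<forall>\<^sub>F y in nhds x. f y = g y"
  shows "fderiv f x = fderiv g x"
proof -
  obtain S where "open S" "x \<in> S" "\<And>y. y \<in> S \<Longrightarrow> f y = g y" using assms unfolding eventually_nhds
    by blast
  then have "iter_deriv f [h] x = iter_deriv g [h] x" for h by (intro iter_deriv_cong[of S])
  then show ?thesis by (simp add: fderiv_def del: iter_deriv.simps)
qed

lemma fderiv_ident: "blinfun_apply (fderiv (\<lambda>x. x) x) v = v"
  by (rule fun_cong[OF fderiv_unique[OF smooth_at_ident has_derivative_ident]])

lemma tangent_chart_tangent_vector_self:
  assumes A: "banach_manifold A" and c: "c \<in> charts A" "u \<in> snd c ` fst c"
  shows "tangent_chart (snd c) (tangent_vector A c (u, \<xi>)) = (u, \<xi>)"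
proof -
  have C: "is_chart c" by (rule chart_is_chart[OF c(1)])
  obtain x where x: "x \<in> fst c" "u = snd c x" using c by blast
  have "\<forall>\<^sub>F v in nhds u. snd c (chart_inv c v) = v"
    using eventually_chart_inv[OF C x(1)] x(2) by (auto elim: eventually_mono)
  then have "fderiv (\<lambda>u. snd c (chart_inv c u)) u = fderiv (\<lambda>u. u) u" by (rule fderiv_cong)
  then show ?thesis
    using tangent_chart_tangent_vector[OF A c c(1)] x C by (simp add: chart_inv_left fderiv_ident)
qed

lemma tangent_chart_inj:
  assumes A: "banach_manifold A" and c: "c \<in> charts A"
    and w: "w \<in> tangent_bundle 1 A" "jet_proj w \<in> fst c" "w' \<in> tangent_bundle 1 A" "jet_proj w' \<in>
      fst c"
    and eq: "tangent_chart (snd c) w = tangent_chart (snd c) w'"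
  shows "w = w'"
proof -
  have 0: "jet_rep w 0 \<in> fst c" "jet_rep w' 0 \<in> fst c" using w by (simp_all add: jet_proj_def)
  have "curve_in c (jet_rep w)" "curve_in c (jet_rep w')"
    using smooth_curve_iff[where \<gamma> = "jet_rep w", OF A c 0(1)] smooth_curve_iff[where \<gamma>
      = "jet_rep w'", OF A c 0(2)]
      tangent_bundle_rep(1)[OF A] w by auto
  moreover have "curve_deriv i (snd c \<circ> jet_rep w) 0 = curve_deriv i (snd c \<circ> jet_rep w') 0" if "i
    \<le> 1" for i
    using that eq by (cases "i = 0") (auto simp: tangent_chart_def jet_proj_def curve_deriv_def
      le_Suc_eq)
  ultimately have "jet_equiv 1 A (jet_rep w) (jet_rep w')"
    using jet_equiv_iff[where \<gamma> = "jet_rep w", OF A c 0(1)] by blast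
  then show ?thesis using jet_eq[OF A] tangent_bundle_rep(2)[OF A] w by metis
qed

lemma
  fixes A :: "('m, 'e::banach) chart set"
  assumes A: "banach_manifold A" and c: "c \<in> charts A"
  shows tangent_bundle_chart_image: "d \<in> charts A \<Longrightarrow> snd (tangent_bundle_chart A c) `
      (fst (tangent_bundle_chart A c) \<inter> fst (tangent_bundle_chart A d))
        = snd c ` (fst c \<inter> fst d) \<times> UNIV"
    and tangent_bundle_chart_inv: "u \<in> snd c ` fst c \<Longrightarrow>
      chart_inv (tangent_bundle_chart A c) (u, \<xi>) = tangent_vector A c (u, \<xi>)"
    and is_chart_tangent_bundle_chart: "is_chart (tangent_bundle_chart A c)"
proof -
  have C: "is_chart c" by (rule chart_is_chart[OF c])
  have inj: "inj_on (snd (tangent_bundle_chart A c)) (fst (tangent_bundle_chart A c))"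
    using tangent_chart_inj[OF A c] by (auto simp: tangent_bundle_chart_def inj_on_def)
  have vec: "tangent_vector A c (u, \<xi>) \<in> fst (tangent_bundle_chart A c)"
      "snd (tangent_bundle_chart A c) (tangent_vector A c (u, \<xi>)) = (u, \<xi>)" if "u \<in> snd c ` fst c"
        for u \<xi>
    using that tangent_vector_in[OF A c that] tangent_vector_proj[OF A c that]
      tangent_chart_tangent_vector_self[OF A c that] C
    by (auto simp: tangent_bundle_chart_def chart_inv_left)
  show "chart_inv (tangent_bundle_chart A c) (u, \<xi>) = tangent_vector A c (u, \<xi>)"
    if "u \<in> snd c ` fst c" for u \<xi>
    using inv_into_f_eq[OF inj vec[OF that]] .
  show im: "snd (tangent_bundle_chart A c) ` (fst (tangent_bundle_chart A c) \<inter> fst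
    (tangent_bundle_chart A d))
      = snd c ` (fst c \<inter> fst d) \<times> UNIV" if "d \<in> charts A" for d
  proof (intro equalityI subsetI)
    fix p :: "'e \<times> 'e" assume "p \<in> snd (tangent_bundle_chart A c) ` (fst (tangent_bundle_chart A c)
      \<inter> fst (tangent_bundle_chart A d))"
    then show "p \<in> snd c ` (fst c \<inter> fst d) \<times> UNIV"
      by (auto simp: tangent_bundle_chart_def tangent_chart_def)
  next
    fix p :: "'e \<times> 'e" assume p: "p \<in> snd c ` (fst c \<inter> fst d) \<times> UNIV"
    then obtain x \<xi> where x: "x \<in> fst c" "x \<in> fst d" "p = (snd c x, \<xi>)" by auto
    let ?w = "tangent_vector A c (snd c x, \<xi>)"
    have "?w \<in> fst (tangent_bundle_chart A d)"
      using x tangent_vector_in[OF A c, of "snd c x"] tangent_vector_proj[OF A c, of "snd c x"] C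
      by (auto simp: tangent_bundle_chart_def chart_inv_left)
    then show "p \<in> snd (tangent_bundle_chart A c) ` (fst (tangent_bundle_chart A c) \<inter> fst
      (tangent_bundle_chart A d))"
      using vec[of "snd c x" \<xi>] x by (intro image_eqI[of _ _ ?w]) auto
  qed
  have "snd (tangent_bundle_chart A c) ` fst (tangent_bundle_chart A c) = snd c ` fst c \<times> UNIV"
    using im[OF c] by simp
  then have "open (snd (tangent_bundle_chart A c) ` fst (tangent_bundle_chart A c))"
    using chart_open[OF C] by (simp add: open_Times)
  then show "is_chart (tangent_bundle_chart A c)"
    using inj by (cases "tangent_bundle_chart A c") (simp add: is_chart_def)
qed

text \<open>With the transition map \<open>\<tau>\<close> of the base, the transition maps send
  \<open>(u, \<xi>)\<close> to \<open>(\<tau> u, fderiv \<tau> u \<xi>)\<close>; they are smooth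
  because \<open>fderiv\<close> preserves smoothness.\<close>

lemma banach_manifold_tangent:
  fixes A :: "('m, 'e::banach) chart set"
  assumes A: "banach_manifold A"
  shows "banach_manifold (tangent_atlas A)"
proof -
  have *: "smooth_on (snd (tangent_bundle_chart A c) `
      (fst (tangent_bundle_chart A c) \<inter> fst (tangent_bundle_chart A d)))
      (\<lambda>p. snd (tangent_bundle_chart A d) (chart_inv (tangent_bundle_chart A c) p))"
    if c: "c \<in> charts A" and d: "d \<in> charts A" for c d
    unfolding tangent_bundle_chart_image[OF A c d]
  proof (rule smooth_on_cong)
    let ?\<tau> = "\<lambda>u. snd d (chart_inv c u)"
    have C: "is_chart c" by (rule chart_is_chart[OF c])
    have \<tau>: "smooth_on (snd c ` (fst c \<inter> fst d)) ?\<tau>" by (rule smooth_on_transition[OF A c d])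
    show "smooth_on (snd c ` (fst c \<inter> fst d) \<times> UNIV) (\<lambda>p. (?\<tau> (fst p), fderiv ?\<tau> (fst p) (snd p)))"
      unfolding smooth_on_iff_smooth_at
    proof (intro conjI ballI)
      show "open (snd c ` (fst c \<inter> fst d) \<times> (UNIV :: 'e set))"
        by (intro open_Times smooth_on_open[OF \<tau>]) simp
      fix p :: "'e \<times> 'e" assume "p \<in> snd c ` (fst c \<inter> fst d) \<times> UNIV"
      then have "smooth_at ?\<tau> (fst p)" by (intro smooth_atI[OF \<tau>]) auto
      moreover have "smooth_at fst p" "smooth_at snd p"
        by (auto intro: smooth_at_bounded_linear bounded_linear_fst bounded_linear_snd)
      ultimately show "smooth_at (\<lambda>p. (?\<tau> (fst p), fderiv ?\<tau> (fst p) (snd p))) p"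
        by (intro smooth_at_Pair smooth_at_compose[where f = fst and g = ?\<tau>] smooth_at_fderiv_apply)
    qed
    fix p :: "'e \<times> 'e" assume "p \<in> snd c ` (fst c \<inter> fst d) \<times> UNIV"
    then obtain x \<xi> where x: "x \<in> fst c" "x \<in> fst d" "p = (snd c x, \<xi>)" by auto
    then show "(?\<tau> (fst p), blinfun_apply (fderiv ?\<tau> (fst p)) (snd p)) =
        snd (tangent_bundle_chart A d) (chart_inv (tangent_bundle_chart A c) p)"
      using tangent_bundle_chart_inv[OF A c, of "snd c x"] tangent_chart_tangent_vector[OF A c _ d,
        of "snd c x"] C
      by (simp add: chart_inv_left) (simp add: tangent_bundle_chart_def)
  qed
  have "compatible (tangent_bundle_chart A c) (tangent_bundle_chart A d)"
    if "c \<in> charts A" "d \<in> charts A" for c d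
    unfolding compatible_iff using *[OF that] *[OF that(2,1)] by (simp add: Int_commute)
  then show ?thesis
    unfolding banach_manifold_def tangent_atlas_eq using is_chart_tangent_bundle_chart[OF A]
      by blast
qed

lemma tangent_bundle_chart_in_charts:
  "banach_manifold A \<Longrightarrow> c \<in> charts A \<Longrightarrow> tangent_bundle_chart A c \<in> charts (tangent_atlas A)"
  using atlas_subset_charts[OF banach_manifold_tangent] by (auto simp: tangent_atlas_eq)


section \<open>Related connections in charts\<close>

lemma
  assumes A: "banach_manifold A" and B: "banach_manifold B" and g: "smooth_map A B g"
    and w: "w \<in> tangent_bundle k A"
  shows tangent_map_in: "tangent_map k B g w \<in> tangent_bundle k B"
    and tangent_map_proj: "jet_proj (tangent_map k B g w) = g (jet_proj w)"
proof -
  have s: "smooth_curve B (g \<circ> jet_rep w)"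
    by (rule smooth_curve_smooth_map[OF A B g tangent_bundle_rep(1)[OF A w]])
  show "tangent_map k B g w \<in> tangent_bundle k B"
    unfolding tangent_map_def by (rule tangent_bundle_jet[OF s])
  show "jet_proj (tangent_map k B g w) = g (jet_proj w)"
    unfolding tangent_map_def jet_proj_jet[OF B s] by (simp add: jet_proj_def)
qed

lemma tangent_map_chart:
  assumes A: "banach_manifold A" and B: "banach_manifold B" and g: "smooth_map A B g"
    and c: "c \<in> charts A" and d: "d \<in> charts B"
    and w: "w \<in> tangent_bundle 1 A" "jet_proj w \<in> fst c" "g (jet_proj w) \<in> fst d"
    and p: "tangent_chart (snd c) w = (u, \<xi>)"
  defines "G \<equiv> \<lambda>u. snd d (g (chart_inv c u))"
  shows "tangent_chart (snd d) (tangent_map 1 B g w) = (G u, fderiv G u \<xi>)"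
proof -
  have C: "is_chart c" by (rule chart_is_chart[OF c])
  let ?\<gamma> = "jet_rep w"
  have \<gamma>0: "?\<gamma> 0 \<in> fst c" "g (?\<gamma> 0) \<in> fst d" using w by (simp_all add: jet_proj_def)
  have u: "u = snd c (?\<gamma> 0)" "\<xi> = curve_deriv 1 (\<lambda>t. snd c (?\<gamma> t)) 0"
    using p by (auto simp: tangent_chart_def jet_proj_def o_def)
  have in_c: "curve_in c ?\<gamma>"
    using tangent_bundle_rep(1)[OF A w(1)] smooth_curve_iff[where \<gamma> = ?\<gamma>, OF A c \<gamma>0(1)] by simp
  have in_d: "curve_in d (g \<circ> ?\<gamma>)" by (rule curve_in_smooth_map[OF A B g c in_c d \<gamma>0(2)])
  have G: "smooth_at G u" unfolding G_def u(1) by (rule smooth_map_at(1)[OF A B g c \<gamma>0(1) d \<gamma>0(2)])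
  have s: "smooth_at (\<lambda>t. snd c (?\<gamma> t)) 0" and e: "\<forall>\<^sub>F t in nhds 0. ?\<gamma> t \<in> fst c"
    using in_c by (auto simp: curve_in_def)
  have "curve_deriv 1 (snd d \<circ> (g \<circ> ?\<gamma>)) 0 = curve_deriv 1 (\<lambda>t. G (snd c (?\<gamma> t))) 0"
    by (rule curve_deriv_cong) (use e in eventually_elim, simp add: G_def chart_inv_left[OF C])
  also have "\<dots> = fderiv G u \<xi>"
    using smooth_at_compose_vector_derivative[of G "\<lambda>t. snd c (?\<gamma> t)", OF _
      smooth_at_vector_derivative[OF s]] G
    by (intro curve_deriv_1I) (simp add: u)
  finally show ?thesis
    unfolding tangent_map_def tangent_chart_jet[OF B d in_d]
    by (simp add: u(1) G_def chart_inv_left[OF C \<gamma>0(1)])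
qed

lemma linear_connectionD:
  assumes K: "linear_connection A \<Gamma> K" and w: "w \<in> tangent_bundle 1 (tangent_atlas A)"
    and c: "c \<in> charts A" "jet_proj (jet_proj w) \<in> fst c"
    and "tangent_chart (tangent_chart (snd c)) w = ((x, \<xi>), (y, \<eta>))"
  shows "K w \<in> tangent_bundle 1 A" and "jet_proj (K w) \<in> fst c"
    and "tangent_chart (snd c) (K w) = (x, \<eta> + \<Gamma> c x \<xi> y)"
proof -
  obtain U \<phi> where c_eq: "c = (U, \<phi>)" by (cases c)
  have *: "K w \<in> tangent_bundle 1 A \<and> (\<forall>(U, \<phi>)\<in>charts A. jet_proj (jet_proj w) \<in> U \<longrightarrow>
           jet_proj (K w) \<in> U \<and>
           (let ((x, \<xi>), (y, \<eta>)) = tangent_chart (tangent_chart \<phi>) w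
            in tangent_chart \<phi> (K w) = (x, \<eta> + \<Gamma> (U, \<phi>) x \<xi> y)))"
    using K w unfolding linear_connection_def by blast
  then show "K w \<in> tangent_bundle 1 A" by simp
  show "jet_proj (K w) \<in> fst c" "tangent_chart (snd c) (K w) = (x, \<eta> + \<Gamma> c x \<xi> y)"
    using bspec[OF conjunct2[OF *] c(1)] assms(4,5) by (simp_all add: c_eq)
qed

text \<open>The global relation is tested on the class of the curve \<open>(u + t y, \<xi>)\<close>
  of tangent vectors. It has coordinates \<open>((u, \<xi>), (y, 0))\<close>, so that the connection
  map returns the pure Christoffel term, and its image under the second tangent map has the second
  derivative of \<open>G\<close> in the last component.\<close>

lemma connections_related_local:
  assumes A: "banach_manifold A" and B: "banach_manifold B" and g: "smooth_map A B g"
    and KA: "linear_connection A \<Gamma>A KA" and KB: "linear_connection B \<Gamma>B KB"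
    and rel: "connections_related A B g KA KB"
    and c: "c \<in> charts A" "x \<in> fst c" and d: "d \<in> charts B" "g x \<in> fst d"
  defines "G \<equiv> \<lambda>u. snd d (g (chart_inv c u))" and "u \<equiv> snd c x"
  shows "fderiv G u (\<Gamma>A c u \<xi> y) = fderiv (fderiv G) u \<xi> y
    + \<Gamma>B d (G u) (fderiv G u \<xi>) (fderiv G u y)"
proof -
  have C: "is_chart c" by (rule chart_is_chart[OF c(1)])
  have D: "is_chart d" by (rule chart_is_chart[OF d(1)])
  note TA = banach_manifold_tangent[OF A] and TB = banach_manifold_tangent[OF B]
  let ?c = "tangent_bundle_chart A c" and ?d = "tangent_bundle_chart B d"
  note Tc = tangent_bundle_chart_in_charts[OF A c(1)] and Td
    = tangent_bundle_chart_in_charts[OF B d(1)]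
  let ?q = "\<lambda>t. (u + t *\<^sub>R y, \<xi>)" and ?\<Lambda> = "\<lambda>t. chart_inv ?c (u + t *\<^sub>R y, \<xi>)"
  have q: "smooth_at ?q 0" by (intro smooth_at_Pair smooth_at_line smooth_at_const)
  have q0: "?q 0 \<in> snd ?c ` fst ?c"
    using tangent_bundle_chart_image[OF A c(1) c(1)] c(2) by (auto simp: u_def)
  note in_c = curve_in_chart_inv[OF chart_is_chart[OF Tc] q q0]
  define w where "w = jet 1 (tangent_atlas A) ?\<Lambda>"
  have w: "w \<in> tangent_bundle 1 (tangent_atlas A)"
    unfolding w_def by (rule tangent_bundle_jet[OF smooth_curveI[OF Tc in_c(1)]])
  \<comment> \<open>\<open>tangent_map\<close> follows the chosen representative of \<open>w\<close>
    rather than \<open>?\<Lambda>\<close>; only the value and the first derivative at 0 carry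
    over.\<close>
  define R where "R = jet_rep w"
  have R: "curve_in ?c R" unfolding R_def w_def by (rule curve_in_jet_rep(1)[OF TA Tc in_c(1)])
  define r where "r t = snd ?c (R t)" for t
  have ev: "snd ?c (?\<Lambda> t) = ?q t" if "t = 0" for t using eventually_nhds_x_imp_x[OF in_c(2)] that
    by simp
  have w_chart: "tangent_chart (snd ?c) w = ((u, \<xi>), (y, 0))"
  proof -
    have "curve_deriv 1 (snd ?c \<circ> ?\<Lambda>) 0 = curve_deriv 1 ?q 0"
      by (rule curve_deriv_cong) (use in_c(2) in \<open>simp add: o_def\<close>)
    also have "\<dots> = (y, 0)" 
      by (intro curve_deriv_1I has_vector_derivative_Pair) (auto intro!: derivative_eq_intros)
    finally show ?thesis unfolding w_def tangent_chart_jet[OF TA Tc in_c(1)] using ev by simp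
  qed
  have r0: "r 0 = (u, \<xi>)" using w_chart by (simp add: tangent_chart_def r_def R_def jet_proj_def)
  have r1: "(r has_vector_derivative (y, 0)) (at 0)"
  proof -
    have "smooth_at r 0" using R by (simp add: curve_in_def r_def[abs_def])
    moreover have "curve_deriv 1 r 0 = (y, 0)"
      using w_chart by (simp add: tangent_chart_def r_def[abs_def] R_def o_def)
    ultimately show ?thesis using smooth_at_vector_derivative by metis
  qed
  have r: "smooth_at r 0" using R by (simp add: curve_in_def r_def[abs_def])
  have R0: "R 0 \<in> tangent_bundle 1 A" "jet_proj (R 0) \<in> fst c"
    using curve_in_0[OF R] by (auto simp: tangent_bundle_chart_def)
  have "snd c (jet_proj (R 0)) = snd c x"
    using r0 by (simp add: r_def tangent_bundle_chart_def tangent_chart_def u_def)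
  then have R0x: "jet_proj (R 0) = x" using chart_inj[OF C R0(2) c(2)] by simp
  have proj_w: "jet_proj (jet_proj w) = x" using R0x by (simp add: R_def jet_proj_def)
  have G: "smooth_at G u" unfolding G_def u_def by (rule smooth_map_at(1)[OF A B g c d])
  have eG: "\<forall>\<^sub>F u in nhds u. g (chart_inv c u) \<in> fst d" unfolding u_def
    by (rule smooth_map_at(2)[OF A B g c d])
  define \<Delta> where "\<Delta> = tangent_map 1 B g \<circ> R"
  let ?s = "\<lambda>t. (G (fst (r t)), fderiv G (fst (r t)) (snd (r t)))"
  have fst_r: "smooth_at (\<lambda>t. fst (r t)) 0" "smooth_at (\<lambda>t. snd (r t)) 0"
    by (intro smooth_at_fst smooth_at_snd r)+
  have "\<forall>\<^sub>F u in nhds (fst (r 0)). g (chart_inv c u) \<in> fst d" using eG r0 by simp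
  then have "\<forall>\<^sub>F t in nhds 0. g (chart_inv c (fst (r t))) \<in> fst d"
    by (rule smooth_at_compose_eventually[OF fst_r(1)])
  moreover have "\<forall>\<^sub>F t in nhds 0. R t \<in> fst ?c" using R by (simp add: curve_in_def)
  ultimately have e: "\<forall>\<^sub>F t in nhds 0. \<Delta> t \<in> fst ?d \<and> snd ?d (\<Delta> t) = ?s t"
  proof eventually_elim
    case (elim t)
    have Rt: "R t \<in> tangent_bundle 1 A" "jet_proj (R t) \<in> fst c"
      using elim by (auto simp: tangent_bundle_chart_def)
    have "fst (r t) = snd c (jet_proj (R t))" by (simp add: r_def tangent_bundle_chart_def
      tangent_chart_def)
    then have gd: "g (jet_proj (R t)) \<in> fst d" using elim Rt C by (simp add: chart_inv_left)
    have "tangent_chart (snd c) (R t) = (fst (r t), snd (r t))"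
      by (simp add: r_def tangent_bundle_chart_def)
    from tangent_map_chart[OF A B g c(1) d(1) Rt gd this]
    show ?case using tangent_map_in[OF A B g Rt(1)] tangent_map_proj[OF A B g Rt(1)] gd
      by (simp add: \<Delta>_def tangent_bundle_chart_def G_def)
  qed
  have s: "smooth_at ?s 0"
    using G r0 fst_r
    by (intro smooth_at_Pair smooth_at_compose[where f = "\<lambda>t. fst (r t)" and g
      = G] smooth_at_fderiv_apply) simp_all
  have in_d: "curve_in ?d \<Delta>"
    unfolding curve_in_def
  proof
    show "smooth_at (\<lambda>t. snd ?d (\<Delta> t)) 0"
      by (rule smooth_at_cong[OF s]) (use e in eventually_elim, simp)
    show "\<forall>\<^sub>F t in nhds 0. \<Delta> t \<in> fst ?d" using e by eventually_elim simp
  qed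
  \<comment> \<open>The fibre component of \<open>r\<close> has derivative 0, so the product rule
    leaves only the variation of the base point.\<close>
  have s1: "(?s has_vector_derivative (fderiv G u y, fderiv (fderiv G) u y \<xi>)) (at 0)"
  proof (rule has_vector_derivative_Pair)
    have f: "((\<lambda>t. fst (r t)) has_vector_derivative y) (at 0)"
      using bounded_linear.has_vector_derivative[OF bounded_linear_fst r1] by simp
    have s: "((\<lambda>t. snd (r t)) has_vector_derivative 0) (at 0)"
      using bounded_linear.has_vector_derivative[OF bounded_linear_snd r1] by simp
    show "((\<lambda>t. G (fst (r t))) has_vector_derivative fderiv G u y) (at 0)"
      using smooth_at_compose_vector_derivative[of G "\<lambda>t. fst (r t)", OF _ f] G r0 by simp
    have "((\<lambda>t. fderiv G (fst (r t))) has_vector_derivative fderiv (fderiv G) u y) (at 0)"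
      using smooth_at_compose_vector_derivative[of "fderiv G" "\<lambda>t. fst (r t)", OF _ f]
        smooth_at_fderiv[OF G] r0 by simp
    from bounded_bilinear.has_vector_derivative[OF bounded_bilinear_blinfun_apply this s]
    show "((\<lambda>t. fderiv G (fst (r t)) (snd (r t))) has_vector_derivative fderiv (fderiv G) u y \<xi>) (at
      0)"
      using r0 by (simp add: blinfun.zero_right)
  qed
  define w' where "w' = tangent_map 1 (tangent_atlas B) (tangent_map 1 B g) w"
  have w'_jet: "w' = jet 1 (tangent_atlas B) \<Delta>" by (simp add: w'_def tangent_map_def \<Delta>_def R_def)
  have w': "w' \<in> tangent_bundle 1 (tangent_atlas B)"
    unfolding w'_jet by (rule tangent_bundle_jet[OF smooth_curveI[OF Td in_d]])
  have w'_chart: "tangent_chart (snd ?d) w' = ((G u, fderiv G u \<xi>), (fderiv G u y, fderiv (fderiv G)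
    u y \<xi>))"
  proof -
    have "curve_deriv 1 (snd ?d \<circ> \<Delta>) 0 = curve_deriv 1 ?s 0"
      by (rule curve_deriv_cong) (use e in eventually_elim, simp)
    also have "\<dots> = (fderiv G u y, fderiv (fderiv G) u y \<xi>)" by (rule curve_deriv_1I[OF s1])
    finally show ?thesis unfolding w'_jet tangent_chart_jet[OF TB Td in_d]
      using eventually_nhds_x_imp_x[OF e] r0 by simp
  qed
  have proj_w': "jet_proj (jet_proj w') = g x"
    using jet_proj_jet[OF TB smooth_curveI[OF Td in_d], of 1] tangent_map_proj[OF A B g R0(1)] R0x
    by (simp add: w'_jet \<Delta>_def)
  have KAw: "KA w \<in> tangent_bundle 1 A" "jet_proj (KA w) \<in> fst c"
      "tangent_chart (snd c) (KA w) = (u, \<Gamma>A c u \<xi> y)"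
    using linear_connectionD[OF KA w c(1), of u \<xi> y 0] w_chart c(2) proj_w
    by (simp_all add: tangent_bundle_chart_def)
  have KBw: "tangent_chart (snd d) (KB w') =
      (G u, fderiv (fderiv G) u y \<xi> + \<Gamma>B d (G u) (fderiv G u \<xi>) (fderiv G u y))"
    using linear_connectionD(3)[OF KB w' d(1)] w'_chart d(2) proj_w'
      by (simp add: tangent_bundle_chart_def)
  have eq: "KB w' = tangent_map 1 B g (KA w)"
    using rel w by (simp add: connections_related_def w'_def)
  have "snd c (jet_proj (KA w)) = snd c x" using KAw(3) by (simp add: tangent_chart_def u_def)
  then have "jet_proj (KA w) = x" using chart_inj[OF C KAw(2) c(2)] by simp
  then have "tangent_chart (snd d) (KB w') = (G u, fderiv G u (\<Gamma>A c u \<xi> y))"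
    unfolding eq G_def using tangent_map_chart[OF A B g c(1) d(1) KAw(1,2) _ KAw(3)] d(2) by simp
  \<comment> \<open>\<open>K\<close> differentiates the field \<open>\<xi>\<close> in direction \<open>y\<close>, whereas in \<open>M\<^sup>1(x, \<xi>) y\<close> the velocity
    is \<open>\<xi>\<close>: the second derivative has to be symmetric.\<close>
  then show ?thesis using KBw fderiv_fderiv_commute[OF G, of y \<xi>] by simp
qed

section \<open>The local components along a curve\<close>

text \<open>The arguments \<open>(x, \<xi>\<^sub>1, \<xi>\<^sub>2, \<dots>)\<close> of the local components are collected in a bounded sequence,
  so that all the components live on one Banach space and the sum over the partial derivatives
  becomes a single Frechet derivative.\<close>

definition seq_unit :: "nat \<Rightarrow> 'e::real_normed_vector \<Rightarrow> (nat \<Rightarrow>\<^sub>C 'e)" where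
  "seq_unit l v = Bcontfun (\<lambda>m. if m = l then v else 0)"

lemma apply_seq_unit: "apply_bcontfun (seq_unit l v) m = (if m = l then v else 0)"
proof -
  have "(\<lambda>m. if m = l then v else 0) \<in> bcontfun"
    by (rule bcontfun_normI[where b = "norm v"]) auto
  then show ?thesis by (simp add: seq_unit_def Bcontfun_inverse)
qed

lemma apply_bcontfun_sum: "apply_bcontfun (\<Sum>i\<in>I. f i) x = (\<Sum>i\<in>I. apply_bcontfun (f i) x)"
  by (induction I rule: infinite_finite_induct) auto

lemma bounded_linear_apply_bcontfun: "bounded_linear (\<lambda>f. apply_bcontfun f x)"
  by (rule bounded_linear_intro[where K = 1])
    (use norm_bounded in auto)

lemma bounded_linear_seq_unit: "bounded_linear (seq_unit l)"
proof (rule bounded_linear_intro[where K = 1])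
  show "norm (seq_unit l v) \<le> norm v * 1" for v :: 'a
    by (rule norm_bound) (simp add: apply_seq_unit)
qed (auto intro!: bcontfun_eqI simp: apply_seq_unit)

text \<open>The direction \<open>i xi_i\<close> in the \<open>i\<close>-th variable, for all
  \<open>i \<le> n\<close> at once; the \<open>i\<close>-th variable is entry \<open>i - 1\<close>.
  On Taylor coefficients this is their time derivative, cut off after \<open>n\<close>
  entries.\<close>

definition seq_shift :: "nat \<Rightarrow> (nat \<Rightarrow>\<^sub>C 'e) \<Rightarrow> (nat \<Rightarrow>\<^sub>C 'e::real_normed_vector)" where
  "seq_shift n \<zeta> = (\<Sum>i=1..n. seq_unit (i - 1) (real i *\<^sub>R apply_bcontfun \<zeta> i))"

lemma bounded_linear_seq_shift: "bounded_linear (seq_shift n)"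
  unfolding seq_shift_def
  by (intro bounded_linear_sum bounded_linear_compose[OF bounded_linear_seq_unit]
      bounded_linear_compose[OF bounded_linear_scaleR_right] bounded_linear_apply_bcontfun)

text \<open>The local components as functions on the sequence space. Order 0 is the identity,
  whereas \<open>local_component\<close> has the default 0 there: with the identity the recursion
  already produces order 1, and the Leibniz sum contains its term with \<open>j = 0\<close>.\<close>

fun comp_op :: "('e::banach \<Rightarrow> 'e \<Rightarrow>\<^sub>L 'e \<Rightarrow>\<^sub>L 'e) \<Rightarrow> nat \<Rightarrow> (nat \<Rightarrow>\<^sub>C 'e) \<Rightarrow> 'e \<Rightarrow>\<^sub>L 'e" where
  "comp_op G 0 = (\<lambda>\<zeta>. id_blinfun)"
| "comp_op G (Suc n) = (\<lambda>\<zeta>. (1 / real (Suc n)) *\<^sub>R (fderiv (comp_op G n) \<zeta> (seq_shift (Suc n) \<zeta>) +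
     (G (apply_bcontfun \<zeta> 0) (apply_bcontfun \<zeta> 1) o\<^sub>L comp_op G n \<zeta>)))"

lemma smooth_at_comp_op:
  assumes G: "smooth_on S G" and "apply_bcontfun \<zeta> 0 \<in> S"
  shows "smooth_at (comp_op G n) \<zeta>"
  using assms(2)
proof (induction n arbitrary: \<zeta>)
  case 0
  then show ?case by (simp add: smooth_at_const)
next
  case (Suc n)
  have "smooth_at (\<lambda>\<zeta>. G (apply_bcontfun \<zeta> 0)) \<zeta>"
    by (rule smooth_at_compose[where g = G])
      (auto intro: smooth_at_bounded_linear bounded_linear_apply_bcontfun smooth_atI[OF G
        Suc.prems])
  then have "smooth_at (\<lambda>\<zeta>. G (apply_bcontfun \<zeta> 0) (apply_bcontfun \<zeta> 1)) \<zeta>"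
    by (rule smooth_at_apply) (rule smooth_at_bounded_linear[OF bounded_linear_apply_bcontfun])
  then have a: "smooth_at (\<lambda>\<zeta>. (G (apply_bcontfun \<zeta> 0) (apply_bcontfun \<zeta> 1) o\<^sub>L comp_op G n \<zeta>)) \<zeta>"
    by (rule smooth_at_bilinear[OF bounded_bilinear_blinfun_compose]) (rule Suc.IH[OF Suc.prems])
  have b: "smooth_at (\<lambda>\<zeta>. fderiv (comp_op G n) \<zeta> (seq_shift (Suc n) \<zeta>)) \<zeta>"
    by (rule smooth_at_apply[OF smooth_at_fderiv[OF Suc.IH[OF Suc.prems]]])
      (rule smooth_at_bounded_linear[OF bounded_linear_seq_shift])
  show ?case
    unfolding comp_op.simps by (rule smooth_at_scaleR[OF smooth_at_const smooth_at_add[OF b a]])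
qed

lemma eventually_apply_bcontfun_in:
  fixes \<zeta> :: "'i::topological_space \<Rightarrow>\<^sub>C 'e::real_normed_vector"
  assumes "open S" "apply_bcontfun \<zeta> x \<in> S"
  shows "\<forall>\<^sub>F \<zeta>' in nhds \<zeta>. apply_bcontfun \<zeta>' x \<in> S"
proof -
  have "\<forall>\<^sub>F y in nhds (apply_bcontfun \<zeta> x). y \<in> S" by (rule eventually_nhds_in_open[OF assms])
  then show ?thesis
    by (rule smooth_at_compose_eventually[where f = "\<lambda>\<zeta>. apply_bcontfun \<zeta> x" and P = "\<lambda>y. y \<in> S",
          OF smooth_at_bounded_linear[OF bounded_linear_apply_bcontfun]])
qed

text \<open>By smoothness of \<open>comp_op\<close>, each partial derivative is the total derivative
  in the direction of one \<open>seq_unit\<close>, and linearity collects them into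
  \<open>seq_shift\<close>. This also shows that \<open>frechet_derivative\<close> in the recursion
  returns genuine derivatives.\<close>

lemma local_component_eq_comp_op:
  assumes G: "smooth_on S G" and "apply_bcontfun \<zeta> 0 \<in> S"
  shows "local_component G (Suc n) (apply_bcontfun \<zeta>) y = comp_op G (Suc n) \<zeta> y"
  using assms(2)
proof (induction n arbitrary: \<zeta>)
  case 0
  have "fderiv (\<lambda>\<zeta>. id_blinfun :: 'a \<Rightarrow>\<^sub>L 'a) \<zeta> = 0"
    by (rule blinfun_eqI) (simp add: fderiv_unique[OF smooth_at_const has_derivative_const])
  then show ?case by (simp add: blinfun.zero_left)
next
  case (Suc n)
  let ?M = "comp_op G (Suc n)"
  note M = smooth_at_comp_op[OF G Suc.prems, of "Suc n"]
  have pd: "partial_deriv i (\<lambda>\<zeta>'. local_component G (Suc n) \<zeta>' y) (apply_bcontfun \<zeta>) w =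
      fderiv ?M \<zeta> (seq_unit (i - 1) w) y" for i w
  proof -
    let ?l = "i - 1"
    \<comment> \<open>The affine line in the sequence space that moves only entry \<open>?l\<close>,
      placing \<open>u\<close> there.\<close>
    let ?p = "\<lambda>u. \<zeta> + seq_unit ?l (u - apply_bcontfun \<zeta> ?l)"
    have p: "apply_bcontfun (?p u) = (apply_bcontfun \<zeta>)(?l := u)" for u
      by (auto simp: apply_seq_unit)
    have p0: "?p (apply_bcontfun \<zeta> ?l) = \<zeta>"
      by (rule bcontfun_eqI) (simp only: p, simp)
    interpret su: bounded_linear "seq_unit ?l :: 'a \<Rightarrow> nat \<Rightarrow>\<^sub>C 'a" by (rule bounded_linear_seq_unit)
    have dp: "(?p has_derivative seq_unit ?l) (at (apply_bcontfun \<zeta> ?l))"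
      by (rule has_derivative_eq_rhs[OF has_derivative_add[OF has_derivative_const
            su.has_derivative[OF has_derivative_diff[OF has_derivative_ident
              has_derivative_const]]]]) simp
    have "((\<lambda>u. ?M (?p u)) has_derivative (\<lambda>h. fderiv ?M \<zeta> (seq_unit ?l h))) (at (apply_bcontfun \<zeta>
      ?l))"
      using has_derivative_compose[where g = ?M, OF dp] smooth_at_has_derivative[OF M] p0 by simp
    then have 1: "((\<lambda>u. ?M (?p u) y) has_derivative (\<lambda>h. fderiv ?M \<zeta> (seq_unit ?l h) y)) (at
      (apply_bcontfun \<zeta> ?l))"
      using bounded_linear.has_derivative[OF blinfun.bounded_linear_left] by blast
    \<comment> \<open>The induction hypothesis needs entry 0 in \<open>S\<close>. The moving entry
      may be this one, so the identity is available only near the base value.\<close>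
    have "\<forall>\<^sub>F \<zeta>' in nhds (?p (apply_bcontfun \<zeta> ?l)). apply_bcontfun \<zeta>' 0 \<in> S"
      unfolding p0 by (rule eventually_apply_bcontfun_in[OF smooth_on_open[OF G] Suc.prems])
    moreover have "(?p \<longlongrightarrow> ?p (apply_bcontfun \<zeta> ?l)) (nhds (apply_bcontfun \<zeta> ?l))"
      using has_derivative_continuous[OF dp] by (simp add: continuous_at tendsto_nhds_iff)
    ultimately have "\<forall>\<^sub>F u in nhds (apply_bcontfun \<zeta> ?l). apply_bcontfun (?p u) 0 \<in> S"
      by (rule eventually_compose_filterlim)
    then have "\<forall>\<^sub>F u in nhds (apply_bcontfun \<zeta> ?l).
        ?M (?p u) y = local_component G (Suc n) ((apply_bcontfun \<zeta>)(?l := u)) y"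
      by eventually_elim (use Suc.IH p in metis)
    then obtain T where T: "open T" "apply_bcontfun \<zeta> ?l \<in> T"
        "\<And>u. u \<in> T \<Longrightarrow> ?M (?p u) y = local_component G (Suc n) ((apply_bcontfun \<zeta>)(?l := u)) y"
      unfolding eventually_nhds by blast
    have "((\<lambda>u. local_component G (Suc n) ((apply_bcontfun \<zeta>)(?l := u)) y) has_derivative
        (\<lambda>h. fderiv ?M \<zeta> (seq_unit ?l h) y)) (at (apply_bcontfun \<zeta> ?l))"
      by (rule has_derivative_transform_within_open[OF 1 T(1,2,3)])
    then show ?thesis unfolding partial_deriv_def by (simp only: frechet_derivative_at[symmetric])
  qed
  have "(\<Sum>i=1..Suc (Suc n). partial_deriv i (\<lambda>\<zeta>'. local_component G (Suc n) \<zeta>' y) (apply_bcontfun \<zeta>)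
      (real i *\<^sub>R apply_bcontfun \<zeta> i)) = fderiv ?M \<zeta> (seq_shift (Suc (Suc n)) \<zeta>) y"
    unfolding pd seq_shift_def blinfun.sum_right blinfun.sum_left ..
  then show ?case
    unfolding local_component.simps(3) comp_op.simps(2)[of G "Suc n"] Suc.IH[OF Suc.prems]
    by (simp only: blinfun.scaleR_left blinfun.add_left blinfun_apply_blinfun_compose)
qed

text \<open>Permits cutting off the Taylor sequence: \<open>M^j\<close> reads the entries up to
  \<open>j\<close> only.\<close>

lemma local_component_cong:
  "(\<And>l. l \<le> j \<Longrightarrow> \<zeta> l = \<zeta>' l) \<Longrightarrow> local_component G j \<zeta> y = local_component G j \<zeta>' y"
proof (induction G j \<zeta> y arbitrary: \<zeta>' rule: local_component.induct)
  case (3 G n \<zeta> y)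
  have pd: "partial_deriv i (\<lambda>\<zeta>. local_component G (Suc n) \<zeta> y) \<zeta> (real i *\<^sub>R \<zeta> i) =
      partial_deriv i (\<lambda>\<zeta>. local_component G (Suc n) \<zeta> y) \<zeta>' (real i *\<^sub>R \<zeta>' i)"
    if "i \<in> {1..Suc (Suc n)}" for i
  proof -
    have "local_component G (Suc n) (\<zeta>(i - 1 := u)) y
      = local_component G (Suc n) (\<zeta>'(i - 1 := u)) y" for u
      using that 3(3) by (intro 3(1)) auto
    moreover have "\<zeta> (i - 1) = \<zeta>' (i - 1)" "\<zeta> i = \<zeta>' i" using that by (auto intro!: 3(3))
    ultimately show ?thesis unfolding partial_deriv_def by simp
  qed
  have "local_component G (Suc n) \<zeta> y = local_component G (Suc n) \<zeta>' y" using 3(3)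
    by (intro 3(2)) auto
  then show ?case using pd 3(3)[of 0] 3(3)[of 1] by simp
qed auto

lemma comp_op_cong:
  assumes G: "smooth_on S G" and "apply_bcontfun \<zeta> 0 \<in> S"
    and eq: "\<And>l. l \<le> n \<Longrightarrow> apply_bcontfun \<zeta> l = apply_bcontfun \<zeta>' l"
  shows "comp_op G n \<zeta> = comp_op G n \<zeta>'"
proof (cases n)
  case (Suc m)
  show ?thesis
  proof (rule blinfun_eqI)
    fix y
    show "comp_op G n \<zeta> y = comp_op G n \<zeta>' y"
      using local_component_eq_comp_op[OF G, of \<zeta> m y] local_component_eq_comp_op[OF G, of \<zeta>' m y]
        local_component_cong[of n "apply_bcontfun \<zeta>" "apply_bcontfun \<zeta>'" G y] assms(2) eq eq[of 0]
      unfolding Suc by simp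
  qed
qed simp

text \<open>The velocity of a Taylor sequence agrees with \<open>seq_shift (Suc n)\<close> in the
  entries up to \<open>n\<close> but not beyond; these entries suffice because moving the others
  leaves \<open>comp_op G n\<close> constant.\<close>

lemma fderiv_comp_op_cong:
  assumes G: "smooth_on S G" and \<zeta>: "apply_bcontfun \<zeta> 0 \<in> S"
    and eq: "\<And>l. l \<le> n \<Longrightarrow> apply_bcontfun v l = apply_bcontfun w l"
  shows "fderiv (comp_op G n) \<zeta> v = fderiv (comp_op G n) \<zeta> w"
proof -
  note M = smooth_at_has_derivative[OF smooth_at_comp_op[OF G \<zeta>, of n]]
  have v: "((\<lambda>t. comp_op G n (\<zeta> + t *\<^sub>R v)) has_vector_derivative fderiv (comp_op G n) \<zeta> v) (at 0)"
    by (rule has_derivative_line[OF M])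
  have w: "((\<lambda>t. comp_op G n (\<zeta> + t *\<^sub>R w)) has_vector_derivative fderiv (comp_op G n) \<zeta> w) (at 0)"
    by (rule has_derivative_line[OF M])
  have "\<forall>\<^sub>F \<zeta>' in nhds (\<zeta> + 0 *\<^sub>R v). apply_bcontfun \<zeta>' 0 \<in> S"
    using eventually_apply_bcontfun_in[OF smooth_on_open[OF G] \<zeta>] by simp
  then have "\<forall>\<^sub>F t in nhds 0. apply_bcontfun (\<zeta> + t *\<^sub>R v) 0 \<in> S"
    by (rule smooth_at_compose_eventually[OF smooth_at_line])
  then have "\<forall>\<^sub>F t in nhds 0. comp_op G n (\<zeta> + t *\<^sub>R v) = comp_op G n (\<zeta> + t *\<^sub>R w)"
    by eventually_elim (intro comp_op_cong[OF G], auto simp: eq)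
  then obtain T where T: "open T" "0 \<in> T" "\<And>t. t \<in> T \<Longrightarrow> comp_op G n (\<zeta> + t *\<^sub>R v) = comp_op G n (\<zeta>
    + t *\<^sub>R w)"
    unfolding eventually_nhds by blast
  have "((\<lambda>t. comp_op G n (\<zeta> + t *\<^sub>R w)) has_vector_derivative fderiv (comp_op G n) \<zeta> v) (at 0)"
    by (rule has_vector_derivative_transform_within_open[OF v T])
  then show ?thesis using w vector_derivative_unique_at by blast
qed

section \<open>Taylor sequences of smooth curves\<close>

lemma smooth_at_curve_deriv: "smooth_at c t \<Longrightarrow> smooth_at (curve_deriv n c) t"
proof (induction n arbitrary: t)
  case 0
  then show ?case by (simp add: curve_deriv_def)
next
  case (Suc n)
  have "smooth_at (\<lambda>t. fderiv (curve_deriv n c) t 1) t"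
    by (rule smooth_at_apply[OF smooth_at_fderiv[OF Suc.IH[OF Suc.prems]] smooth_at_const])
  moreover have "\<forall>\<^sub>F s in nhds t. fderiv (curve_deriv n c) s 1 = curve_deriv (Suc n) c s"
    using smooth_at_eventually[OF Suc.prems]
  proof eventually_elim
    case (elim s)
    have "(curve_deriv n c has_vector_derivative fderiv (curve_deriv n c) s 1) (at s)"
      using smooth_at_has_derivative[OF Suc.IH[OF elim]]
      by (simp add: has_vector_derivative_def flip: blinfun.scaleR_right)
    then show ?case by (simp add: curve_deriv_def vector_derivative_at)
  qed
  ultimately show ?case by (rule smooth_at_cong)
qed

lemma curve_deriv_has_vector_derivative:
  "smooth_at c t \<Longrightarrow> (curve_deriv n c has_vector_derivative curve_deriv (Suc n) c t) (at t)"
  using smooth_at_vector_derivative[OF smooth_at_curve_deriv, of c t n]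
    by (simp add: curve_deriv_def)

text \<open>Cut off at \<open>m\<close>, as all Taylor coefficients of a smooth curve together need
  not form a bounded sequence.\<close>

definition taylor_seq :: "nat \<Rightarrow> (real \<Rightarrow> 'e::real_normed_vector) \<Rightarrow> real \<Rightarrow> (nat \<Rightarrow>\<^sub>C 'e)" where
  "taylor_seq m c t = (\<Sum>l\<le>m. seq_unit l ((1 / fact l) *\<^sub>R curve_deriv l c t))"

lemma apply_sum_seq_unit:
  "apply_bcontfun (\<Sum>l\<le>m. seq_unit l (f l)) i = (if i \<le> m then f i else 0)"
  by (simp add: apply_bcontfun_sum apply_seq_unit)

lemma apply_taylor_seq:
  "apply_bcontfun (taylor_seq m c t) i = (if i \<le> m then (1 / fact i) *\<^sub>R curve_deriv i c t else 0)"
  unfolding taylor_seq_def apply_sum_seq_unit ..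

lemma apply_seq_shift:
  "apply_bcontfun (seq_shift n \<zeta>) l = (if l < n then real (Suc l) *\<^sub>R apply_bcontfun \<zeta> (Suc l) else
    0)"
proof -
  have "seq_shift n \<zeta> = (\<Sum>i<n. seq_unit i (real (Suc i) *\<^sub>R apply_bcontfun \<zeta> (Suc i)))"
    unfolding seq_shift_def by (rule sum.reindex_bij_witness[of _ Suc "\<lambda>i. i - 1"]) auto
  then show ?thesis by (simp add: apply_bcontfun_sum apply_seq_unit)
qed

text \<open>The chain rule gives the derivative of \<open>comp_op\<close> along the velocity of the
  Taylor sequence, and the recursion expresses it by the next component. The velocity up to entry
  \<open>n\<close> involves the coefficient of order \<open>n + 1\<close>, hence
  \<open>n < m\<close>.\<close>

lemma comp_op_deriv:
  assumes G: "smooth_on S G" and c: "smooth_at c t" "c t \<in> S" and "n < m"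
  shows "((\<lambda>t. comp_op G n (taylor_seq m c t)) has_vector_derivative
     real (Suc n) *\<^sub>R comp_op G (Suc n) (taylor_seq m c t)
       - (G (c t) (curve_deriv 1 c t) o\<^sub>L comp_op G n (taylor_seq m c t))) (at t)"
proof -
  let ?Z = "taylor_seq m c" and ?Z' = "\<Sum>l\<le>m. seq_unit l ((1 / fact l) *\<^sub>R curve_deriv (Suc l) c t)"
  have Z: "(?Z has_vector_derivative ?Z') (at t)"
    unfolding taylor_seq_def
    by (intro has_vector_derivative_sum bounded_linear.has_vector_derivative[OF
      bounded_linear_seq_unit]
        bounded_linear.has_vector_derivative[OF bounded_linear_scaleR_right]
          curve_deriv_has_vector_derivative c)
  have Z0: "apply_bcontfun (?Z t) 0 \<in> S" "apply_bcontfun (?Z t) 0 = c t" "apply_bcontfun (?Z t) 1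
    = curve_deriv 1 c t"
    using c \<open>n < m\<close> by (simp_all add: apply_taylor_seq) (simp_all add: curve_deriv_def)
  have "((\<lambda>t. comp_op G n (?Z t)) has_vector_derivative fderiv (comp_op G n) (?Z t) ?Z') (at t)"
    by (rule smooth_at_compose_vector_derivative[OF smooth_at_comp_op[OF G Z0(1)] Z])
  also have "fderiv (comp_op G n) (?Z t) ?Z' = fderiv (comp_op G n) (?Z t) (seq_shift (Suc n) (?Z
    t))"
    using \<open>n < m\<close> by (intro fderiv_comp_op_cong[OF G Z0(1)])
      (simp add: apply_sum_seq_unit apply_seq_shift apply_taylor_seq divide_simps del: of_nat_Suc)
  also have "\<dots> = real (Suc n) *\<^sub>R comp_op G (Suc n) (?Z t) - (G (c t) (curve_deriv 1 c t) o\<^sub>L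
    comp_op G n (?Z t))"
  proof -
    have "comp_op G (Suc n) (?Z t) = (1 / real (Suc n)) *\<^sub>R
        (fderiv (comp_op G n) (?Z t) (seq_shift (Suc n) (?Z t))
          + (G (c t) (curve_deriv 1 c t) o\<^sub>L comp_op G n (?Z t)))"
      by (simp only: comp_op.simps Z0(2,3))
    then have "real (Suc n) *\<^sub>R comp_op G (Suc n) (?Z t) =
        fderiv (comp_op G n) (?Z t) (seq_shift (Suc n) (?Z t))
          + (G (c t) (curve_deriv 1 c t) o\<^sub>L comp_op G n (?Z t))"
      by (simp del: of_nat_Suc comp_op.simps)
    then show ?thesis by (simp only: add_diff_cancel_right')
  qed
  finally show ?thesis .
qed


section \<open>Iterated covariant derivatives of the velocity\<close>

text \<open>\<open>cov_deriv G k c m\<close> is \<open>1 / m!\<close> times the \<open>m\<close>-th iterate of \<open>d/dt + G c c'\<close> applied to the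
  velocity \<open>c'\<close>, for all \<open>m \<le> k\<close>: this is the Leibniz rule, as \<open>j! M\<^sup>j\<close> is the \<open>j\<close>-th iterate
  applied to constant fields.\<close>

definition cov_deriv ::
    "('e::banach \<Rightarrow> 'e \<Rightarrow>\<^sub>L 'e \<Rightarrow>\<^sub>L 'e) \<Rightarrow> nat \<Rightarrow> (real \<Rightarrow> 'e) \<Rightarrow> nat \<Rightarrow> real \<Rightarrow> 'e" where
  "cov_deriv G k c m t = (\<Sum>j\<le>m. comp_op G j (taylor_seq k c t) ((1 / fact (m - j)) *\<^sub>R curve_deriv
    (Suc (m - j)) c t))"

lemma z_coord_eq_cov_deriv:
  assumes G: "smooth_on S G" and "c 0 \<in> S" and "m \<le> k"
  shows "z_coord G c (Suc m) = (1 / real (Suc m)) *\<^sub>R cov_deriv G k c m 0"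
proof -
  have "local_component G j (\<lambda>l. (1 / fact l) *\<^sub>R curve_deriv l c 0) y
    = comp_op G j (taylor_seq k c 0) y"
    if "j \<in> {1..m}" for j y
  proof -
    obtain i where j: "j = Suc i" using \<open>j \<in> {1..m}\<close> by (cases j) auto
    have "local_component G j (\<lambda>l. (1 / fact l) *\<^sub>R curve_deriv l c 0) y
      = local_component G j (apply_bcontfun (taylor_seq k c 0)) y"
      using \<open>j \<in> {1..m}\<close> \<open>m \<le> k\<close> by (intro local_component_cong) (simp add: apply_taylor_seq)
    also have "\<dots> = comp_op G j (taylor_seq k c 0) y"
      unfolding j using assms(2) by (intro local_component_eq_comp_op[OF G]) (simp add:
        apply_taylor_seq curve_deriv_def)
    finally show ?thesis .
  qed
  then have "(\<Sum>j=1..m. local_component G j (\<lambda>l. (1 / fact l) *\<^sub>R curve_deriv l c 0)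
             ((1 / fact (Suc m - j - 1)) *\<^sub>R curve_deriv (Suc m - j) c 0)) =
      (\<Sum>j=1..m. comp_op G j (taylor_seq k c 0) ((1 / fact (m - j)) *\<^sub>R curve_deriv (Suc (m - j)) c
        0))"
    by (intro sum.cong refl) (simp add: Suc_diff_le)
  \<comment> \<open>The term with \<open>j = 0\<close> is the identity applied to the highest
    derivative, the first summand of \<open>z_coord\<close>.\<close>
  moreover have "{..m} = insert 0 {1..m}" by auto
  ultimately show ?thesis by (simp add: z_coord_def cov_deriv_def)
qed

lemma cov_deriv_0: "cov_deriv G k c 0 t = curve_deriv 1 c t"
  by (simp add: cov_deriv_def)

lemma cov_deriv_deriv:
  assumes G: "smooth_on S G" and c: "smooth_at c t" "c t \<in> S" and "m < k"
  shows "(cov_deriv G k c m has_vector_derivative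
     real (Suc m) *\<^sub>R cov_deriv G k c (Suc m) t - G (c t) (curve_deriv 1 c t) (cov_deriv G k c m t))
       (at t)"
proof -
  let ?A = "\<lambda>j. comp_op G j (taylor_seq k c t)" and ?C
    = "\<lambda>l. (1 / fact l) *\<^sub>R curve_deriv (Suc l) c t"
  let ?\<Gamma> = "G (c t) (curve_deriv 1 c t)"
  have C: "((\<lambda>t. (1 / fact l) *\<^sub>R curve_deriv (Suc l) c t) has_vector_derivative real (Suc l) *\<^sub>R ?C
    (Suc l)) (at t)" for l
  proof -
    have "((\<lambda>t. (1 / fact l) *\<^sub>R curve_deriv (Suc l) c t) has_vector_derivative (1 / fact l) *\<^sub>R
      curve_deriv (Suc (Suc l)) c t) (at t)"
      by (intro bounded_linear.has_vector_derivative[OF bounded_linear_scaleR_right]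
        curve_deriv_has_vector_derivative c)
    then show ?thesis by (simp del: of_nat_Suc)
  qed
  have "(cov_deriv G k c m has_vector_derivative (\<Sum>j\<le>m. ?A j (real (Suc (m - j)) *\<^sub>R ?C (Suc (m -
    j))) +
      (real (Suc j) *\<^sub>R ?A (Suc j) - (?\<Gamma> o\<^sub>L ?A j)) (?C (m - j)))) (at t)"
    unfolding cov_deriv_def
    using \<open>m < k\<close> by (intro has_vector_derivative_sum bounded_bilinear.has_vector_derivative[OF
      bounded_bilinear_blinfun_apply]
        comp_op_deriv[OF G c] C) auto
  also have "(\<Sum>j\<le>m. ?A j (real (Suc (m - j)) *\<^sub>R ?C (Suc (m - j))) +
      (real (Suc j) *\<^sub>R ?A (Suc j) - (?\<Gamma> o\<^sub>L ?A j)) (?C (m - j)))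
      = (\<Sum>j\<le>m. real (Suc (m - j)) *\<^sub>R ?A j (?C (Suc (m - j))))
        + (\<Sum>j\<le>m. real (Suc j) *\<^sub>R ?A (Suc j) (?C (m - j)))
        - ?\<Gamma> (\<Sum>j\<le>m. ?A j (?C (m - j)))"
    by (simp only: blinfun.scaleR_right blinfun.scaleR_left blinfun.diff_left
      blinfun_apply_blinfun_compose
        scaleR_diff_right scaleR_left_commute sum.distrib sum_subtractf blinfun.sum_right
          add_diff_eq)
  \<comment> \<open>Both sums are extended to \<open>j \<le> Suc m\<close> by a term with
    coefficient 0; then the weights \<open>Suc m - j\<close> and \<open>j\<close> add up to
    \<open>Suc m\<close>.\<close>
  also have "(\<Sum>j\<le>m. real (Suc (m - j)) *\<^sub>R ?A j (?C (Suc (m - j))))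
    = (\<Sum>j\<le>Suc m. real (Suc m - j) *\<^sub>R ?A j (?C (Suc m - j)))"
    by (simp add: Suc_diff_le del: of_nat_Suc fact_Suc of_nat_diff)
  also have "(\<Sum>j\<le>m. real (Suc j) *\<^sub>R ?A (Suc j) (?C (m - j)))
    = (\<Sum>j\<le>Suc m. real j *\<^sub>R ?A j (?C (Suc m - j)))"
    by (subst sum.atMost_Suc_shift) (simp del: of_nat_Suc comp_op.simps)
  also have "(\<Sum>j\<le>Suc m. real (Suc m - j) *\<^sub>R ?A j (?C (Suc m - j)))
    + (\<Sum>j\<le>Suc m. real j *\<^sub>R ?A j (?C (Suc m - j)))
      = real (Suc m) *\<^sub>R (\<Sum>j\<le>Suc m. ?A j (?C (Suc m - j)))"
    unfolding scaleR_sum_right sum.distrib[symmetric] scaleR_add_left[symmetric]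
    by (intro sum.cong refl arg_cong[where f = "\<lambda>a. a *\<^sub>R _"]) (simp add: of_nat_diff)
  finally show ?thesis unfolding cov_deriv_def .
qed

text \<open>Differentiating \<open>fderiv g (c t) (cov_deriv GA k c m t)\<close> yields a second
  derivative of \<open>g\<close> in the directions of the velocity and of the covariant derivative;
  relatedness trades it for the difference of the Christoffel terms.\<close>

lemma cov_deriv_related:
  fixes g :: "'e::banach \<Rightarrow> 'f::banach" and GA :: "'e \<Rightarrow> 'e \<Rightarrow>\<^sub>L 'e \<Rightarrow>\<^sub>L 'e"
    and GB :: "'f \<Rightarrow> 'f \<Rightarrow>\<^sub>L 'f \<Rightarrow>\<^sub>L 'f"
  assumes GA: "smooth_on S GA" and GB: "smooth_on T GB"
    and c: "smooth_at c 0" "c 0 \<in> S" and g: "smooth_at g (c 0)" "g (c 0) \<in> T"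
    and rel: "\<forall>\<^sub>F u in nhds (c 0). \<forall>\<xi> y. fderiv g u (GA u \<xi> y) =
      fderiv (fderiv g) u \<xi> y + GB (g u) (fderiv g u \<xi>) (fderiv g u y)"
    and "m \<le> k"
  shows "cov_deriv GB k (\<lambda>t. g (c t)) m 0 = fderiv g (c 0) (cov_deriv GA k c m 0)"
proof -
  have "\<forall>\<^sub>F u in nhds (c 0). u \<in> S" by (rule eventually_nhds_in_open[OF smooth_on_open[OF GA] c(2)])
  moreover have "\<forall>\<^sub>F u in nhds (c 0). g u \<in> T"
    by (rule smooth_at_compose_eventually[OF g(1) eventually_nhds_in_open[OF smooth_on_open[OF GB]
      g(2)]])
  ultimately have "\<forall>\<^sub>F u in nhds (c 0). u \<in> S \<and> g u \<in> T \<and> smooth_at g u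
    \<and> (\<forall>\<xi> y. fderiv g u (GA u \<xi> y) =
      fderiv (fderiv g) u \<xi> y + GB (g u) (fderiv g u \<xi>) (fderiv g u y))"
    using smooth_at_eventually[OF g(1)] rel by eventually_elim blast
  then have "\<forall>\<^sub>F t in nhds 0. c t \<in> S \<and> g (c t) \<in> T \<and> smooth_at g (c t)
    \<and> (\<forall>\<xi> y. fderiv g (c t) (GA (c t) \<xi> y) =
      fderiv (fderiv g) (c t) \<xi> y + GB (g (c t)) (fderiv g (c t) \<xi>) (fderiv g (c t) y))"
    by (rule smooth_at_compose_eventually[OF c(1)])
  then have "\<forall>\<^sub>F t in nhds 0. smooth_at c t \<and> c t \<in> S \<and> g (c t) \<in> T \<and> smooth_at g (c t)
    \<and> (\<forall>\<xi> y. fderiv g (c t) (GA (c t) \<xi> y) =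
      fderiv (fderiv g) (c t) \<xi> y + GB (g (c t)) (fderiv g (c t) \<xi>) (fderiv g (c t) y))"
    using smooth_at_eventually[OF c(1)] by eventually_elim blast
  \<comment> \<open>An open set of times, because the identity for \<open>m\<close> is
    differentiated to obtain the one for \<open>Suc m\<close>.\<close>
  then obtain I where I: "open I" "0 \<in> I" and *: "\<And>t. t \<in> I \<Longrightarrow> smooth_at c t" "\<And>t. t \<in> I \<Longrightarrow> c t \<in> S"
      "\<And>t. t \<in> I \<Longrightarrow> g (c t) \<in> T" "\<And>t. t \<in> I \<Longrightarrow> smooth_at g (c t)"
      "\<And>t \<xi> y. t \<in> I \<Longrightarrow> fderiv g (c t) (GA (c t) \<xi> y) =
      fderiv (fderiv g) (c t) \<xi> y + GB (g (c t)) (fderiv g (c t) \<xi>) (fderiv g (c t) y)"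
    unfolding eventually_nhds by blast
  let ?WA = "cov_deriv GA k c" and ?WB = "cov_deriv GB k (\<lambda>t. g (c t))"
  have gc: "smooth_at (\<lambda>t. g (c t)) t" "curve_deriv 1 (\<lambda>t. g (c t)) t
    = fderiv g (c t) (curve_deriv 1 c t)" if "t \<in> I" for t
    using smooth_at_compose[OF *(1)[OF that] *(4)[OF that]]
      curve_deriv_1I[OF smooth_at_compose_vector_derivative[OF *(4)[OF that]
        smooth_at_vector_derivative[OF *(1)[OF that]]]]
    by auto
  have "\<forall>t\<in>I. ?WB m t = fderiv g (c t) (?WA m t)"
    using \<open>m \<le> k\<close>
  proof (induction m)
    case 0
    then show ?case using gc by (simp add: cov_deriv_0)
  next
    case (Suc m)
    show ?case
    proof
      fix t assume t: "t \<in> I"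
      let ?v = "curve_deriv 1 c t"
      have B: "(?WB m has_vector_derivative real (Suc m) *\<^sub>R ?WB (Suc m) t
          - GB (g (c t)) (fderiv g (c t) ?v) (fderiv g (c t) (?WA m t))) (at t)"
        using cov_deriv_deriv[OF GB gc(1)[OF t] *(3)[OF t], of m k] gc(2)[OF t] Suc t by simp
      have d: "((\<lambda>t. fderiv g (c t)) has_vector_derivative fderiv (fderiv g) (c t) ?v) (at t)"
        by (rule smooth_at_compose_vector_derivative[OF smooth_at_fderiv[OF *(4)[OF t]]
              smooth_at_vector_derivative[OF *(1)[OF t]]])
      have "(?WA m has_vector_derivative real (Suc m) *\<^sub>R ?WA (Suc m) t - GA (c t) ?v (?WA m t)) (at
        t)"
        using cov_deriv_deriv[OF GA *(1)[OF t] *(2)[OF t]] Suc.prems by simp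
      from bounded_bilinear.has_vector_derivative[OF bounded_bilinear_blinfun_apply d this]
      have "((\<lambda>t. fderiv g (c t) (?WA m t)) has_vector_derivative
          fderiv g (c t) (real (Suc m) *\<^sub>R ?WA (Suc m) t - GA (c t) ?v (?WA m t))
          + fderiv (fderiv g) (c t) ?v (?WA m t)) (at t)" .
      \<comment> \<open>By the induction hypothesis both sides are the same function on
        \<open>I\<close>; comparing the two expressions for its derivative isolates order
        \<open>Suc m\<close>.\<close>
      then have "(?WB m has_vector_derivative
          fderiv g (c t) (real (Suc m) *\<^sub>R ?WA (Suc m) t - GA (c t) ?v (?WA m t))
          + fderiv (fderiv g) (c t) ?v (?WA m t)) (at t)"
        by (rule has_vector_derivative_transform_within_open[OF _ I(1) t]) (use Suc in simp)
      from vector_derivative_unique_at[OF this B]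
      have "real (Suc m) *\<^sub>R ?WB (Suc m) t = real (Suc m) *\<^sub>R fderiv g (c t) (?WA (Suc m) t)"
        using *(5)[OF t, of ?v "?WA m t"] by (simp add: blinfun.diff_right blinfun.scaleR_right del:
          of_nat_Suc)
      then show "?WB (Suc m) t = fderiv g (c t) (?WA (Suc m) t)" by (simp del: of_nat_Suc)
    qed
  qed
  then show ?thesis using I by blast
qed

section \<open>Surjectivity of the trivializations on fibres\<close>

lemma z_coord_cong:
  assumes "\<And>l. l \<le> i \<Longrightarrow> curve_deriv l c 0 = curve_deriv l d 0"
  shows "z_coord G c i = z_coord G d i"
proof -
  have *: "local_component G j (\<lambda>l. (1 / fact l) *\<^sub>R curve_deriv l c 0) ((1 / fact (i - j - 1)) *\<^sub>R
    curve_deriv (i - j) c 0)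
      = local_component G j (\<lambda>l. (1 / fact l) *\<^sub>R curve_deriv l d 0) ((1 / fact (i - j - 1)) *\<^sub>R
        curve_deriv (i - j) d 0)"
    if "j \<in> {1..i - 1}" for j
  proof -
    have "curve_deriv (i - j) c 0 = curve_deriv (i - j) d 0" by (rule assms) simp
    moreover have "local_component G j (\<lambda>l. (1 / fact l) *\<^sub>R curve_deriv l c 0) y
        = local_component G j (\<lambda>l. (1 / fact l) *\<^sub>R curve_deriv l d 0) y" for y
    proof (rule local_component_cong)
      fix l assume "l \<le> j"
      then have "curve_deriv l c 0 = curve_deriv l d 0" using that by (intro assms) auto
      then show "(1 / fact l) *\<^sub>R curve_deriv l c 0 = (1 / fact l) *\<^sub>R curve_deriv l d 0" by simp
    qed
    ultimately show ?thesis by simp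
  qed
  show ?thesis
    unfolding z_coord_def assms[OF le_refl]
    by (intro arg_cong2[where f = scaleR] arg_cong2[where f = plus] sum.cong refl *)
qed

text \<open>The factorials make \<open>b l\<close> the derivative of order \<open>l\<close> at 0 and
  turn differentiation into a shift of \<open>b\<close>.\<close>

definition poly_curve :: "nat \<Rightarrow> (nat \<Rightarrow> 'e::real_normed_vector) \<Rightarrow> real \<Rightarrow> 'e" where
  "poly_curve m b t = (\<Sum>l<m. (t ^ l / fact l) *\<^sub>R b l)"

lemma poly_curve_deriv:
  "(poly_curve m b has_vector_derivative poly_curve (m - 1) (\<lambda>l. b (Suc l)) t) (at t)"
proof (cases m)
  case (Suc n)
  have "((\<lambda>t. \<Sum>l<m. (t ^ l / fact l) *\<^sub>R b l) has_vector_derivative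
      (\<Sum>l<m. (real l * t ^ (l - 1) / fact l) *\<^sub>R b l)) (at t)"
    by (intro has_vector_derivative_sum) (auto intro!: derivative_eq_intros simp:
      has_vector_derivative_def)
  also have "(\<Sum>l<m. (real l * t ^ (l - 1) / fact l) *\<^sub>R b l)
    = (\<Sum>l<n. (t ^ l / fact l) *\<^sub>R b (Suc l))"
    unfolding Suc by (subst sum.lessThan_Suc_shift) (simp del: of_nat_Suc)
  finally show ?thesis by (simp add: poly_curve_def[abs_def] Suc)
qed (simp add: poly_curve_def[abs_def])

lemma curve_deriv_poly_curve: "curve_deriv n (poly_curve m b) = poly_curve (m - n) (\<lambda>l. b (l + n))"
proof (induction n)
  case (Suc n)
  have "curve_deriv (Suc n) (poly_curve m b) = (\<lambda>t. vector_derivative (curve_deriv n (poly_curve m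
    b)) (at t))"
    by (simp add: curve_deriv_def)
  then show ?case unfolding Suc using poly_curve_deriv[of "m - n" "\<lambda>l. b (l
    + n)", THEN vector_derivative_at] by auto
qed (simp add: curve_deriv_def)

lemma poly_curve_0: "poly_curve m b 0 = (if m = 0 then 0 else b 0)"
proof (cases m)
  case (Suc n)
  show ?thesis unfolding poly_curve_def Suc by (subst sum.lessThan_Suc_shift) simp
qed (simp add: poly_curve_def)

lemma smooth_at_poly_curve: "smooth_at (poly_curve m b) t"
  unfolding poly_curve_def[abs_def] divide_inverse
  by (intro smooth_at_sum smooth_at_scaleR smooth_at_const smooth_at_power
      smooth_at_bilinear[OF bounded_bilinear_mult] smooth_at_ident)

text \<open>\<open>z\<^sup>i\<close> is \<open>b i / i!\<close> plus a term in \<open>b 0, \<dots>, b (i - 1)\<close>, so that the coefficients can be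
  solved for one after the other.\<close>

lemma exists_curve_z_coord:
  fixes v :: "nat \<Rightarrow> 'e::banach"
  shows "\<exists>b. b 0 = u \<and> (\<forall>m i. i \<in> {1..k} \<longrightarrow> k < m \<longrightarrow> z_coord G (poly_curve m b) i = v i)"
proof (induction k)
  case 0
  then show ?case by (intro exI[of _ "\<lambda>_. u"]) simp
next
  case (Suc k)
  have cd: "curve_deriv l (poly_curve m b) 0 = b l" if "l < m" for l m and b :: "nat \<Rightarrow> 'e"
    using that by (simp add: curve_deriv_poly_curve poly_curve_0)
  obtain b where b: "b 0 = u" "\<And>m i. i \<in> {1..k} \<Longrightarrow> k < m \<Longrightarrow> z_coord G (poly_curve m b) i = v i"
    using Suc by blast
  \<comment> \<open>The part of z^(k+1) that involves only \<open>b 0\<close>, ...,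
    \<open>b k\<close>, which are already fixed.\<close>
  define R where "R = (\<Sum>j=1..k. local_component G j (\<lambda>l. (1 / fact l) *\<^sub>R b l) ((1 / fact (k - j))
    *\<^sub>R b (Suc k - j)))"
  \<comment> \<open>The solution of \<open>(1 / real (Suc k)) *\<^sub>R ((1 / fact k) *\<^sub>R X +
    R) = v (Suc k)\<close>.\<close>
  define X where "X = (fact k :: real) *\<^sub>R (real (Suc k) *\<^sub>R v (Suc k) - R)"
  \<comment> \<open>Only the derivative of order \<open>k + 1\<close> changes. The induction
    hypothesis covers all lengths \<open>m > k\<close>, so the coordinates already achieved persist
    for the longer polynomial.\<close>
  define b' where "b' = b(Suc k := X)"
  have z: "z_coord G (poly_curve m b') i = v i" if i: "i \<in> {1..Suc k}" and m: "Suc k < m" for m i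
  proof (cases "i = Suc k")
    case False
    then have "z_coord G (poly_curve m b') i = z_coord G (poly_curve m b) i"
      using i m by (intro z_coord_cong) (simp add: cd b'_def)
    then show ?thesis using b(2)[of i m] False i m by simp
  next
    case True
    have S: "(\<Sum>j=1..k. local_component G j (\<lambda>l. (1 / fact l) *\<^sub>R curve_deriv l (poly_curve m b') 0)
             ((1 / fact (Suc k - j - 1)) *\<^sub>R curve_deriv (Suc k - j) (poly_curve m b') 0)) = R"
      unfolding R_def
    proof (rule sum.cong[OF refl])
      fix j assume j: "j \<in> {1..k}"
      then have "curve_deriv (Suc k - j) (poly_curve m b') 0 = b (Suc k - j)"
        using m by (subst cd) (auto simp: b'_def)
      moreover have "Suc k - j - 1 = k - j" by simp
      moreover have "local_component G j (\<lambda>l. (1 / fact l) *\<^sub>R curve_deriv l (poly_curve m b') 0) y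
        =
          local_component G j (\<lambda>l. (1 / fact l) *\<^sub>R b l) y" for y
        using j m by (intro local_component_cong) (simp add: cd b'_def)
      ultimately show "local_component G j (\<lambda>l. (1 / fact l) *\<^sub>R curve_deriv l (poly_curve m b') 0)
             ((1 / fact (Suc k - j - 1)) *\<^sub>R curve_deriv (Suc k - j) (poly_curve m b') 0) =
          local_component G j (\<lambda>l. (1 / fact l) *\<^sub>R b l) ((1 / fact (k - j)) *\<^sub>R b (Suc k - j))"
        by simp
    qed
    have "z_coord G (poly_curve m b') (Suc k) = (1 / real (Suc k)) *\<^sub>R ((1 / fact k) *\<^sub>R X + R)"
    proof -
      have "curve_deriv (Suc k) (poly_curve m b') 0 = X" using m by (subst cd) (auto simp: b'_def)
      then show ?thesis unfolding z_coord_def diff_Suc_1 S by (simp only:)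
    qed
    also have "\<dots> = v (Suc k)" by (simp add: X_def del: of_nat_Suc)
    finally show ?thesis using True by simp
  qed
  have "b' 0 = u" by (simp add: b'_def b)
  then show ?case using z by (intro exI[of _ b'] conjI allI impI)
qed

section \<open>Positions in the index type and preimages under the trivializations\<close>

lemma index_bounds: "index (i :: 'k::{finite,linorder}) \<in> {1..CARD('k)}"
proof -
  have "card {..i} > 0" by (subst card_gt_0_iff) auto
  moreover have "card {..i} \<le> CARD('k)" by (intro card_mono) auto
  ultimately show ?thesis by (simp add: index_def)
qed

lemma inj_index: "inj (index :: 'k::{finite,linorder} \<Rightarrow> nat)"
proof (rule linorder_injI)
  fix i j :: 'k assume "i < j"
  then have "{..i} \<subset> {..j}" by auto
  then have "card {..i} < card {..j}" by (intro psubset_card_mono) auto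
  then show "index i \<noteq> index j" by (simp add: index_def)
qed

lemma induced_triv_surj:
  fixes v :: "'e::banach ^ 'k::{finite,linorder}"
  assumes A: "banach_manifold A" and c: "c \<in> charts A" "x \<in> fst c"
  shows "\<exists>w\<in>tangent_bundle (CARD('k)) A. jet_proj w = x \<and> snd (induced_triv \<Gamma> c w) = v"
proof -
  let ?k = "CARD('k)"
  have C: "is_chart c" by (rule chart_is_chart[OF c(1)])
  obtain b where b: "b 0 = snd c x"
      "\<And>m i. i \<in> {1..?k} \<Longrightarrow> ?k < m \<Longrightarrow> z_coord (\<Gamma> c) (poly_curve m b) i = v $ inv index i"
    using exists_curve_z_coord[of "snd c x" ?k "\<Gamma> c" "\<lambda>i. v $ inv index i"] by blast
  \<comment> \<open>\<open>poly_curve m\<close> has degree below \<open>m\<close>;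
    \<open>Suc ?k\<close> terms are needed to include the coefficient of order
    \<open>?k\<close>.\<close>
  let ?q = "poly_curve (Suc ?k) b"
  let ?\<gamma> = "\<lambda>t. chart_inv c (?q t)"
  have q0: "?q 0 = snd c x" by (simp add: poly_curve_0 b)
  note in_c = curve_in_chart_inv[OF C smooth_at_poly_curve[of "Suc ?k" b 0]]
  have \<gamma>: "curve_in c ?\<gamma>" "\<forall>\<^sub>F t in nhds 0. snd c (?\<gamma> t) = ?q t" using in_c q0 c by auto
  let ?w = "jet ?k A ?\<gamma>"
  have "jet_proj ?w = x"
    unfolding jet_proj_jet[OF A smooth_curveI[OF c(1) \<gamma>(1)]] q0 by (rule chart_inv_left[OF C c(2)])
  moreover have "?w \<in> tangent_bundle ?k A" by (rule tangent_bundle_jet[OF smooth_curveI[OF c(1)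
    \<gamma>(1)]])
  moreover have "z_coord (\<Gamma> c) (snd c \<circ> jet_rep ?w) (index i) = v $ i" for i :: 'k
  proof -
    have i: "index i \<in> {1..?k}" by (rule index_bounds)
    have "curve_deriv l (snd c \<circ> jet_rep ?w) 0 = curve_deriv l ?q 0" if "l \<le> index i" for l
    proof -
      have "curve_deriv l (snd c \<circ> jet_rep ?w) 0 = curve_deriv l (snd c \<circ> ?\<gamma>) 0"
        by (rule curve_in_jet_rep(2)[OF A c(1) \<gamma>(1)]) (use that i in simp)
      also have "\<dots> = curve_deriv l ?q 0" by (rule curve_deriv_cong) (use \<gamma>(2) in simp)
      finally show ?thesis .
    qed
    then have "z_coord (\<Gamma> c) (snd c \<circ> jet_rep ?w) (index i) = z_coord (\<Gamma> c) ?q (index i)"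
      by (rule z_coord_cong)
    then show ?thesis using b(2)[OF i, of "Suc ?k"] by (simp add: inv_f_f[OF inj_index])
  qed
  ultimately show ?thesis by (intro bexI[of _ ?w]) (simp_all add: induced_triv_def)
qed


section \<open>The higher order differential in the trivializations\<close>

lemma z_coord_related:
  fixes GA :: "'e::banach \<Rightarrow> 'e \<Rightarrow>\<^sub>L 'e \<Rightarrow>\<^sub>L 'e" and GB :: "'f::banach \<Rightarrow> 'f \<Rightarrow>\<^sub>L 'f \<Rightarrow>\<^sub>L 'f"
  assumes GA: "smooth_on S GA" and GB: "smooth_on T GB"
    and c: "smooth_at c 0" "c 0 \<in> S" and g: "smooth_at g (c 0)" "g (c 0) \<in> T"
    and rel: "\<forall>\<^sub>F u in nhds (c 0). \<forall>\<xi> y. fderiv g u (GA u \<xi> y) =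
      fderiv (fderiv g) u \<xi> y + GB (g u) (fderiv g u \<xi>) (fderiv g u y)"
    and "i \<ge> 1"
  shows "z_coord GB (\<lambda>t. g (c t)) i = fderiv g (c 0) (z_coord GA c i)"
proof -
  obtain m where i: "i = Suc m" using \<open>i \<ge> 1\<close> by (cases i) auto
  show ?thesis
    unfolding i z_coord_eq_cov_deriv[where c = c, OF GA c(2) le_refl] z_coord_eq_cov_deriv[where c
      = "\<lambda>t. g (c t)", OF GB g(2) le_refl]
      cov_deriv_related[OF GA GB c g rel le_refl] blinfun.scaleR_right ..
qed

lemma fibre_map_tangent_map:
  fixes \<Gamma>A :: "('m, 'e::banach) christoffel" and \<Gamma>B :: "('n, 'f::banach) christoffel"
    and v :: "'e ^ 'k::{finite,linorder}"
  assumes A: "banach_manifold A" and B: "banach_manifold B" and g: "smooth_map A B g"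
    and KA: "linear_connection A \<Gamma>A KA" and KB: "linear_connection B \<Gamma>B KB"
    and rel: "connections_related A B g KA KB" and k: "k = CARD('k)"
    and c: "c \<in> charts A" "x \<in> fst c" and d: "d \<in> charts B" "g x \<in> fst d"
  shows "fibre_map (induced_bundle k A \<Gamma>A) (induced_bundle k B \<Gamma>B) g (tangent_map k B g) c d x v =
    ((\<chi> i. fderiv (\<lambda>u. snd d (g (chart_inv c u))) (snd c x) (v $ i)) :: ('f, 'k) vec)"
proof -
  let ?X = "induced_bundle k A \<Gamma>A :: ('m jet, 'm, 'e, ('e, 'k) vec) vbundle"
  let ?Y = "induced_bundle k B \<Gamma>B :: ('n jet, 'n, 'f, ('f, 'k) vec) vbundle"
  let ?G = "\<lambda>u. snd d (g (chart_inv c u))"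
  have C: "is_chart c" by (rule chart_is_chart[OF c(1)])
  define p where "p = inv_into (fibre ?X x) (triv_at ?X c x) v"
  have "v \<in> triv_at ?X c x ` fibre ?X x"
    using induced_triv_surj[OF A c, of \<Gamma>A v]
    by (auto simp: triv_at_def fibre_def induced_bundle_def k image_iff)
  then have "p \<in> fibre ?X x" "triv_at ?X c x p = v"
    unfolding p_def by (rule inv_into_into, rule f_inv_into_f)
  then have p: "p \<in> tangent_bundle k A" "jet_proj p = x"
    and v: "\<And>i. z_coord (\<Gamma>A c) (snd c \<circ> jet_rep p) (index i) = v $ i"
    by (auto simp: triv_at_def fibre_def induced_bundle_def induced_triv_def)
  let ?\<gamma> = "jet_rep p"
  have \<gamma>0: "?\<gamma> 0 = x" using p by (simp add: jet_proj_def)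
  have in_c: "curve_in c ?\<gamma>"
    using tangent_bundle_rep(1)[OF A p(1)] smooth_curve_iff[where \<gamma> = ?\<gamma>, OF A c(1)] c(2) \<gamma>0 by simp
  have in_d: "curve_in d (g \<circ> ?\<gamma>)"
    by (rule curve_in_smooth_map[OF A B g c(1) in_c d(1)]) (simp add: \<gamma>0 d)
  have "z_coord (\<Gamma>B d) (snd d \<circ> jet_rep (tangent_map k B g p)) (index i)
    = fderiv ?G (snd c x) (v $ i)" for i :: 'k
  proof -
    have i: "index i \<in> {1..k}" unfolding k by (rule index_bounds)
    let ?c = "\<lambda>t. snd c (?\<gamma> t)"
    have "curve_deriv l (snd d \<circ> jet_rep (tangent_map k B g p)) 0 = curve_deriv l (\<lambda>t. ?G (?c t)) 0"
      if "l \<le> index i" for l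
    proof -
      have "curve_deriv l (snd d \<circ> jet_rep (tangent_map k B g p)) 0
        = curve_deriv l (snd d \<circ> (g \<circ> ?\<gamma>)) 0"
        unfolding tangent_map_def by (rule curve_in_jet_rep(2)[OF B d(1) in_d]) (use that i in simp)
      also have "\<dots> = curve_deriv l (\<lambda>t. ?G (?c t)) 0"
      proof (rule curve_deriv_cong)
        have "\<forall>\<^sub>F t in nhds 0. ?\<gamma> t \<in> fst c" using in_c by (simp add: curve_in_def)
        then show "\<forall>\<^sub>F t in nhds 0. (snd d \<circ> (g \<circ> ?\<gamma>)) t = ?G (?c t)"
          by eventually_elim (simp add: chart_inv_left[OF C])
      qed
      finally show ?thesis .
    qed
    then have "z_coord (\<Gamma>B d) (snd d \<circ> jet_rep (tangent_map k B g p)) (index i)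
      = z_coord (\<Gamma>B d) (\<lambda>t. ?G (?c t)) (index i)"
      by (rule z_coord_cong)
    also have "\<dots> = fderiv ?G (?c 0) (z_coord (\<Gamma>A c) ?c (index i))"
    proof (rule z_coord_related)
      show "smooth_on (snd c ` fst c) (\<Gamma>A c)" "smooth_on (snd d ` fst d) (\<Gamma>B d)"
        using KA KB c(1) d(1) unfolding linear_connection_def by fastforce+
      show "smooth_at ?c 0" using in_c by (simp add: curve_in_def)
      show "?c 0 \<in> snd c ` fst c" using c \<gamma>0 by simp
      show "smooth_at ?G (?c 0)" unfolding \<gamma>0 by (rule smooth_map_at(1)[OF A B g c d])
      show "?G (?c 0) \<in> snd d ` fst d" using c d \<gamma>0 by (simp add: chart_inv_left[OF C])
      show "1 \<le> index i" using i by simp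
      \<comment> \<open>The relation is needed at all points near \<open>x\<close>, since the
        covariant derivatives are compared along the whole germ of the curve.\<close>
      have "\<forall>\<^sub>F u in nhds (snd c x). \<forall>\<xi> y. fderiv ?G u (\<Gamma>A c u \<xi> y) =
          fderiv (fderiv ?G) u \<xi> y + \<Gamma>B d (?G u) (fderiv ?G u \<xi>) (fderiv ?G u y)"
        using eventually_chart_inv[OF C c(2)] smooth_map_at(2)[OF A B g c d]
      proof eventually_elim
        case (elim u)
        then show ?case
          using connections_related_local[OF A B g KA KB rel c(1) _ d(1), of "chart_inv c u"]
            by simp
      qed
      then show "\<forall>\<^sub>F u in nhds (?c 0). \<forall>\<xi> y. fderiv ?G u (\<Gamma>A c u \<xi> y) =
          fderiv (fderiv ?G) u \<xi> y + \<Gamma>B d (?G u) (fderiv ?G u \<xi>) (fderiv ?G u y)"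
        unfolding \<gamma>0 .
    qed
    finally show ?thesis using v[of i] \<gamma>0 by (simp add: o_def)
  qed
  then show ?thesis
    by (simp add: fibre_map_def flip: p_def) (simp add: triv_at_def induced_bundle_def
      induced_triv_def)
qed

section \<open>Operators acting componentwise on the \<open>k\<close>-fold product\<close>

lemma norm_vec_map_le:
  "norm ((\<chi> i. blinfun_apply A (v $ i)) :: 'f::real_normed_vector ^ 'k)
    \<le> norm A * norm (v :: 'e::real_normed_vector ^ 'k)"
proof -
  have "norm ((\<chi> i. blinfun_apply A (v $ i)) :: 'f ^ 'k) \<le> L2_set (\<lambda>i. norm A * norm (v $ i)) UNIV"
    unfolding norm_vec_def by (intro L2_set_mono) (simp_all add: norm_blinfun)
  also have "\<dots> = norm A * norm v" unfolding norm_vec_def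
    by (rule L2_set_right_distrib[symmetric]) simp
  finally show ?thesis .
qed

lemma bounded_linear_vec_map:
  "bounded_linear (\<lambda>v :: 'e::real_normed_vector ^ 'k. (\<chi> i. blinfun_apply A (v $ i)) ::
    'f::real_normed_vector ^ 'k)"
  by (rule bounded_linear_intro[where K = "norm A"])
    (use norm_vec_map_le[of A] in \<open>auto simp: vec_eq_iff blinfun.add_right blinfun.scaleR_right
      mult.commute\<close>)

text \<open>The block diagonal embedding of operators is bounded linear, so smoothness of
  \<open>fderiv\<close> in the operator norm carries over to the fibre maps on the
  \<open>k\<close>-fold product.\<close>

lemma bounded_linear_Blinfun_vec_map:
  "bounded_linear (\<lambda>A. Blinfun (\<lambda>v :: 'e::real_normed_vector ^ 'k. (\<chi> i. blinfun_apply A (v $ i)) ::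
    'f::real_normed_vector ^ 'k))"
proof (rule bounded_linear_intro[where K = 1])
  note app = bounded_linear_Blinfun_apply[OF bounded_linear_vec_map]
  fix A B :: "'e \<Rightarrow>\<^sub>L 'f" and r :: real
  show "Blinfun (\<lambda>v :: 'e ^ 'k. (\<chi> i. blinfun_apply (A + B) (v $ i)) :: 'f ^ 'k) =
      Blinfun (\<lambda>v. \<chi> i. blinfun_apply A (v $ i)) + Blinfun (\<lambda>v. \<chi> i. blinfun_apply B (v $ i))"
    by (rule blinfun_eqI, subst app, subst blinfun.add_left, subst app, subst app)
      (simp add: vec_eq_iff blinfun.add_left)
  show "Blinfun (\<lambda>v :: 'e ^ 'k. (\<chi> i. blinfun_apply (r *\<^sub>R A) (v $ i)) :: 'f ^ 'k) =
      r *\<^sub>R Blinfun (\<lambda>v. \<chi> i. blinfun_apply A (v $ i))"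
    by (rule blinfun_eqI, subst app, subst blinfun.scaleR_left, subst app)
      (simp add: vec_eq_iff blinfun.scaleR_left)
  show "norm (Blinfun (\<lambda>v :: 'e ^ 'k. (\<chi> i. blinfun_apply A (v $ i)) :: 'f ^ 'k)) \<le> norm A * 1"
    by (rule norm_blinfun_bound) (simp_all add: app norm_vec_map_le)
qed

theorem theorem3p2:
  fixes M :: "('m, 'e::banach) chart set"
    and N :: "('n, 'f::banach) chart set"
    and \<Gamma>\<^sub>M :: "('m, 'e) christoffel" and K\<^sub>M :: "'m jet jet \<Rightarrow> 'm jet"
    and \<Gamma>\<^sub>N :: "('n, 'f) christoffel" and K\<^sub>N :: "'n jet jet \<Rightarrow> 'n jet"
    and g :: "'m \<Rightarrow> 'n" and k :: nat
  assumes "banach_manifold M" and "banach_manifold N"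
    and "linear_connection M \<Gamma>\<^sub>M K\<^sub>M" and "linear_connection N \<Gamma>\<^sub>N K\<^sub>N"
    and "smooth_map M N g"
    and "k = CARD('k::{finite,linorder})"
    and "connections_related M N g K\<^sub>M K\<^sub>N"
  shows "vbundle_morphism
           (induced_bundle k M \<Gamma>\<^sub>M :: ('m jet, 'm, 'e, 'e ^ 'k::{finite,linorder}) vbundle)
           (induced_bundle k N \<Gamma>\<^sub>N :: ('n jet, 'n, 'f, 'f ^ 'k::{finite,linorder}) vbundle)
           g (tangent_map k N g)"
proof -
  let ?X = "induced_bundle k M \<Gamma>\<^sub>M :: ('m jet, 'm, 'e, ('e, 'k) vec) vbundle"
  let ?Y = "induced_bundle k N \<Gamma>\<^sub>N :: ('n jet, 'n, 'f, ('f, 'k) vec) vbundle"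
  let ?F = "tangent_map k N g"
  let ?G = "\<lambda>c d u. snd d (g (chart_inv c u))"
  have eq: "fibre_map ?X ?Y g ?F c d x = (\<lambda>v. \<chi> i. fderiv (?G c d) (snd c x) (v $ i))"
    if "c \<in> charts M" "x \<in> fst c" "d \<in> charts N" "g x \<in> fst d" for c d x
    by (rule ext) (rule fibre_map_tangent_map[OF assms(1,2,5,3,4,7,6) that])
  have 1: "?F p \<in> tangent_bundle k N \<and> jet_proj (?F p) = g (jet_proj p)" if "p \<in> tangent_bundle k M"
    for p
    using tangent_map_in[OF assms(1,2,5) that] tangent_map_proj[OF assms(1,2,5) that] by simp
  have 2: "bounded_linear (fibre_map ?X ?Y g ?F c d x)"
    if "c \<in> charts M" "x \<in> fst c" "d \<in> charts N" "g x \<in> fst d" for c d x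
    unfolding eq[OF that] by (rule bounded_linear_vec_map)
  have 3: "smooth_on (snd c ` fst c) (\<lambda>u. Blinfun (fibre_map ?X ?Y g ?F c d (chart_inv c u)))"
    if c: "c \<in> charts M" and d: "d \<in> charts N" and sub: "g ` fst c \<subseteq> fst d" for c d
  proof (rule smooth_on_cong)
    have C: "is_chart c" by (rule chart_is_chart[OF c])
    let ?L = "\<lambda>A. Blinfun (\<lambda>v :: ('e, 'k) vec. (\<chi> i. blinfun_apply A (v $ i)) :: ('f, 'k) vec)"
    show "smooth_on (snd c ` fst c) (\<lambda>u. ?L (fderiv (?G c d) u))"
      unfolding smooth_on_iff_smooth_at
    proof (intro conjI ballI chart_open[OF C])
      fix u assume "u \<in> snd c ` fst c"
      then obtain x where x: "x \<in> fst c" "u = snd c x" by blast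
      have "smooth_at (?G c d) u"
        unfolding x(2) by (rule smooth_map_at(1)[OF assms(1,2,5) c x(1) d]) (use sub x in blast)
      then show "smooth_at (\<lambda>u. ?L (fderiv (?G c d) u)) u"
        by (intro smooth_at_linear_compose[OF bounded_linear_Blinfun_vec_map] smooth_at_fderiv)
    qed
    fix u assume "u \<in> snd c ` fst c"
    then obtain x where x: "x \<in> fst c" "u = snd c x" by blast
    have "g x \<in> fst d" using sub x by blast
    then show "?L (fderiv (?G c d) u) = Blinfun (fibre_map ?X ?Y g ?F c d (chart_inv c u))"
      using x eq[OF c x(1) d] by (simp add: chart_inv_left[OF C])
  qed
  show ?thesis
    unfolding vbundle_morphism_def
  proof (intro conjI ballI)
    fix p assume "p \<in> total_space ?X"
    then show "?F p \<in> total_space ?Y" "bundle_proj ?Y (?F p) = g (bundle_proj ?X p)"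
      using 1 by (simp_all add: induced_bundle_def)
  next
    fix c assume "c \<in> charts (base_atlas ?X)"
    then have c: "c \<in> charts M" by (simp add: induced_bundle_def)
    have "(\<forall>x\<in>fst c. g x \<in> fst d \<longrightarrow> bounded_linear (fibre_map ?X ?Y g ?F c d x)) \<and>
        (g ` fst c \<subseteq> fst d \<longrightarrow>
          smooth_on (snd c ` fst c) (\<lambda>u. Blinfun (fibre_map ?X ?Y g ?F c d (chart_inv c u))))"
      if "d \<in> charts (base_atlas ?Y)" for d
      using 2[OF c] 3[OF c] that by (simp add: induced_bundle_def)
    then show "case c of (U, \<phi>) \<Rightarrow> \<forall>(V, \<psi>)\<in>charts (base_atlas ?Y).
        (\<forall>x\<in>U. g x \<in> V \<longrightarrow> bounded_linear (fibre_map ?X ?Y g ?F (U, \<phi>) (V, \<psi>) x)) \<and>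
        (g ` U \<subseteq> V \<longrightarrow>
          smooth_on (\<phi> ` U) (\<lambda>u. Blinfun (fibre_map ?X ?Y g ?F (U, \<phi>) (V, \<psi>) (inv_into U \<phi> u))))"
      by (cases c) fastforce
  qed
qed

end
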